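(* Let $(M,g)$ be a two-dimensional oriented Riemannian manifold whose set $\Sigma$ of zeros of the curvature is a (possibly empty) closed one-dimensional submanifold of $M$, and let $\hat\Sigma=\pi^{-1}(\Sigma)$. If $f:M\to M$ is an orientation-preserving isometry of $(M,g)$, then $f^c$ is an isometry of $(SO(M,g)\setminus\hat\Sigma,\hat g)$, where $\hat g$ is the Wagner lift of $g$.
   Context: Let $K:M\to\mathbb{R}$ be the (Gaussian) curvature of $(M,g)$ and $\Sigma=\{x\in M: K(x)=0\}$. Let $\pi:SO(M,g)\to M$ be the principal $SO(2)$-bundle of positively oriented orthonormal frames, with right action $\{e_1,e_2\}\cdot r(\varphi)=\{\cos\varphi\, e_1+\sin\varphi\, e_2,\,-\sin\varphi\, e_1+\cos\varphi\, e_2\}$. The Levi-Civita connection of $g$ determines the $SO(2)$-invariant horizontal distribution $\mathcal{H}$ on $SO(M,g)$, complementary to the vertical distribution $V$ (tangent to the fibers). Let $\partial_\varphi$ be the fundamental vertical vector field, $\partial_\varphi|_p=\frac{d}{d\varphi}|_{\varphi=0}\, p\cdot r(\varphi)$; it spans $V$. The Wagner lift $\hat g$ of $g$ is the Riemannian metric on $SO(M,g)\setminus\hat\Sigma$ defined by: $\hat g(X,Y)_p=g(d\pi X,d\pi Y)$ for $X,Y\in\mathcal{H}_p$; $\hat g(X,Y)_p=0$ for $X\in\mathcal{H}_p$, $Y\in V_p$; and $\hat g(\partial_\varphi,\partial_\varphi)_p=1/K^2(\pi(p))$. For an orientation-preserving isometry $f$ of $(M,g)$, $f^c:SO(M,g)\to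 SO(M,g)$ is the diffeomorphism $\{e_1,e_2\}_x\mapsto\{df_x(e_1),df_x(e_2)\}$; it maps $SO(M,g)\setminus\hat\Sigma$ onto itself. *)

theory Defs
  imports "HOL-Analysis.Analysis"
begin

section \<open>Smooth maps between Euclidean spaces\<close>

text \<open>Meant for open sets only: the derivative is taken in the full space.\<close>

primrec Ck_on :: "nat \<Rightarrow> ('a::real_normed_vector \<Rightarrow> 'b::real_normed_vector) \<Rightarrow> 'a set \<Rightarrow> bool" where
  "Ck_on 0 f S \<longleftrightarrow> continuous_on S f"
| "Ck_on (Suc k) f S \<longleftrightarrow> (\<forall>x\<in>S. f differentiable (at x)) \<and>
     (\<forall>v. Ck_on k (\<lambda>x. frechet_derivative f (at x) v) S)"

definition smooth_on :: "('a::real_normed_vector \<Rightarrow> 'b::real_normed_vector) \<Rightarrow> 'a set \<Rightarrow> bool" where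
  "smooth_on f S \<longleftrightarrow> (\<forall>k. Ck_on k f S)"


section \<open>Smooth manifolds\<close>

text \<open>
  A chart is a pair of its domain and its coordinate map; the values of the coordinate map
  outside the domain are irrelevant.  A smooth manifold is given by an atlas. Its underlying set
  is the union of the chart domains and its topology is the one making all charts homeomorphisms
  onto open subsets of the model space.
\<close>

type_synonym ('m, 'e) chart = "'m set \<times> ('m \<Rightarrow> 'e)"

definition chart_inv :: "('m, 'e) chart \<Rightarrow> 'e \<Rightarrow> 'm" where
  "chart_inv c = inv_into (fst c) (snd c)"

definition transition :: "('m, 'e) chart \<Rightarrow> ('m, 'e) chart \<Rightarrow> 'e \<Rightarrow> 'e" where
  "transition c d = snd d \<circ> chart_inv c"

definition carrier_of :: "('m, 'e) chart set \<Rightarrow> 'm set" where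
  "carrier_of A = (\<Union>c\<in>A. fst c)"

definition charts_at :: "('m, 'e) chart set \<Rightarrow> 'm \<Rightarrow> ('m, 'e) chart set" where
  "charts_at A x = {c \<in> A. x \<in> fst c}"

definition is_chart :: "('m, 'e::euclidean_space) chart \<Rightarrow> bool" where
  "is_chart c \<longleftrightarrow> inj_on (snd c) (fst c) \<and> open (snd c ` fst c)"

definition compatible :: "('m, 'e::euclidean_space) chart \<Rightarrow> ('m, 'e) chart \<Rightarrow> bool" where
  "compatible c d \<longleftrightarrow>
     open (snd c ` (fst c \<inter> fst d)) \<and> smooth_on (transition c d) (snd c ` (fst c \<inter> fst d)) \<and>
     open (snd d ` (fst c \<inter> fst d)) \<and> smooth_on (transition d c) (snd d ` (fst c \<inter> fst d))"

definition smooth_atlas :: "('m, 'e::euclidean_space) chart set \<Rightarrow> bool" where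
  "smooth_atlas A \<longleftrightarrow> (\<forall>c\<in>A. is_chart c) \<and> (\<forall>c\<in>A. \<forall>d\<in>A. compatible c d)"

definition atlas_topology :: "('m, 'e::euclidean_space) chart set \<Rightarrow> 'm topology" where
  "atlas_topology A =
     topology (\<lambda>S. S \<subseteq> carrier_of A \<and> (\<forall>c\<in>A. open (snd c ` (S \<inter> fst c))))"

lemma openin_atlas_topology:
  assumes "smooth_atlas A"
  shows "openin (atlas_topology A) S \<longleftrightarrow>
    S \<subseteq> carrier_of A \<and> (\<forall>c\<in>A. open (snd c ` (S \<inter> fst c)))"
proof -
  let ?L = "\<lambda>S. S \<subseteq> carrier_of A \<and> (\<forall>c\<in>A. open (snd c ` (S \<inter> fst c)))"
  have "?L (S \<inter> T)" if S: "?L S" and T: "?L T" for S T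
  proof (intro conjI ballI)
    show "S \<inter> T \<subseteq> carrier_of A" using S by (simp add: le_infI1)
    fix c assume c: "c \<in> A"
    have inj: "inj_on (snd c) (fst c)"
      using assms c by (simp add: smooth_atlas_def is_chart_def)
    have "(S \<inter> T) \<inter> fst c = (S \<inter> fst c) \<inter> (T \<inter> fst c)" by blast
    then have "snd c ` (S \<inter> T \<inter> fst c) = snd c ` (S \<inter> fst c) \<inter> snd c ` (T \<inter> fst c)"
      using inj_on_image_Int[OF inj, of "S \<inter> fst c" "T \<inter> fst c"] by simp
    then show "open (snd c ` (S \<inter> T \<inter> fst c))"
      using S T c by (simp add: open_Int)
  qed
  moreover have "?L (\<Union>\<K>)" if K: "\<forall>S\<in>\<K>. ?L S" for \<K>
  proof (intro conjI ballI)
    show "\<Union>\<K> \<subseteq> carrier_of A" using K by (simp add: Sup_le_iff)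
    fix c assume c: "c \<in> A"
    have "snd c ` (\<Union>\<K> \<inter> fst c) = (\<Union>S\<in>\<K>. snd c ` (S \<inter> fst c))" by blast
    then show "open (snd c ` (\<Union>\<K> \<inter> fst c))"
      using K c by (simp add: open_UN)
  qed
  ultimately have "istopology ?L"
    unfolding istopology_def by (intro conjI allI impI) simp_all
  then show ?thesis
    by (simp add: atlas_topology_def topology_inverse')
qed

definition smooth_manifold :: "('m, 'e::euclidean_space) chart set \<Rightarrow> bool" where
  "smooth_manifold A \<longleftrightarrow> smooth_atlas A \<and>
     Hausdorff_space (atlas_topology A) \<and> second_countable (atlas_topology A)"

definition maximal_atlas :: "('m, 'e::euclidean_space) chart set \<Rightarrow> ('m, 'e) chart set" where
  "maximal_atlas A =
     {c. fst c \<subseteq> carrier_of A \<and> is_chart c \<and> (\<forall>d\<in>A. compatible c d)}"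

text \<open>Embedded submanifolds of dimension \<open>k\<close>, via slice charts; the empty set is one for every \<open>k\<close>.\<close>

definition submanifold :: "('m, 'e::euclidean_space) chart set \<Rightarrow> nat \<Rightarrow> 'm set \<Rightarrow> bool" where
  "submanifold A k S \<longleftrightarrow> S \<subseteq> carrier_of A \<and>
     (\<forall>x\<in>S. \<exists>c\<in>maximal_atlas A. x \<in> fst c \<and>
        (\<exists>L. subspace L \<and> dim L = k \<and> snd c ` (fst c \<inter> S) = snd c ` fst c \<inter> L))"

text \<open>
  Maps between the open subsets \<open>W\<close> and \<open>W'\<close> of two manifolds, regarded as open submanifolds.
\<close>

definition smooth_map ::
  "('m, 'e::euclidean_space) chart set \<Rightarrow> 'm set \<Rightarrow> ('n, 'f::euclidean_space) chart set \<Rightarrow> 'n set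
   \<Rightarrow> ('m \<Rightarrow> 'n) \<Rightarrow> bool" where
  "smooth_map A W B W' f \<longleftrightarrow> f ` W \<subseteq> W' \<and>
     (\<forall>c\<in>A. \<forall>d\<in>B.
        let D = snd c ` (fst c \<inter> W \<inter> f -` fst d)
        in open D \<and> smooth_on (snd d \<circ> f \<circ> chart_inv c) D)"

definition diffeomorphism ::
  "('m, 'e::euclidean_space) chart set \<Rightarrow> 'm set \<Rightarrow> ('n, 'f::euclidean_space) chart set \<Rightarrow> 'n set
   \<Rightarrow> ('m \<Rightarrow> 'n) \<Rightarrow> bool" where
  "diffeomorphism A W B W' f \<longleftrightarrow>
     bij_betw f W W' \<and> smooth_map A W B W' f \<and> smooth_map B W' A W (inv_into W f)"


section \<open>Tangent vectors\<close>

text \<open>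
  A tangent vector at \<open>x\<close> assigns to each chart of the atlas around \<open>x\<close> its coordinate vector in that
  chart, the coordinate vectors in different charts being related by the Jacobian of the transition
  map. To make the representation unique, it is zero on everything that is not a chart around \<open>x\<close>.
  Sums and scalar multiples are formed pointwise.
\<close>

type_synonym ('m, 'e) tvec = "('m, 'e) chart \<Rightarrow> 'e"

definition tangent_space ::
  "('m, 'e::euclidean_space) chart set \<Rightarrow> 'm \<Rightarrow> ('m, 'e) tvec set" where
  "tangent_space A x = {v.
     (\<forall>c\<in>charts_at A x. \<forall>d\<in>charts_at A x.
        v d = frechet_derivative (transition c d) (at (snd c x)) (v c)) \<and>
     (\<forall>c. c \<notin> charts_at A x \<longrightarrow> v c = 0)}"

text \<open>The tangent vector at \<open>x\<close> whose coordinate vector in the chart \<open>c\<close> is \<open>a\<close>.\<close>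

definition coord_vector ::
  "('m, 'e::euclidean_space) chart set \<Rightarrow> ('m, 'e) chart \<Rightarrow> 'm \<Rightarrow> 'e \<Rightarrow> ('m, 'e) tvec" where
  "coord_vector A c x a =
     (\<lambda>d. if d \<in> charts_at A x
          then frechet_derivative (transition c d) (at (snd c x)) a else 0)"

text \<open>
  Derivatives are computed in an arbitrary chart around the base point; for smooth maps the result
  does not depend on that choice.
\<close>

definition fun_differential ::
  "('m, 'e::euclidean_space) chart set \<Rightarrow> ('m \<Rightarrow> 'b::real_normed_vector) \<Rightarrow> 'm
   \<Rightarrow> ('m, 'e) tvec \<Rightarrow> 'b" where
  "fun_differential A F x v =
     (let c = (SOME c. c \<in> charts_at A x)
      in frechet_derivative (F \<circ> chart_inv c) (at (snd c x)) (v c))"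

definition differential ::
  "('m, 'e::euclidean_space) chart set \<Rightarrow> ('n, 'f::euclidean_space) chart set \<Rightarrow> ('m \<Rightarrow> 'n) \<Rightarrow> 'm
   \<Rightarrow> ('m, 'e) tvec \<Rightarrow> ('n, 'f) tvec" where
  "differential A B f x v =
     (\<lambda>d. if d \<in> charts_at B (f x) then fun_differential A (snd d \<circ> f) x v else 0)"

definition velocity ::
  "('m, 'e::euclidean_space) chart set \<Rightarrow> (real \<Rightarrow> 'm) \<Rightarrow> real \<Rightarrow> ('m, 'e) tvec" where
  "velocity A \<gamma> t =
     (\<lambda>d. if d \<in> charts_at A (\<gamma> t) then vector_derivative (snd d \<circ> \<gamma>) (at t) else 0)"


section \<open>Riemannian metrics\<close>

type_synonym ('m, 'e) metric = "'m \<Rightarrow> ('m, 'e) tvec \<Rightarrow> ('m, 'e) tvec \<Rightarrow> real"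

definition sym_bilinear_on ::
  "('m, 'e::euclidean_space) tvec set \<Rightarrow> (('m, 'e) tvec \<Rightarrow> ('m, 'e) tvec \<Rightarrow> real) \<Rightarrow> bool" where
  "sym_bilinear_on T h \<longleftrightarrow>
     (\<forall>v\<in>T. \<forall>w\<in>T. h v w = h w v) \<and>
     (\<forall>v\<in>T. \<forall>w\<in>T. \<forall>z\<in>T. \<forall>a b.
        h (\<lambda>c. a *\<^sub>R v c + b *\<^sub>R w c) z = a * h v z + b * h w z)"

text \<open>\<open>metric_coord A g c u a b\<close> is \<open>\<Sum>i j. g\<^sub>i\<^sub>j(u) a\<^sub>i b\<^sub>j\<close> in the chart \<open>c\<close>.\<close>

definition metric_coord ::
  "('m, 'e::euclidean_space) chart set \<Rightarrow> ('m, 'e) metric \<Rightarrow> ('m, 'e) chart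
   \<Rightarrow> 'e \<Rightarrow> 'e \<Rightarrow> 'e \<Rightarrow> real" where
  "metric_coord A g c u a b =
     (let x = chart_inv c u in g x (coord_vector A c x a) (coord_vector A c x b))"

definition riemannian_metric ::
  "('m, 'e::euclidean_space) chart set \<Rightarrow> ('m, 'e) metric \<Rightarrow> bool" where
  "riemannian_metric A g \<longleftrightarrow>
     (\<forall>x\<in>carrier_of A. sym_bilinear_on (tangent_space A x) (g x) \<and>
        (\<forall>v\<in>tangent_space A x. v \<noteq> (\<lambda>c. 0) \<longrightarrow> g x v v > 0)) \<and>
     (\<forall>c\<in>A. \<forall>a b. smooth_on (\<lambda>u. metric_coord A g c u a b) (snd c ` fst c))"

definition riemannian_isometry ::
  "('m, 'e::euclidean_space) chart set \<Rightarrow> 'm set \<Rightarrow> ('m, 'e) metric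
   \<Rightarrow> ('n, 'f::euclidean_space) chart set \<Rightarrow> 'n set \<Rightarrow> ('n, 'f) metric \<Rightarrow> ('m \<Rightarrow> 'n) \<Rightarrow> bool" where
  "riemannian_isometry A W g B W' h f \<longleftrightarrow> diffeomorphism A W B W' f \<and>
     (\<forall>x\<in>W. \<forall>v\<in>tangent_space A x. \<forall>w\<in>tangent_space A x.
        h (f x) (differential A B f x v) (differential A B f x w) = g x v w)"

text \<open>
  The Levi-Civita connection in the chart \<open>c\<close>, \<open>\<nabla>\<^sub>v Z = DZ(v) + \<Gamma>(v, Z)\<close>. Its Christoffel symbols at \<open>u\<close>
  are the only ones for which it is torsion-free (\<open>\<Gamma>\<close> symmetric) and compatible with the metric.
\<close>

definition christoffel ::
  "('m, 'e::euclidean_space) chart set \<Rightarrow> ('m, 'e) metric \<Rightarrow> ('m, 'e) chart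
   \<Rightarrow> 'e \<Rightarrow> 'e \<Rightarrow> 'e \<Rightarrow> 'e" where
  "christoffel A g c u = (THE \<Gamma>. bilinear \<Gamma> \<and> (\<forall>v w. \<Gamma> v w = \<Gamma> w v) \<and>
     (\<forall>v w z. frechet_derivative (\<lambda>u. metric_coord A g c u w z) (at u) v =
        metric_coord A g c u (\<Gamma> v w) z + metric_coord A g c u w (\<Gamma> v z)))"

text \<open>\<open>R(v, w)z = \<nabla>\<^sub>v \<nabla>\<^sub>w z - \<nabla>\<^sub>w \<nabla>\<^sub>v z\<close> for vector fields \<open>v\<close>, \<open>w\<close>, \<open>z\<close> with constant coordinates.\<close>

definition curvature_tensor ::
  "('m, 'e::euclidean_space) chart set \<Rightarrow> ('m, 'e) metric \<Rightarrow> ('m, 'e) chart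
   \<Rightarrow> 'e \<Rightarrow> 'e \<Rightarrow> 'e \<Rightarrow> 'e \<Rightarrow> 'e" where
  "curvature_tensor A g c u v w z =
     (let \<Gamma> = christoffel A g c in
      frechet_derivative (\<lambda>u. \<Gamma> u w z) (at u) v - frechet_derivative (\<lambda>u. \<Gamma> u v z) (at u) w
      + \<Gamma> u v (\<Gamma> u w z) - \<Gamma> u w (\<Gamma> u v z))"

definition gauss_curvature ::
  "('m, real^2) chart set \<Rightarrow> ('m, real^2) metric \<Rightarrow> 'm \<Rightarrow> real" where
  "gauss_curvature A g x =
     (let c = (SOME c. c \<in> charts_at A x); u = snd c x; G = metric_coord A g c u;
          a = axis 1 1; b = axis 2 1
      in G (curvature_tensor A g c u a b b) a / (G a a * G b b - (G a b)\<^sup>2))"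


section \<open>Oriented surfaces\<close>

text \<open>An orientation is given by an atlas all of whose charts are positively oriented.\<close>

definition oriented_atlas :: "('m, real^2) chart set \<Rightarrow> bool" where
  "oriented_atlas A \<longleftrightarrow> (\<forall>c\<in>A. \<forall>d\<in>A. \<forall>x\<in>fst c \<inter> fst d.
     det (matrix (frechet_derivative (transition c d) (at (snd c x)))) > 0)"

definition positive_basis ::
  "('m, real^2) chart set \<Rightarrow> 'm \<Rightarrow> ('m, real^2) tvec \<Rightarrow> ('m, real^2) tvec \<Rightarrow> bool" where
  "positive_basis A x v w \<longleftrightarrow> (\<forall>c\<in>charts_at A x. det (vector [v c, w c] :: real^2^2) > 0)"

definition orientation_preserving :: "('m, real^2) chart set \<Rightarrow> ('m \<Rightarrow> 'm) \<Rightarrow> bool" where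
  "orientation_preserving A f \<longleftrightarrow>
     (\<forall>x\<in>carrier_of A. \<forall>v\<in>tangent_space A x. \<forall>w\<in>tangent_space A x.
        positive_basis A x v w \<longrightarrow>
        positive_basis A (f x) (differential A A f x v) (differential A A f x w))"


section \<open>The bundle of positively oriented orthonormal frames\<close>

type_synonym 'm frame = "'m \<times> ('m, real^2) tvec \<times> ('m, real^2) tvec"

definition frame_bundle ::
  "('m, real^2) chart set \<Rightarrow> ('m, real^2) metric \<Rightarrow> 'm frame set" where
  "frame_bundle A g = {(x, e1, e2). x \<in> carrier_of A \<and>
     e1 \<in> tangent_space A x \<and> e2 \<in> tangent_space A x \<and>
     g x e1 e1 = 1 \<and> g x e2 e2 = 1 \<and> g x e1 e2 = 0 \<and> positive_basis A x e1 e2}"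

definition rotate_frame :: "'m frame \<Rightarrow> real \<Rightarrow> 'm frame" where
  "rotate_frame = (\<lambda>(x, e1, e2) t.
     (x, \<lambda>c. cos t *\<^sub>R e1 c + sin t *\<^sub>R e2 c, \<lambda>c. - sin t *\<^sub>R e1 c + cos t *\<^sub>R e2 c))"

text \<open>
  The smooth structure: a smooth section \<open>s\<close> over the domain of a chart \<open>c\<close> of the surface yields the
  local trivialization \<open>(x, t) \<mapsto> s(x)\<cdot>r(t)\<close>, which restricted to angles \<open>t\<close> in an open interval of
  length \<open>2\<pi>\<close> is the inverse of a chart of the bundle.
\<close>

definition smooth_section ::
  "('m, real^2) chart set \<Rightarrow> ('m, real^2) metric \<Rightarrow> ('m, real^2) chart \<Rightarrow> ('m \<Rightarrow> 'm frame) \<Rightarrow> bool" where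
  "smooth_section A g c s \<longleftrightarrow>
     (\<forall>x\<in>fst c. s x \<in> frame_bundle A g \<and> fst (s x) = x) \<and>
     smooth_on (\<lambda>u. fst (snd (s (chart_inv c u))) c) (snd c ` fst c) \<and>
     smooth_on (\<lambda>u. snd (snd (s (chart_inv c u))) c) (snd c ` fst c)"

definition frame_chart ::
  "('m, real^2) chart \<Rightarrow> ('m \<Rightarrow> 'm frame) \<Rightarrow> real \<Rightarrow> ('m frame, (real^2) \<times> real) chart" where
  "frame_chart c s a =
     (let P = (\<lambda>(u, t). rotate_frame (s (chart_inv c u)) t);
          D = (snd c ` fst c) \<times> {a - pi <..< a + pi}
      in (P ` D, inv_into D P))"

definition frame_atlas ::
  "('m, real^2) chart set \<Rightarrow> ('m, real^2) metric \<Rightarrow> ('m frame, (real^2) \<times> real) chart set" where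
  "frame_atlas A g = {frame_chart c s a |c s a. c \<in> A \<and> smooth_section A g c s}"

abbreviation frame_proj :: "'m frame \<Rightarrow> 'm" where
  "frame_proj \<equiv> fst"

definition frame_map :: "('m, real^2) chart set \<Rightarrow> ('m \<Rightarrow> 'm) \<Rightarrow> 'm frame \<Rightarrow> 'm frame" where
  "frame_map A f = (\<lambda>(x, e1, e2). (f x, differential A A f x e1, differential A A f x e2))"


section \<open>The Wagner lift\<close>

definition vertical_space ::
  "('m, real^2) chart set \<Rightarrow> ('m, real^2) metric \<Rightarrow> 'm frame
   \<Rightarrow> ('m frame, (real^2) \<times> real) tvec set" where
  "vertical_space A g p =
     {X \<in> tangent_space (frame_atlas A g) p. differential (frame_atlas A g) A frame_proj p X = (\<lambda>c. 0)}"

text \<open>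
  The horizontal distribution of the Levi-Civita connection: along the direction \<open>X\<close>, both frame
  vectors have vanishing covariant derivative \<open>de\<^sub>i(X) + \<Gamma>(d\<pi>(X), e\<^sub>i)\<close>.
\<close>

definition horizontal_space ::
  "('m, real^2) chart set \<Rightarrow> ('m, real^2) metric \<Rightarrow> 'm frame
   \<Rightarrow> ('m frame, (real^2) \<times> real) tvec set" where
  "horizontal_space A g p =
     {X \<in> tangent_space (frame_atlas A g) p. \<forall>c\<in>charts_at A (frame_proj p).
        let \<Gamma> = christoffel A g c (snd c (frame_proj p));
            w = differential (frame_atlas A g) A frame_proj p X c
        in fun_differential (frame_atlas A g) (\<lambda>(y, e1, e2). e1 c) p X + \<Gamma> w (fst (snd p) c) = 0 \<and>
           fun_differential (frame_atlas A g) (\<lambda>(y, e1, e2). e2 c) p X + \<Gamma> w (snd (snd p) c) = 0}"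

definition fundamental_vector ::
  "('m, real^2) chart set \<Rightarrow> ('m, real^2) metric \<Rightarrow> 'm frame
   \<Rightarrow> ('m frame, (real^2) \<times> real) tvec" where
  "fundamental_vector A g p = velocity (frame_atlas A g) (rotate_frame p) 0"

text \<open>
  The three conditions determine the bilinear form on the tangent space at \<open>p\<close>; the choice operator
  only fixes its irrelevant values on arguments that are not tangent vectors at \<open>p\<close>.
  Meaningful at frames over points of nonzero curvature.
\<close>

definition wagner_lift ::
  "('m, real^2) chart set \<Rightarrow> ('m, real^2) metric \<Rightarrow> ('m frame, (real^2) \<times> real) metric" where
  "wagner_lift A g p = (SOME h.
     sym_bilinear_on (tangent_space (frame_atlas A g) p) h \<and>
     (\<forall>X\<in>horizontal_space A g p. \<forall>Y\<in>horizontal_space A g p.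
        h X Y = g (frame_proj p) (differential (frame_atlas A g) A frame_proj p X)
                                 (differential (frame_atlas A g) A frame_proj p Y)) \<and>
     (\<forall>X\<in>horizontal_space A g p. \<forall>Y\<in>vertical_space A g p. h X Y = 0) \<and>
     h (fundamental_vector A g p) (fundamental_vector A g p)
       = 1 / (gauss_curvature A g (frame_proj p))\<^sup>2)"

end

theory Submission
  imports Defs
begin

text \<open>
  Everything that enters the Wagner lift is natural under orientation-preserving isometries.
  Let \<open>\<phi>\<close> be the coordinate expression of \<open>f\<close> in two charts.  Differentiating \<open>G = \<phi>\<^sup>* H\<close> and using that
  the Christoffel symbols are determined by symmetry and metricity gives
  \<open>D\<phi>(\<Gamma>(v, w)) = \<Gamma>'(D\<phi> v, D\<phi> w) + D\<^sup>2\<phi>(v, w)\<close>; differentiating once more gives the invariance of the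
  curvature.  Since \<open>f\<^sup>c\<close> commutes with the rotations and covers \<open>f\<close>, its differential
  preserves the fundamental vector field, the vertical spaces and, by the above law, the horizontal spaces.  Hence the pullback of the
  Wagner lift at \<open>f\<^sup>c(p)\<close> satisfies the conditions characterising the Wagner lift at \<open>p\<close>, and these
  determine the form because the tangent space is spanned by the horizontal space and the fundamental vector.
  The case \<open>f = id\<close> of the transformation laws yields independence of charts throughout, including
  the smoothness of the transition maps of the frame bundle.
\<close>


section \<open>Calculus of smooth maps\<close>

text \<open>Three obstacles shape the proof. First, the definitions pick charts by
  \<open>SOME\<close> or quantify over all of them; so metric, connection and curvature are treated
  as formulas on open sets of the plane (\<open>local_metric\<close>,
  \<open>local_isometry\<close>), and each transformation law is proved for an arbitrary pair of
  charts. Second, \<open>christoffel\<close> is a \<open>THE\<close> term and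
  \<open>wagner_lift\<close> a \<open>SOME\<close> term, so existence has to be shown before their
  properties can be used; for the Christoffel symbols an explicit formula is needed, because they
  are differentiated again in the curvature. Third, regularity of \<open>G\<close> and \<Gamma> is
  stated for constant arguments only; where a varying vector is inserted, it is expanded in the
  basis. The term \<open>D\<^sup>2\<phi>\<close> in the law for \<Gamma> must be symmetric for the
  uniqueness argument to apply, hence the section on second derivatives. On the bundle the delicate
  coordinate is the angle: it must be recovered smoothly from a frame over a whole open interval of
  length 2 pi, which a half-angle formula does.\<close>

lemma frechet_derivative_has:
  "f differentiable (at x) \<Longrightarrow> (f has_derivative frechet_derivative f (at x)) (at x)"
  using frechet_derivative_works by blast

lemma frechet_derivative_eqI:
  "(f has_derivative f') (at x) \<Longrightarrow> frechet_derivative f (at x) = f'"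
  by (metis frechet_derivative_at)

text \<open>Holds even where no derivative exists: \<open>frechet_derivative\<close> chooses among
  the derivatives of a function, and functions that agree near \<open>x\<close> have the same
  ones.\<close>

lemma frechet_derivative_cong_open:
  assumes "open S" "x \<in> S" "\<And>y. y \<in> S \<Longrightarrow> f y = g y"
  shows "frechet_derivative f (at x) = frechet_derivative g (at x)"
proof -
  have "(f has_derivative D) (at x) = (g has_derivative D) (at x)" for D
    using assms has_derivative_transform_within_open by (metis (no_types, lifting))
  then show ?thesis by (simp add: frechet_derivative_def)
qed

lemma differentiable_cong_open:
  assumes "open S" "x \<in> S" "\<And>y. y \<in> S \<Longrightarrow> f y = g y"
  shows "f differentiable (at x) \<longleftrightarrow> g differentiable (at x)"
  unfolding differentiable_def
  using assms has_derivative_transform_within_open by (metis (no_types, lifting))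

lemma Ck_on_cong:
  assumes "open S" "\<And>x. x \<in> S \<Longrightarrow> f x = g x" "Ck_on k f S"
  shows "Ck_on k g S"
  using assms(2,3)
proof (induction k arbitrary: f g)
  case 0
  then show ?case by (metis Ck_on.simps(1) continuous_on_cong)
next
  case (Suc k)
  have d: "frechet_derivative f (at x) = frechet_derivative g (at x)" if "x \<in> S" for x
    by (rule frechet_derivative_cong_open[OF assms(1) that]) (use Suc in auto)
  have "g differentiable (at x)" if "x \<in> S" for x
    using differentiable_cong_open[OF assms(1) that, of f g] Suc.prems that by auto
  moreover have "Ck_on k (\<lambda>x. frechet_derivative g (at x) v) S" for v
    by (rule Suc.IH[of "\<lambda>x. frechet_derivative f (at x) v"]) (use Suc d in auto)
  ultimately show ?case by simp
qed

lemma Ck_on_subset: "Ck_on k f S \<Longrightarrow> T \<subseteq> S \<Longrightarrow> Ck_on k f T"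
proof (induction k arbitrary: f)
  case 0
  then show ?case using continuous_on_subset by auto
next
  case (Suc k)
  then show ?case by (metis Ck_on.simps(2) subsetD)
qed

lemma Ck_on_continuous: "Ck_on k f S \<Longrightarrow> continuous_on S f"
  by (cases k) (auto intro!: differentiable_imp_continuous_within continuous_at_imp_continuous_on)

lemma Ck_on_Suc_imp: "Ck_on (Suc k) f S \<Longrightarrow> Ck_on k f S"
proof (induction k arbitrary: f)
  case 0
  then show ?case using Ck_on_continuous by (metis Ck_on.simps(1))
next
  case (Suc k)
  then show ?case by (metis Ck_on.simps(2))
qed

text \<open>Replaces \<open>frechet_derivative\<close> by a derivative given explicitly, so that the
  closure properties below can be proved with the usual derivative rules.\<close>

lemma Ck_on_SucI:
  assumes "open S" "\<And>x. x \<in> S \<Longrightarrow> (f has_derivative f' x) (at x)"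
    and "\<And>v. Ck_on k (\<lambda>x. f' x v) S"
  shows "Ck_on (Suc k) f S"
proof -
  have "f differentiable (at x)" if "x \<in> S" for x
    using assms(2)[OF that] differentiableI by blast
  moreover have "Ck_on k (\<lambda>x. frechet_derivative f (at x) v) S" for v
    by (rule Ck_on_cong[OF assms(1) _ assms(3)]) (simp add: frechet_derivative_eqI[OF assms(2)])
  ultimately show ?thesis by simp
qed

lemma Ck_on_SucD:
  assumes "Ck_on (Suc k) f S" "x \<in> S"
  shows "(f has_derivative frechet_derivative f (at x)) (at x)"
  using assms frechet_derivative_has by auto

lemma Ck_on_const: "Ck_on k (\<lambda>x. c) S"
  by (induction k arbitrary: c) auto

lemma Ck_on_ident: "Ck_on k (\<lambda>x. x) S"
  by (cases k) (auto simp: Ck_on_const)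

lemma Ck_on_add:
  assumes "open S" "Ck_on k f S" "Ck_on k g S"
  shows "Ck_on k (\<lambda>x. f x + g x) S"
  using assms(2,3)
proof (induction k arbitrary: f g)
  case 0
  then show ?case by (auto intro: continuous_on_add)
next
  case (Suc k)
  show ?case
    by (rule Ck_on_SucI[OF assms(1) has_derivative_add[OF Ck_on_SucD[OF Suc.prems(1)] Ck_on_SucD[OF Suc.prems(2)]]])
      (use Suc in auto)
qed

lemma Ck_on_bounded_linear:
  assumes "open S" "bounded_linear L" "Ck_on k f S"
  shows "Ck_on k (\<lambda>x. L (f x)) S"
  using assms(3)
proof (induction k arbitrary: f)
  case 0
  then show ?case using assms(2) by (auto intro: bounded_linear.continuous_on)
next
  case (Suc k)
  show ?case
    by (rule Ck_on_SucI[OF assms(1) bounded_linear.has_derivative[OF assms(2) Ck_on_SucD[OF Suc.prems]]])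
      (use Suc in auto)
qed

lemma Ck_on_bounded_bilinear:
  assumes "open S" "bounded_bilinear B" "Ck_on k f S" "Ck_on k g S"
  shows "Ck_on k (\<lambda>x. B (f x) (g x)) S"
  using assms(3,4)
proof (induction k arbitrary: f g)
  case 0
  then show ?case using assms(2) by (auto intro: bounded_bilinear.continuous_on)
next
  case (Suc k)
  show ?case
    by (rule Ck_on_SucI[OF assms(1) bounded_bilinear.FDERIV[OF assms(2) Ck_on_SucD[OF Suc.prems(1)] Ck_on_SucD[OF Suc.prems(2)]]])
      (use Suc in \<open>auto intro!: Ck_on_add assms(1) Suc.IH Ck_on_Suc_imp[OF Suc.prems(1)] Ck_on_Suc_imp[OF Suc.prems(2)]\<close>)
qed

lemma Ck_on_sum:
  assumes "open S" "\<And>i. i \<in> I \<Longrightarrow> Ck_on k (f i) S"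
  shows "Ck_on k (\<lambda>x. \<Sum>i\<in>I. f i x) S"
  using assms(2)
proof (induction I rule: infinite_finite_induct)
  case (insert x F)
  then show ?case by (auto intro!: Ck_on_add assms(1))
qed (auto intro: Ck_on_const)

lemma linear_basis_sum:
  fixes L :: "'a::euclidean_space \<Rightarrow> 'b::real_vector"
  assumes "linear L"
  shows "L v = (\<Sum>b\<in>Basis. (v \<bullet> b) *\<^sub>R L b)"
proof -
  have "L v = L (\<Sum>b\<in>Basis. (v \<bullet> b) *\<^sub>R b)" by (simp add: euclidean_representation)
  also have "\<dots> = (\<Sum>b\<in>Basis. (v \<bullet> b) *\<^sub>R L b)"
    using assms by (simp add: linear_sum linear_scale)
  finally show ?thesis .
qed

text \<open>The chain rule evaluates the derivative of \<open>g\<close> on the moving vector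
  \<open>?Df x v\<close>, while \<open>Ck_on\<close> controls it for fixed directions only.
  Expanding that vector in the basis gives a sum of products to which the induction hypothesis
  applies; this is why the middle space is Euclidean.\<close>

lemma Ck_on_compose:
  fixes f :: "'a::real_normed_vector \<Rightarrow> 'b::euclidean_space"
    and g :: "'b \<Rightarrow> 'c::real_normed_vector"
  assumes "open S" "open T" "Ck_on k f S" "Ck_on k g T" "f ` S \<subseteq> T"
  shows "Ck_on k (\<lambda>x. g (f x)) S"
  using assms(3-5)
proof (induction k arbitrary: f g)
  case 0
  then show ?case using continuous_on_compose2[of T g S f] by simp
next
  case (Suc k)
  let ?Df = "\<lambda>x. frechet_derivative f (at x)" and ?Dg = "\<lambda>x. frechet_derivative g (at x)"
  have der: "((\<lambda>x. g (f x)) has_derivative (\<lambda>v. \<Sum>b\<in>Basis. (?Df x v \<bullet> b) *\<^sub>R ?Dg (f x) b)) (at x)"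
    if x: "x \<in> S" for x
  proof -
    have fx: "f x \<in> T" using Suc.prems x by blast
    have lin: "linear (?Dg (f x))"
      using Ck_on_SucD[OF Suc.prems(2) fx] has_derivative_linear by blast
    have "((g \<circ> f) has_derivative (?Dg (f x) \<circ> ?Df x)) (at x)"
      by (rule diff_chain_at[OF Ck_on_SucD[OF Suc.prems(1) x] Ck_on_SucD[OF Suc.prems(2) fx]])
    moreover have "?Dg (f x) \<circ> ?Df x = (\<lambda>v. \<Sum>b\<in>Basis. (?Df x v \<bullet> b) *\<^sub>R ?Dg (f x) b)"
      by (rule ext, unfold o_apply, rule linear_basis_sum[OF lin])
    ultimately show ?thesis by (simp add: o_def)
  qed
  show ?case
  proof (rule Ck_on_SucI[OF assms(1) der])
    fix v
    show "Ck_on k (\<lambda>x. \<Sum>b\<in>Basis. (?Df x v \<bullet> b) *\<^sub>R ?Dg (f x) b) S"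
    proof (rule Ck_on_sum[OF assms(1)], rule Ck_on_bounded_bilinear[OF assms(1) bounded_bilinear_scaleR])
      fix b
      show "Ck_on k (\<lambda>x. ?Df x v \<bullet> b) S"
        using Suc.prems(1) by (intro Ck_on_bounded_linear[OF assms(1) bounded_linear_inner_left]) auto
      show "Ck_on k (\<lambda>x. ?Dg (f x) b) S"
        using Suc.prems by (intro Suc.IH[of f] Ck_on_Suc_imp[of k f]) auto
    qed
  qed
qed

lemma Ck_on_DERIV:
  fixes f :: "real \<Rightarrow> real"
  assumes "open S" "\<And>x. x \<in> S \<Longrightarrow> (f has_field_derivative f' x) (at x)" "Ck_on k f' S"
  shows "Ck_on (Suc k) f S"
  by (rule Ck_on_SucI[where f' = "\<lambda>x. (*) (f' x)"])
    (use assms in \<open>auto intro!: Ck_on_bounded_bilinear[OF _ bounded_bilinear_mult] Ck_on_const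
      simp: has_field_derivative_def\<close>)

section \<open>Closure properties of smooth functions and the elementary functions\<close>

lemma smooth_on_cong:
  "open S \<Longrightarrow> (\<And>x. x \<in> S \<Longrightarrow> f x = g x) \<Longrightarrow> smooth_on f S \<Longrightarrow> smooth_on g S"
  by (metis smooth_on_def Ck_on_cong)

lemma smooth_on_subset: "smooth_on f S \<Longrightarrow> T \<subseteq> S \<Longrightarrow> smooth_on f T"
  by (metis smooth_on_def Ck_on_subset)

lemma smooth_on_continuous: "smooth_on f S \<Longrightarrow> continuous_on S f"
  by (metis smooth_on_def Ck_on_continuous)

lemma smooth_on_has_derivative:
  "smooth_on f S \<Longrightarrow> x \<in> S \<Longrightarrow> (f has_derivative frechet_derivative f (at x)) (at x)"
  by (meson Ck_on_SucD smooth_on_def)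

lemma smooth_on_differentiable: "smooth_on f S \<Longrightarrow> x \<in> S \<Longrightarrow> f differentiable (at x)"
  using smooth_on_has_derivative differentiableI by blast

lemma smooth_on_linear_derivative: "smooth_on f S \<Longrightarrow> x \<in> S \<Longrightarrow> linear (frechet_derivative f (at x))"
  using smooth_on_has_derivative has_derivative_linear by blast

lemma smooth_on_frechet_derivative_const:
  "smooth_on f S \<Longrightarrow> smooth_on (\<lambda>x. frechet_derivative f (at x) v) S"
  unfolding smooth_on_def using Ck_on.simps(2) by blast

lemma smooth_on_const [simp]: "smooth_on (\<lambda>x. c) S"
  by (simp add: smooth_on_def Ck_on_const)

lemma smooth_on_ident [simp]: "smooth_on (\<lambda>x. x) S"
  by (simp add: smooth_on_def Ck_on_ident)

lemma smooth_on_bounded_linear: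
  "open S \<Longrightarrow> bounded_linear L \<Longrightarrow> smooth_on f S \<Longrightarrow> smooth_on (\<lambda>x. L (f x)) S"
  by (simp add: smooth_on_def Ck_on_bounded_linear)

lemma smooth_on_bounded_bilinear:
  "open S \<Longrightarrow> bounded_bilinear B \<Longrightarrow> smooth_on f S \<Longrightarrow> smooth_on g S \<Longrightarrow> smooth_on (\<lambda>x. B (f x) (g x)) S"
  by (simp add: smooth_on_def Ck_on_bounded_bilinear)

lemma smooth_on_add:
  "open S \<Longrightarrow> smooth_on f S \<Longrightarrow> smooth_on g S \<Longrightarrow> smooth_on (\<lambda>x. f x + g x) S"
  by (simp add: smooth_on_def Ck_on_add)

lemma smooth_on_uminus: "open S \<Longrightarrow> smooth_on f S \<Longrightarrow> smooth_on (\<lambda>x. - f x) S"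
  using smooth_on_bounded_linear[OF _ bounded_linear_minus[OF bounded_linear_ident]] by blast

lemma smooth_on_diff:
  "open S \<Longrightarrow> smooth_on f S \<Longrightarrow> smooth_on g S \<Longrightarrow> smooth_on (\<lambda>x. f x - g x) S"
  using smooth_on_add[of S f "\<lambda>x. - g x"] smooth_on_uminus[of S g] by simp

lemma smooth_on_sum:
  "open S \<Longrightarrow> (\<And>i. i \<in> I \<Longrightarrow> smooth_on (f i) S) \<Longrightarrow> smooth_on (\<lambda>x. \<Sum>i\<in>I. f i x) S"
  by (simp add: smooth_on_def Ck_on_sum)

lemma smooth_on_scaleR:
  "open S \<Longrightarrow> smooth_on f S \<Longrightarrow> smooth_on g S \<Longrightarrow> smooth_on (\<lambda>x. f x *\<^sub>R g x) S"
  by (rule smooth_on_bounded_bilinear[OF _ bounded_bilinear_scaleR])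

lemma smooth_on_mult:
  fixes f g :: "'a::real_normed_vector \<Rightarrow> real"
  shows "open S \<Longrightarrow> smooth_on f S \<Longrightarrow> smooth_on g S \<Longrightarrow> smooth_on (\<lambda>x. f x * g x) S"
  by (rule smooth_on_bounded_bilinear[OF _ bounded_bilinear_mult])

lemma smooth_on_fst: "open S \<Longrightarrow> smooth_on f S \<Longrightarrow> smooth_on (\<lambda>x. fst (f x)) S"
  by (rule smooth_on_bounded_linear[OF _ bounded_linear_fst])

lemma smooth_on_snd: "open S \<Longrightarrow> smooth_on f S \<Longrightarrow> smooth_on (\<lambda>x. snd (f x)) S"
  by (rule smooth_on_bounded_linear[OF _ bounded_linear_snd])

lemma smooth_on_Pair:
  assumes "open S" "smooth_on f S" "smooth_on g S"
  shows "smooth_on (\<lambda>x. (f x, g x)) S"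
proof -
  have 1: "bounded_linear (\<lambda>x. (x, 0))" and 2: "bounded_linear (\<lambda>x. (0, x))"
    by (auto intro!: bounded_linear_Pair)
  show ?thesis
    using smooth_on_add[OF assms(1) smooth_on_bounded_linear[OF assms(1) 1 assms(2)]
        smooth_on_bounded_linear[OF assms(1) 2 assms(3)]] by simp
qed

lemma smooth_on_compose:
  fixes f :: "'a::real_normed_vector \<Rightarrow> 'b::euclidean_space"
  assumes "smooth_on g T" "open S" "open T" "smooth_on f S" "\<And>x. x \<in> S \<Longrightarrow> f x \<in> T"
  shows "smooth_on (\<lambda>x. g (f x)) S"
  unfolding smooth_on_def
  by (rule allI, rule Ck_on_compose[OF assms(2,3), of _ f g]) (use assms in \<open>auto simp: smooth_on_def\<close>)

lemma smooth_on_sin_cos: "smooth_on sin (UNIV::real set)" "smooth_on cos (UNIV::real set)"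
proof -
  \<comment> \<open>Up to sign each function is the derivative of the other, so both are carried
    through one induction.\<close>
  have "Ck_on k sin (UNIV::real set) \<and> Ck_on k cos (UNIV::real set)" for k
  proof (induction k)
    case 0
    then show ?case by (auto intro: continuous_intros)
  next
    case (Suc k)
    have "Ck_on k (\<lambda>x::real. - sin x) UNIV"
      using Suc Ck_on_bounded_linear[OF open_UNIV bounded_linear_minus[OF bounded_linear_ident]] by blast
    then show ?case
      using Suc by (auto intro!: Ck_on_DERIV derivative_eq_intros simp del: Ck_on.simps)
  qed
  then show "smooth_on sin (UNIV::real set)" "smooth_on cos (UNIV::real set)"
    by (auto simp: smooth_on_def)
qed

text \<open>The derivative is a polynomial in \<open>inverse\<close> itself, so the induction on the
  order closes.\<close>

lemma smooth_on_inverse: "smooth_on inverse (- {0::real})"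
proof -
  have op: "open (- {0::real})" by auto
  have "Ck_on k inverse (- {0::real})" for k
  proof (induction k)
    case 0
    then show ?case by (auto intro: continuous_intros)
  next
    case (Suc k)
    have "Ck_on k (\<lambda>x::real. - (inverse x * inverse x)) (- {0})"
      by (intro Ck_on_bounded_linear[OF op bounded_linear_minus[OF bounded_linear_ident]]
          Ck_on_bounded_bilinear[OF op bounded_bilinear_mult] Suc)
    then show ?case
      by (rule Ck_on_DERIV[OF op, rotated]) (auto intro!: derivative_eq_intros simp: power2_eq_square)
  qed
  then show ?thesis by (auto simp: smooth_on_def)
qed

lemma smooth_on_inverse_compose:
  fixes f :: "'a::real_normed_vector \<Rightarrow> real"
  assumes "open S" "smooth_on f S" "\<And>x. x \<in> S \<Longrightarrow> f x \<noteq> 0"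
  shows "smooth_on (\<lambda>x. inverse (f x)) S"
  by (rule smooth_on_compose[OF smooth_on_inverse assms(1) _ assms(2)]) (use assms in auto)

lemma smooth_on_divide:
  fixes f :: "'a::real_normed_vector \<Rightarrow> real"
  assumes "open S" "smooth_on f S" "smooth_on g S" "\<And>x. x \<in> S \<Longrightarrow> g x \<noteq> 0"
  shows "smooth_on (\<lambda>x. f x / g x) S"
  unfolding divide_inverse by (intro smooth_on_mult smooth_on_inverse_compose assms)

lemma smooth_on_arctan: "smooth_on arctan UNIV"
proof -
  have 1: "smooth_on (\<lambda>x::real. inverse (1 + x * x)) UNIV"
    by (intro smooth_on_inverse_compose smooth_on_add smooth_on_mult)
      (auto simp: add_nonneg_eq_0_iff)
  have "Ck_on k arctan UNIV" for k
  proof (cases k)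
    case 0
    then show ?thesis by (auto intro: continuous_intros)
  next
    case (Suc j)
    have "Ck_on (Suc j) arctan UNIV"
      by (rule Ck_on_DERIV[where f' = "\<lambda>x. inverse (1 + x * x)"])
        (use 1 in \<open>auto intro!: derivative_eq_intros simp: smooth_on_def power2_eq_square\<close>)
    then show ?thesis using Suc by simp
  qed
  then show ?thesis by (auto simp: smooth_on_def)
qed

lemma smooth_on_sqrt: "smooth_on sqrt {0<..}"
proof -
  have op: "open {0::real<..}" by auto
  have "Ck_on k sqrt {0<..}" for k
  proof (induction k)
    case 0
    then show ?case by (auto intro!: continuous_intros)
  next
    case (Suc k)
    have "Ck_on k (\<lambda>x. inverse (sqrt x)) {0<..}"
      by (rule Ck_on_compose[OF op, of "- {0}" k sqrt inverse])
        (use smooth_on_inverse Suc in \<open>auto simp: smooth_on_def\<close>)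
    then have "Ck_on k (\<lambda>x. inverse (sqrt x) * (1/2)) {0<..}"
      by (intro Ck_on_bounded_bilinear[OF op bounded_bilinear_mult] Ck_on_const)
    then show ?case
      by (rule Ck_on_DERIV[OF op, rotated]) (auto intro!: derivative_eq_intros simp: divide_simps)
  qed
  then show ?thesis by (auto simp: smooth_on_def)
qed

lemma smooth_on_sqrt_compose:
  fixes f :: "'a::real_normed_vector \<Rightarrow> real"
  assumes "open S" "smooth_on f S" "\<And>x. x \<in> S \<Longrightarrow> f x > 0"
  shows "smooth_on (\<lambda>x. sqrt (f x)) S"
  by (rule smooth_on_compose[OF smooth_on_sqrt assms(1) _ assms(2)]) (use assms in auto)

lemmas smooth_on_sin_compose = smooth_on_compose[OF smooth_on_sin_cos(1) _ open_UNIV, simplified]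
  and smooth_on_cos_compose = smooth_on_compose[OF smooth_on_sin_cos(2) _ open_UNIV, simplified]
  and smooth_on_arctan_compose = smooth_on_compose[OF smooth_on_arctan _ open_UNIV, simplified]

text \<open>Lets the base point and both vectors vary at once although \<open>G\<close> is only
  known to be smooth for constant vectors: in the basis expansion every factor is covered by a
  hypothesis.\<close>

lemma smooth_on_bilinear_compose:
  fixes G :: "'b::euclidean_space \<Rightarrow> 'c::euclidean_space \<Rightarrow> 'd::euclidean_space \<Rightarrow> 'e::real_normed_vector"
  assumes "open S" "open T" "smooth_on p S" "\<And>x. x \<in> S \<Longrightarrow> p x \<in> T"
    and "\<And>u. u \<in> T \<Longrightarrow> bilinear (G u)" "\<And>a b. smooth_on (\<lambda>u. G u a b) T"
    and "smooth_on v S" "smooth_on w S"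
  shows "smooth_on (\<lambda>x. G (p x) (v x) (w x)) S"
proof (rule smooth_on_cong[OF assms(1)])
  show "smooth_on (\<lambda>x. \<Sum>b\<in>Basis. \<Sum>c\<in>Basis. (v x \<bullet> b) *\<^sub>R (w x \<bullet> c) *\<^sub>R G (p x) b c) S"
    by (intro smooth_on_sum smooth_on_scaleR smooth_on_bounded_linear[OF _ bounded_linear_inner_left]
        smooth_on_compose[OF assms(6)] assms)
  fix x assume "x \<in> S"
  then have b: "bilinear (G (p x))" using assms by blast
  then have "G (p x) (v x) (w x) = (\<Sum>b\<in>Basis. (v x \<bullet> b) *\<^sub>R G (p x) b (w x))"
    by (intro linear_basis_sum) (simp add: bilinear_def)
  also have "\<dots> = (\<Sum>b\<in>Basis. (v x \<bullet> b) *\<^sub>R (\<Sum>c\<in>Basis. (w x \<bullet> c) *\<^sub>R G (p x) b c))"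
    by (intro sum.cong refl arg_cong2[where f = scaleR] linear_basis_sum) (use b in \<open>simp add: bilinear_def\<close>)
  finally show "(\<Sum>b\<in>Basis. \<Sum>c\<in>Basis. (v x \<bullet> b) *\<^sub>R (w x \<bullet> c) *\<^sub>R G (p x) b c) = G (p x) (v x) (w x)"
    by (simp add: scaleR_sum_right)
qed


section \<open>Symmetry of second derivatives\<close>

text \<open>Two applications of the mean value theorem to the second difference over a
  parallelogram: in direction \<open>v\<close> to the difference of two opposite edges, then in
  direction \<open>w\<close> to the difference of first derivatives so obtained.\<close>

lemma mixed_mean_value:
  fixes f :: "'a::real_normed_vector \<Rightarrow> real"
  assumes "smooth_on f S" "s > 0"
    and S: "\<And>a b. 0 \<le> a \<Longrightarrow> a \<le> s \<Longrightarrow> 0 \<le> b \<Longrightarrow> b \<le> s \<Longrightarrow> u + a *\<^sub>R v + b *\<^sub>R w \<in> S"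
  obtains a b where "0 < a" "a < s" "0 < b" "b < s"
    "f (u + s *\<^sub>R v + s *\<^sub>R w) - f (u + s *\<^sub>R v) - f (u + s *\<^sub>R w) + f u =
      s * s * frechet_derivative (\<lambda>x. frechet_derivative f (at x) v) (at (u + a *\<^sub>R v + b *\<^sub>R w)) w"
proof -
  let ?Df = "\<lambda>x. frechet_derivative f (at x) v"
  \<comment> \<open>The summand \<open>0 *\<^sub>R w\<close> is kept so that \<open>chain\<close>
    fits both terms, with \<open>b = s\<close> and \<open>b = 0\<close>.\<close>
  let ?\<phi> = "\<lambda>t. f (u + t *\<^sub>R v + s *\<^sub>R w) - f (u + t *\<^sub>R v + 0 *\<^sub>R w)"
  have chain: "((\<lambda>t. h (u + t *\<^sub>R v + b *\<^sub>R w)) has_real_derivative frechet_derivative h (at (u + t *\<^sub>R v + b *\<^sub>R w)) v) (at t)"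
    if "smooth_on h S" "0 \<le> t" "t \<le> s" "0 \<le> b" "b \<le> s" for h :: "'a \<Rightarrow> real" and t b
  proof -
    let ?x = "u + t *\<^sub>R v + b *\<^sub>R w"
    have h: "(h has_derivative frechet_derivative h (at ?x)) (at ?x)"
      by (rule smooth_on_has_derivative[OF that(1) S[OF that(2-5)]])
    have "((\<lambda>t. h (u + t *\<^sub>R v + b *\<^sub>R w)) has_derivative (\<lambda>d. frechet_derivative h (at ?x) (d *\<^sub>R v))) (at t)"
      by (rule has_derivative_compose[of "\<lambda>t. u + t *\<^sub>R v + b *\<^sub>R w" "\<lambda>d. d *\<^sub>R v", OF _ h])
        (auto intro!: derivative_eq_intros)
    then show ?thesis
      using linear_scale[OF has_derivative_linear[OF h]]
      by (simp add: has_field_derivative_def mult_commute_abs)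
  qed
  have chain2: "((\<lambda>t. h (u + a *\<^sub>R v + t *\<^sub>R w)) has_real_derivative frechet_derivative h (at (u + a *\<^sub>R v + t *\<^sub>R w)) w) (at t)"
    if "smooth_on h S" "0 \<le> t" "t \<le> s" "0 \<le> a" "a \<le> s" for h :: "'a \<Rightarrow> real" and t a
  proof -
    let ?x = "u + a *\<^sub>R v + t *\<^sub>R w"
    have h: "(h has_derivative frechet_derivative h (at ?x)) (at ?x)"
      by (rule smooth_on_has_derivative[OF that(1) S[OF that(4,5,2,3)]])
    have "((\<lambda>t. h (u + a *\<^sub>R v + t *\<^sub>R w)) has_derivative (\<lambda>d. frechet_derivative h (at ?x) (d *\<^sub>R w))) (at t)"
      by (rule has_derivative_compose[of "\<lambda>t. u + a *\<^sub>R v + t *\<^sub>R w" "\<lambda>d. d *\<^sub>R w", OF _ h])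
        (auto intro!: derivative_eq_intros)
    then show ?thesis
      using linear_scale[OF has_derivative_linear[OF h]]
      by (simp add: has_field_derivative_def mult_commute_abs)
  qed
  have "\<exists>a. 0 < a \<and> a < s \<and> ?\<phi> s - ?\<phi> 0 =
      (s - 0) * (?Df (u + a *\<^sub>R v + s *\<^sub>R w) - ?Df (u + a *\<^sub>R v + 0 *\<^sub>R w))"
    using assms by (intro MVT2[OF assms(2)] DERIV_diff chain) auto
  then obtain a where a: "0 < a" "a < s"
    and 1: "?\<phi> s - ?\<phi> 0 = s * (?Df (u + a *\<^sub>R v + s *\<^sub>R w) - ?Df (u + a *\<^sub>R v + 0 *\<^sub>R w))"
    by (metis diff_zero)
  have "\<exists>b. 0 < b \<and> b < s \<and> ?Df (u + a *\<^sub>R v + s *\<^sub>R w) - ?Df (u + a *\<^sub>R v + 0 *\<^sub>R w) =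
      (s - 0) * frechet_derivative ?Df (at (u + a *\<^sub>R v + b *\<^sub>R w)) w"
    using a by (intro MVT2[OF assms(2)] chain2 smooth_on_frechet_derivative_const[OF assms(1)]) auto
  then obtain b where b: "0 < b" "b < s"
    and 2: "?Df (u + a *\<^sub>R v + s *\<^sub>R w) - ?Df (u + a *\<^sub>R v + 0 *\<^sub>R w) =
      s * frechet_derivative ?Df (at (u + a *\<^sub>R v + b *\<^sub>R w)) w"
    by (metis diff_zero)
  show ?thesis
    by (rule that[OF a b]) (use 1 in \<open>simp add: 2[simplified]\<close>)
qed

text \<open>The second difference is symmetric in \<open>v\<close> and \<open>w\<close>. By
  \<open>mixed_mean_value\<close> it equals \<open>s * s\<close> times either mixed derivative, each
  taken at some point of a small parallelogram at \<open>u\<close>; continuity of both at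
  \<open>u\<close> then excludes different values there.\<close>

lemma symmetric_second_derivative_real:
  fixes f :: "'a::real_normed_vector \<Rightarrow> real"
  assumes "open S" "smooth_on f S" "u \<in> S"
  shows "frechet_derivative (\<lambda>x. frechet_derivative f (at x) v) (at u) w =
         frechet_derivative (\<lambda>x. frechet_derivative f (at x) w) (at u) v"
proof (rule ccontr)
  let ?A = "\<lambda>x. frechet_derivative (\<lambda>x. frechet_derivative f (at x) v) (at x) w"
  let ?B = "\<lambda>x. frechet_derivative (\<lambda>x. frechet_derivative f (at x) w) (at x) v"
  assume "?A u \<noteq> ?B u"
  \<comment> \<open>Half the gap: two values within \<open>e\<close> of \<open>?A u\<close> and of
    \<open>?B u\<close> cannot coincide.\<close>
  define e where "e = \<bar>?A u - ?B u\<bar> / 2"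
  have e: "e > 0" using \<open>?A u \<noteq> ?B u\<close> by (simp add: e_def)
  have cont: "isCont ?A u" "isCont ?B u"
    using assms smooth_on_continuous[OF smooth_on_frechet_derivative_const[OF smooth_on_frechet_derivative_const[OF assms(2)]]]
    by (auto simp: continuous_on_eq_continuous_at)
  obtain r1 where r1: "r1 > 0" "\<And>x. dist x u < r1 \<Longrightarrow> dist (?A x) (?A u) < e"
    using cont(1) e unfolding continuous_at_eps_delta by blast
  obtain r2 where r2: "r2 > 0" "\<And>x. dist x u < r2 \<Longrightarrow> dist (?B x) (?B u) < e"
    using cont(2) e unfolding continuous_at_eps_delta by blast
  obtain r3 where r3: "r3 > 0" "\<And>x. dist x u < r3 \<Longrightarrow> x \<in> S"
    using assms(1,3) by (metis open_dist)
  define r where "r = min r1 (min r2 r3)"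
  have r: "r > 0" using r1 r2 r3 by (simp add: r_def)
  \<comment> \<open>Makes the parallelogram spanned by \<open>s *\<^sub>R v\<close> and
    \<open>s *\<^sub>R w\<close> fit into the ball of radius \<open>r\<close>; the summand 1 keeps
    the denominator positive when both vectors vanish.\<close>
  define s where "s = r / (norm v + norm w + 1)"
  have np: "norm v + norm w + 1 > 0" by (metis add_nonneg_pos add_nonneg_nonneg norm_ge_zero zero_less_one)
  have s: "s > 0" using r np by (simp add: s_def)
  have small: "dist (u + a *\<^sub>R v + b *\<^sub>R w) u < r" if "0 \<le> a" "a \<le> s" "0 \<le> b" "b \<le> s" for a b
  proof -
    have "dist (u + a *\<^sub>R v + b *\<^sub>R w) u \<le> norm (a *\<^sub>R v) + norm (b *\<^sub>R w)"
      by (simp add: dist_norm add.assoc norm_triangle_ineq del: norm_scaleR)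
    also have "\<dots> \<le> s * norm v + s * norm w"
      using that by (auto intro!: add_mono mult_right_mono)
    also have "\<dots> < s * (norm v + norm w + 1)" using s by (simp add: algebra_simps)
    also have "\<dots> = r" using np by (simp add: s_def)
    finally show ?thesis .
  qed
  have inS: "u + a *\<^sub>R v + b *\<^sub>R w \<in> S" if "0 \<le> a" "a \<le> s" "0 \<le> b" "b \<le> s" for a b
    using small[OF that] by (intro r3(2)) (simp add: r_def)
  have inS': "u + a *\<^sub>R w + b *\<^sub>R v \<in> S" if "0 \<le> a" "a \<le> s" "0 \<le> b" "b \<le> s" for a b
    using inS[of b a] that by (simp add: ac_simps)
  obtain a b where ab: "0 < a" "a < s" "0 < b" "b < s"
    and 1: "f (u + s *\<^sub>R v + s *\<^sub>R w) - f (u + s *\<^sub>R v) - f (u + s *\<^sub>R w) + f u = s * s * ?A (u + a *\<^sub>R v + b *\<^sub>R w)"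
    by (rule mixed_mean_value[OF assms(2) s, of u v w]) (use inS in auto)
  obtain c d where cd: "0 < c" "c < s" "0 < d" "d < s"
    and 2: "f (u + s *\<^sub>R w + s *\<^sub>R v) - f (u + s *\<^sub>R w) - f (u + s *\<^sub>R v) + f u = s * s * ?B (u + d *\<^sub>R w + c *\<^sub>R v)"
    by (rule mixed_mean_value[OF assms(2) s, of u w v]) (use inS' in auto)
  have "s * s * ?A (u + a *\<^sub>R v + b *\<^sub>R w) = s * s * ?B (u + c *\<^sub>R v + d *\<^sub>R w)"
    using 1 2 by (simp add: algebra_simps)
  then have eq: "?A (u + a *\<^sub>R v + b *\<^sub>R w) = ?B (u + c *\<^sub>R v + d *\<^sub>R w)" using s by simp
  have "dist (?A (u + a *\<^sub>R v + b *\<^sub>R w)) (?A u) < e" "dist (?B (u + c *\<^sub>R v + d *\<^sub>R w)) (?B u) < e"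
    using small[of a b] small[of c d] ab cd by (auto intro!: r1(2) r2(2) simp: r_def)
  then show False unfolding eq dist_real_def e_def by argo
qed

text \<open>Componentwise: the inner product with a basis vector commutes with both
  differentiations.\<close>

lemma symmetric_second_derivative:
  fixes f :: "'a::real_normed_vector \<Rightarrow> 'b::euclidean_space"
  assumes "open S" "smooth_on f S" "u \<in> S"
  shows "frechet_derivative (\<lambda>x. frechet_derivative f (at x) v) (at u) w =
         frechet_derivative (\<lambda>x. frechet_derivative f (at x) w) (at u) v"
proof (rule euclidean_eqI)
  fix b :: 'b
  have inner: "frechet_derivative (\<lambda>x. h x \<bullet> b) (at x) v = frechet_derivative h (at x) v \<bullet> b"
    if "smooth_on h S" "x \<in> S" for h :: "'a \<Rightarrow> 'b" and x v
    using frechet_derivative_eqI[OF has_derivative_inner_left[OF smooth_on_has_derivative[OF that]]] by simp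
  have second: "frechet_derivative (\<lambda>x. frechet_derivative f (at x) v) (at u) w \<bullet> b =
      frechet_derivative (\<lambda>x. frechet_derivative (\<lambda>x. f x \<bullet> b) (at x) v) (at u) w" for v w
    unfolding inner[OF smooth_on_frechet_derivative_const[OF assms(2)] assms(3), symmetric]
    by (rule fun_cong[OF frechet_derivative_cong_open[OF assms(1,3)]]) (simp add: inner[OF assms(2)])
  show "frechet_derivative (\<lambda>x. frechet_derivative f (at x) v) (at u) w \<bullet> b =
        frechet_derivative (\<lambda>x. frechet_derivative f (at x) w) (at u) v \<bullet> b"
    unfolding second
    by (rule symmetric_second_derivative_real[OF assms(1) _ assms(3)])
      (rule smooth_on_bounded_linear[OF assms(1) bounded_linear_inner_left assms(2)])
qed


section \<open>Derivatives of parametrised bilinear maps\<close>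

lemma frechet_derivative_lincomb:
  fixes f g :: "'a::real_normed_vector \<Rightarrow> 'b::real_normed_vector"
  assumes "f differentiable (at x)" "g differentiable (at x)"
  shows "frechet_derivative (\<lambda>x. a *\<^sub>R f x + b *\<^sub>R g x) (at x) v =
    a *\<^sub>R frechet_derivative f (at x) v + b *\<^sub>R frechet_derivative g (at x) v"
  by (subst frechet_derivative_eqI[OF has_derivative_add[OF
        has_derivative_scaleR_right[OF frechet_derivative_has[OF assms(1)]]
        has_derivative_scaleR_right[OF frechet_derivative_has[OF assms(2)]]]]) simp

lemma bilinear_basis_sum:
  fixes B :: "'a::euclidean_space \<Rightarrow> 'b::euclidean_space \<Rightarrow> 'c::real_vector"
  assumes "bilinear B"
  shows "B v w = (\<Sum>b\<in>Basis. \<Sum>c\<in>Basis. ((v \<bullet> b) * (w \<bullet> c)) *\<^sub>R B b c)"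
proof -
  have "B v w = (\<Sum>b\<in>Basis. (v \<bullet> b) *\<^sub>R B b w)"
    by (rule linear_basis_sum) (use assms in \<open>simp add: bilinear_def\<close>)
  also have "\<dots> = (\<Sum>b\<in>Basis. (v \<bullet> b) *\<^sub>R (\<Sum>c\<in>Basis. (w \<bullet> c) *\<^sub>R B b c))"
    by (intro sum.cong refl arg_cong2[where f = scaleR] linear_basis_sum) (use assms in \<open>simp add: bilinear_def\<close>)
  finally show ?thesis by (simp add: scaleR_sum_right)
qed

text \<open>A product rule with three factors, the form itself depending on the point. It is the
  source of every derivative of \<open>G\<close> and \<Gamma> along a map; the basis expansion
  reduces it to products of real functions with \<open>B (p y) i j\<close>.\<close>

lemma has_derivative_bilinear_family:
  fixes B :: "'b::real_normed_vector \<Rightarrow> 'c::euclidean_space \<Rightarrow> 'd::euclidean_space \<Rightarrow> 'e::real_normed_vector"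
  assumes "open U" "p y \<in> U" "\<And>u. u \<in> U \<Longrightarrow> bilinear (B u)"
    and "\<And>a b. (\<lambda>u. B u a b) differentiable (at (p y))"
    and p: "(p has_derivative p') (at y)" and E: "(E has_derivative E') (at y)" and F: "(F has_derivative F') (at y)"
  shows "((\<lambda>y. B (p y) (E y) (F y)) has_derivative (\<lambda>h.
    frechet_derivative (\<lambda>u. B u (E y) (F y)) (at (p y)) (p' h) + B (p y) (E' h) (F y) + B (p y) (E y) (F' h))) (at y)"
proof -
  let ?D = "\<lambda>a b. frechet_derivative (\<lambda>u. B u a b) (at (p y))"
  have D: "((\<lambda>u. B u a b) has_derivative ?D a b) (at (p y))" for a b
    by (rule frechet_derivative_has[OF assms(4)])
  \<comment> \<open>The derivative in the base point is again bilinear in the vectors that were kept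
    constant.\<close>
  have Dsum: "?D a b h = (\<Sum>i\<in>Basis. \<Sum>j\<in>Basis. ((a \<bullet> i) * (b \<bullet> j)) *\<^sub>R ?D i j h)" for a b h
  proof -
    have "((\<lambda>u. \<Sum>i\<in>Basis. \<Sum>j\<in>Basis. ((a \<bullet> i) * (b \<bullet> j)) *\<^sub>R B u i j) has_derivative
        (\<lambda>h. \<Sum>i\<in>Basis. \<Sum>j\<in>Basis. ((a \<bullet> i) * (b \<bullet> j)) *\<^sub>R ?D i j h)) (at (p y))"
      by (intro has_derivative_sum has_derivative_scaleR_right D)
    then have "((\<lambda>u. B u a b) has_derivative
        (\<lambda>h. \<Sum>i\<in>Basis. \<Sum>j\<in>Basis. ((a \<bullet> i) * (b \<bullet> j)) *\<^sub>R ?D i j h)) (at (p y))"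
      by (rule has_derivative_transform_within_open[OF _ assms(1,2)])
        (rule bilinear_basis_sum[symmetric, OF assms(3)])
    then show ?thesis by (rule fun_cong[OF frechet_derivative_eqI])
  qed
  have "((\<lambda>y. \<Sum>i\<in>Basis. \<Sum>j\<in>Basis. ((E y \<bullet> i) * (F y \<bullet> j)) *\<^sub>R B (p y) i j) has_derivative
      (\<lambda>h. \<Sum>i\<in>Basis. \<Sum>j\<in>Basis. ((E y \<bullet> i) * (F y \<bullet> j)) *\<^sub>R ?D i j (p' h) +
        ((E y \<bullet> i) * (F' h \<bullet> j) + (E' h \<bullet> i) * (F y \<bullet> j)) *\<^sub>R B (p y) i j)) (at y)"
    by (intro has_derivative_sum has_derivative_scaleR has_derivative_mult has_derivative_inner_left
        has_derivative_compose[OF p D] E F)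
  also have "(\<lambda>h. \<Sum>i\<in>Basis. \<Sum>j\<in>Basis. ((E y \<bullet> i) * (F y \<bullet> j)) *\<^sub>R ?D i j (p' h) +
        ((E y \<bullet> i) * (F' h \<bullet> j) + (E' h \<bullet> i) * (F y \<bullet> j)) *\<^sub>R B (p y) i j) =
      (\<lambda>h. ?D (E y) (F y) (p' h) + B (p y) (E' h) (F y) + B (p y) (E y) (F' h))"
    (is "?L = ?R")
  proof
    fix h
    have "?R h = (\<Sum>i\<in>Basis. \<Sum>j\<in>Basis. ((E y \<bullet> i) * (F y \<bullet> j)) *\<^sub>R ?D i j (p' h)) +
       (\<Sum>i\<in>Basis. \<Sum>j\<in>Basis. ((E' h \<bullet> i) * (F y \<bullet> j)) *\<^sub>R B (p y) i j) +
       (\<Sum>i\<in>Basis. \<Sum>j\<in>Basis. ((E y \<bullet> i) * (F' h \<bullet> j)) *\<^sub>R B (p y) i j)"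
      by (intro arg_cong2[where f = "(+)"] Dsum bilinear_basis_sum assms(2,3))
    then show "?L h = ?R h"
      by (simp add: sum.distrib scaleR_add_left algebra_simps)
  qed
  finally have 1: "((\<lambda>y. \<Sum>i\<in>Basis. \<Sum>j\<in>Basis. ((E y \<bullet> i) * (F y \<bullet> j)) *\<^sub>R B (p y) i j) has_derivative ?R) (at y)" .
  \<comment> \<open>The forms are bilinear over \<open>U\<close> only, so the expansion is valid on
    a neighbourhood of \<open>y\<close> that \<open>p\<close> maps into \<open>U\<close>.\<close>
  have "isCont p y" using p has_derivative_continuous by blast
  then obtain V where V: "open V" "y \<in> V" "\<And>x. x \<in> V \<Longrightarrow> p x \<in> U"
    using assms(1,2) unfolding continuous_at_open by metis
  show ?thesis
    by (rule has_derivative_transform_within_open[OF 1 V(1,2)])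
      (rule bilinear_basis_sum[symmetric, OF assms(3)[OF V(3)]])
qed

lemma has_derivative_linear_family:
  fixes L :: "'b::real_normed_vector \<Rightarrow> 'c::euclidean_space \<Rightarrow> 'e::real_normed_vector"
  assumes "open U" "p y \<in> U" "\<And>u. u \<in> U \<Longrightarrow> linear (L u)"
    and "\<And>a. (\<lambda>u. L u a) differentiable (at (p y))"
    and p: "(p has_derivative p') (at y)" and E: "(E has_derivative E') (at y)"
  shows "((\<lambda>y. L (p y) (E y)) has_derivative (\<lambda>h.
    frechet_derivative (\<lambda>u. L u (E y)) (at (p y)) (p' h) + L (p y) (E' h))) (at y)"
proof -
  \<comment> \<open>A dummy real factor turns the linear family into a bilinear one; it is set
    constantly to 1 below, so its derivative contributes nothing.\<close>
  let ?B = "\<lambda>u (r::real) a. r *\<^sub>R L u a"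
  have b: "bilinear (?B u)" if "u \<in> U" for u
    using assms(3)[OF that] by (auto simp: bilinear_def linear_iff algebra_simps)
  have "(\<lambda>u. r *\<^sub>R L u a) differentiable (at (p y))" for r a
    using assms(4) by (auto intro: differentiable_scaleR)
  then show ?thesis
    using has_derivative_bilinear_family[where B = ?B, OF assms(1,2) b _ p has_derivative_const[of 1] E] by simp
qed


section \<open>Metrics on open subsets of the plane\<close>

type_synonym plane_form = "real^2 \<Rightarrow> real^2 \<Rightarrow> real^2 \<Rightarrow> real"

text \<open>Free of charts and atlases, so that the laws below apply to the coordinate expression of
  the metric in any chart; \<open>christoffel_eq_form\<close> and
  \<open>gauss_curvature_eq_form\<close> lead back to the surface.\<close>

definition is_christoffel :: "plane_form \<Rightarrow> real^2 \<Rightarrow> (real^2 \<Rightarrow> real^2 \<Rightarrow> real^2) \<Rightarrow> bool" where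
  "is_christoffel G u \<Gamma> \<longleftrightarrow> bilinear \<Gamma> \<and> (\<forall>v w. \<Gamma> v w = \<Gamma> w v) \<and>
     (\<forall>v w z. frechet_derivative (\<lambda>u. G u w z) (at u) v = G u (\<Gamma> v w) z + G u w (\<Gamma> v z))"

definition christoffel_form :: "plane_form \<Rightarrow> real^2 \<Rightarrow> real^2 \<Rightarrow> real^2 \<Rightarrow> real^2" where
  "christoffel_form G u = (THE \<Gamma>. is_christoffel G u \<Gamma>)"

definition curvature_form :: "plane_form \<Rightarrow> real^2 \<Rightarrow> real^2 \<Rightarrow> real^2 \<Rightarrow> real^2 \<Rightarrow> real^2" where
  "curvature_form G u v w z =
     (let \<Gamma> = christoffel_form G in
      frechet_derivative (\<lambda>u. \<Gamma> u w z) (at u) v - frechet_derivative (\<lambda>u. \<Gamma> u v z) (at u) w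
      + \<Gamma> u v (\<Gamma> u w z) - \<Gamma> u w (\<Gamma> u v z))"

abbreviation (input) ax1 :: "real^2" where "ax1 \<equiv> axis 1 1"
abbreviation (input) ax2 :: "real^2" where "ax2 \<equiv> axis 2 1"

definition gauss_form :: "plane_form \<Rightarrow> real^2 \<Rightarrow> real" where
  "gauss_form G u = G u (curvature_form G u ax1 ax2 ax2) ax1 / (G u ax1 ax1 * G u ax2 ax2 - (G u ax1 ax2)\<^sup>2)"

definition cross2 :: "real^2 \<Rightarrow> real^2 \<Rightarrow> real" where
  "cross2 v w = v $ 1 * w $ 2 - v $ 2 * w $ 1"

lemma vec2_axis: "(x::real^2) = x $ 1 *\<^sub>R ax1 + x $ 2 *\<^sub>R ax2"
  by (simp add: vec_eq_iff forall_2 axis_def)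

lemma linear_vec2:
  assumes "linear (L :: real^2 \<Rightarrow> 'b::real_vector)"
  shows "L x = x $ 1 *\<^sub>R L ax1 + x $ 2 *\<^sub>R L ax2"
  by (subst vec2_axis) (simp add: linear_add[OF assms] linear_scale[OF assms])

lemma linear_vec2_eqI:
  assumes "linear (L :: real^2 \<Rightarrow> 'b::real_vector)" "linear L'" "L ax1 = L' ax1" "L ax2 = L' ax2"
  shows "L x = L' x"
  using linear_vec2[OF assms(1), of x] linear_vec2[OF assms(2), of x] assms(3,4) by simp

text \<open>The first factor on the right is the determinant of \<open>L\<close>.\<close>

lemma cross2_linear:
  assumes "linear L"
  shows "cross2 (L v) (L w) = cross2 (L ax1) (L ax2) * cross2 v w"
  using linear_vec2[OF assms, of v] linear_vec2[OF assms, of w] by (simp add: cross2_def algebra_simps)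

lemmas bilinear_simps = bilinear_ladd bilinear_radd bilinear_lmul bilinear_rmul bilinear_lsub bilinear_rsub
  bilinear_lneg bilinear_rneg bilinear_lzero bilinear_rzero

lemma linear_trivial_kernel_surj:
  assumes "linear (L :: real^2 \<Rightarrow> real^2)" "\<And>v. L v = 0 \<Longrightarrow> v = 0"
  shows "\<exists>v. L v = x"
  using linear_injective_imp_surjective[OF assms(1)] linear_injective_0[OF assms(1)] assms(2)
  by (metis surjD)

lemma linearI_lincomb:
  fixes L :: "'x::real_vector \<Rightarrow> 'y::real_vector"
  assumes "\<And>a b v w. L (a *\<^sub>R v + b *\<^sub>R w) = a *\<^sub>R L v + b *\<^sub>R L w"
  shows "linear L"
proof (rule linearI)
  show "L (v + w) = L v + L w" for v w using assms[of 1 v 1 w] by simp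
  show "L (a *\<^sub>R v) = a *\<^sub>R L v" for a v using assms[of a v 0 0] by simp
qed

section \<open>Levi-Civita connection and curvature of a metric on an open set of the plane\<close>

locale local_metric =
  fixes U :: "(real^2) set" and G :: plane_form
  assumes open_U: "open U"
    and bilinear_G: "u \<in> U \<Longrightarrow> bilinear (G u)"
    and sym_G: "u \<in> U \<Longrightarrow> G u v w = G u w v"
    and pos_G: "u \<in> U \<Longrightarrow> v \<noteq> 0 \<Longrightarrow> G u v v > 0"
    and smooth_G: "smooth_on (\<lambda>u. G u v w) U"
begin

lemmas G_simps = bilinear_simps[OF bilinear_G]

lemma nondegenerate:
  assumes "u \<in> U" "\<And>z. G u x z = G u y z"
  shows "x = y"
proof (rule ccontr)
  assume "x \<noteq> y"
  then have "G u (x - y) (x - y) > 0" using pos_G assms(1) by simp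
  then show False using assms by (simp add: G_simps)
qed

lemma gram_pos:
  assumes "u \<in> U"
  shows "G u ax1 ax1 * G u ax2 ax2 - (G u ax1 ax2)\<^sup>2 > 0"
proof -
  \<comment> \<open>A multiple of the component of \<open>ax1\<close> orthogonal to
    \<open>ax2\<close>; its square length is \<open>G u ax2 ax2\<close> times the Gram
    determinant.\<close>
  let ?x = "G u ax2 ax2 *\<^sub>R ax1 - G u ax1 ax2 *\<^sub>R ax2"
  have p: "G u ax2 ax2 > 0" using pos_G[OF assms] by (simp add: axis_eq_0_iff)
  have "?x $ 1 \<noteq> 0" using p by (simp add: axis_def)
  then have "?x \<noteq> 0" by (metis zero_index)
  then have "0 < G u ?x ?x" using pos_G assms by blast
  also have "G u ?x ?x = G u ax2 ax2 * (G u ax1 ax1 * G u ax2 ax2 - (G u ax1 ax2)\<^sup>2)"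
    using assms sym_G[OF assms, of ax2 ax1]
    by (simp add: G_simps algebra_simps power2_eq_square)
  finally show ?thesis using p by (simp add: zero_less_mult_iff)
qed

abbreviation (input) dG :: "real^2 \<Rightarrow> real^2 \<Rightarrow> real^2 \<Rightarrow> real^2 \<Rightarrow> real" where
  "dG u v w z \<equiv> frechet_derivative (\<lambda>u. G u w z) (at u) v"

text \<open>The Koszul formula for vector fields with constant coordinates, whose brackets vanish:
  the value that symmetry and metricity force on \<open>G u (\<Gamma> v w) z\<close>.\<close>

definition koszul :: "real^2 \<Rightarrow> real^2 \<Rightarrow> real^2 \<Rightarrow> real^2 \<Rightarrow> real" where
  "koszul u v w z = (dG u v w z + dG u w v z - dG u z v w) / 2"

text \<open>The vector representing the linear form \<open>k\<close>, by Cramer's rule. The explicit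
  formula makes smoothness in \<open>u\<close> visible.\<close>

definition raise :: "real^2 \<Rightarrow> (real^2 \<Rightarrow> real) \<Rightarrow> real^2" where
  "raise u k = (inverse (G u ax1 ax1 * G u ax2 ax2 - G u ax1 ax2 * G u ax1 ax2)) *\<^sub>R
     ((k ax1 * G u ax2 ax2 - k ax2 * G u ax1 ax2) *\<^sub>R ax1 + (k ax2 * G u ax1 ax1 - k ax1 * G u ax1 ax2) *\<^sub>R ax2)"

lemma raise:
  assumes "u \<in> U" "linear k"
  shows "G u (raise u k) z = k z"
proof (rule linear_vec2_eqI)
  show "linear (G u (raise u k))" using bilinear_G[OF assms(1)] by (simp add: bilinear_def)
  let ?d = "G u ax1 ax1 * G u ax2 ax2 - G u ax1 ax2 * G u ax1 ax2"
  have d: "?d \<noteq> 0" using gram_pos[OF assms(1)] by (simp add: power2_eq_square)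
  have s: "G u ax2 ax1 = G u ax1 ax2" using sym_G[OF assms(1)] by blast
  have "G u (raise u k) ax1 = inverse ?d * (?d * k ax1)"
    using assms(1) by (simp add: raise_def G_simps s algebra_simps)
  then show "G u (raise u k) ax1 = k ax1" using d by simp
  have "G u (raise u k) ax2 = inverse ?d * (?d * k ax2)"
    using assms(1) by (simp add: raise_def G_simps s algebra_simps)
  then show "G u (raise u k) ax2 = k ax2" using d by simp
qed (rule assms)

lemma dG_lincomb:
  assumes "u \<in> U"
  shows "dG u (a *\<^sub>R v + b *\<^sub>R v') w z = a * dG u v w z + b * dG u v' w z"
    and "dG u v (a *\<^sub>R w + b *\<^sub>R w') z = a * dG u v w z + b * dG u v w' z"
    and "dG u v w (a *\<^sub>R z + b *\<^sub>R z') = a * dG u v w z + b * dG u v w z'"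
proof -
  have lin: "linear (\<lambda>v. dG u v w z)"
    by (rule smooth_on_linear_derivative[OF smooth_G assms])
  show "dG u (a *\<^sub>R v + b *\<^sub>R v') w z = a * dG u v w z + b * dG u v' w z"
    by (simp add: linear_add[OF lin] linear_scale[OF lin])
  have "dG u v (a *\<^sub>R w + b *\<^sub>R w') z = frechet_derivative (\<lambda>u. a *\<^sub>R G u w z + b *\<^sub>R G u w' z) (at u) v"
    by (rule fun_cong[OF frechet_derivative_cong_open[OF open_U assms]]) (simp add: G_simps)
  then show "dG u v (a *\<^sub>R w + b *\<^sub>R w') z = a * dG u v w z + b * dG u v w' z"
    using frechet_derivative_lincomb[OF smooth_on_differentiable[OF smooth_G assms] smooth_on_differentiable[OF smooth_G assms]]
    by simp
  have "dG u v w (a *\<^sub>R z + b *\<^sub>R z') = frechet_derivative (\<lambda>u. a *\<^sub>R G u w z + b *\<^sub>R G u w z') (at u) v"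
    by (rule fun_cong[OF frechet_derivative_cong_open[OF open_U assms]]) (simp add: G_simps)
  then show "dG u v w (a *\<^sub>R z + b *\<^sub>R z') = a * dG u v w z + b * dG u v w z'"
    using frechet_derivative_lincomb[OF smooth_on_differentiable[OF smooth_G assms] smooth_on_differentiable[OF smooth_G assms]]
    by simp
qed

lemma dG_sym: "u \<in> U \<Longrightarrow> dG u v w z = dG u v z w"
  by (rule fun_cong[OF frechet_derivative_cong_open[OF open_U]]) (auto intro: sym_G)

lemma koszul_lincomb:
  assumes "u \<in> U"
  shows "koszul u (a *\<^sub>R v + b *\<^sub>R v') w z = a * koszul u v w z + b * koszul u v' w z"
    and "koszul u v w (a *\<^sub>R z + b *\<^sub>R z') = a * koszul u v w z + b * koszul u v w z'"
  unfolding koszul_def dG_lincomb[OF assms] by (simp_all add: field_simps)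

lemma G_raise_koszul:
  assumes "u \<in> U"
  shows "G u (raise u (koszul u v w)) z = koszul u v w z"
  by (rule raise[OF assms], rule linearI_lincomb) (simp add: koszul_lincomb[OF assms])

text \<open>Existence. Symmetry and linearity are tested against all \<open>z\<close> by
  nondegeneracy; metricity is the cancellation in \<open>koszul u v w z + koszul u v z w\<close>,
  which leaves \<open>dG u v w z\<close>.\<close>

lemma is_christoffel_raise:
  assumes u: "u \<in> U"
  shows "is_christoffel G u (\<lambda>v w. raise u (koszul u v w))"
proof -
  have sym: "raise u (koszul u v w) = raise u (koszul u w v)" for v w
  proof (rule nondegenerate[OF u])
    show "G u (raise u (koszul u v w)) z = G u (raise u (koszul u w v)) z" for z
      unfolding G_raise_koszul[OF u] using dG_sym[OF u] by (simp add: koszul_def)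
  qed
  have lin: "linear (\<lambda>v. raise u (koszul u v w))" for w
  proof (rule linearI_lincomb, rule nondegenerate[OF u])
    fix a b v v' z
    show "G u (raise u (koszul u (a *\<^sub>R v + b *\<^sub>R v') w)) z =
      G u (a *\<^sub>R raise u (koszul u v w) + b *\<^sub>R raise u (koszul u v' w)) z"
      using u by (simp add: G_simps G_raise_koszul koszul_lincomb)
  qed
  have lin': "linear (\<lambda>w. raise u (koszul u v w))" for v
    using lin[of v] by (simp add: sym[of v])
  have "dG u v w z = G u (raise u (koszul u v w)) z + G u w (raise u (koszul u v z))" for v w z
    unfolding sym_G[OF u, of w] G_raise_koszul[OF u] unfolding koszul_def
    using dG_sym[OF u, where v = v and w = z and z = w] by (simp add: field_simps)
  then show ?thesis
    using sym lin lin' by (auto simp: is_christoffel_def bilinear_def)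
qed

text \<open>Uniqueness: inserting metricity into the three terms of \<open>koszul\<close> gives six
  values of \<Gamma>, of which four cancel by symmetry and two agree.\<close>

lemma is_christoffel_koszul:
  assumes u: "u \<in> U" and \<Gamma>: "is_christoffel G u \<Gamma>"
  shows "G u (\<Gamma> v w) z = koszul u v w z"
proof -
  have s: "\<Gamma> v w = \<Gamma> w v" for v w using \<Gamma> by (simp add: is_christoffel_def)
  have d: "dG u v w z = G u (\<Gamma> v w) z + G u w (\<Gamma> v z)" for v w z
    using \<Gamma> by (simp add: is_christoffel_def)
  show ?thesis unfolding koszul_def d
    using s[of v w] s[of z v] s[of z w] sym_G[OF u, of w "\<Gamma> v z"] by simp
qed

lemma christoffel_form_eq:
  assumes u: "u \<in> U"
  shows "christoffel_form G u = (\<lambda>v w. raise u (koszul u v w))"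
  unfolding christoffel_form_def
proof (rule the_equality[of "is_christoffel G u", OF is_christoffel_raise[OF u]])
  fix \<Gamma> assume "is_christoffel G u \<Gamma>"
  then show "\<Gamma> = (\<lambda>v w. raise u (koszul u v w))"
    by (intro ext nondegenerate[OF u]) (simp add: is_christoffel_koszul[OF u] G_raise_koszul[OF u])
qed

lemma is_christoffel_form: "u \<in> U \<Longrightarrow> is_christoffel G u (christoffel_form G u)"
  using christoffel_form_eq is_christoffel_raise by simp

lemma bilinear_christoffel: "u \<in> U \<Longrightarrow> bilinear (christoffel_form G u)"
  and christoffel_sym: "u \<in> U \<Longrightarrow> christoffel_form G u v w = christoffel_form G u w v"
  and dG_christoffel: "u \<in> U \<Longrightarrow>
    dG u v w z = G u (christoffel_form G u v w) z + G u w (christoffel_form G u v z)"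
  using is_christoffel_form[of u] by (auto simp: is_christoffel_def)

lemmas christoffel_simps = bilinear_simps[OF bilinear_christoffel]

text \<open>The description by \<open>THE\<close> is pointwise and says nothing about dependence on
  \<open>u\<close>. The explicit form is rational in the coefficients of \<open>G\<close> and their
  first derivatives, with the positive Gram determinant as denominator.\<close>

lemma smooth_christoffel: "smooth_on (\<lambda>u. christoffel_form G u v w) U"
proof (rule smooth_on_cong[OF open_U])
  have k: "smooth_on (\<lambda>u. koszul u v w z) U" for z
    unfolding koszul_def
    by (intro smooth_on_divide smooth_on_add smooth_on_diff open_U
        smooth_on_frechet_derivative_const smooth_G smooth_on_const) simp
  show "smooth_on (\<lambda>u. raise u (koszul u v w)) U"
    unfolding raise_def
    by (intro smooth_on_scaleR smooth_on_add smooth_on_diff smooth_on_mult smooth_on_inverse_compose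
        open_U smooth_G k smooth_on_const) (use gram_pos in \<open>force simp: power2_eq_square\<close>)
qed (simp add: christoffel_form_eq)

text \<open>The covariant derivative along a map \<open>p\<close> into \<open>U\<close> is metric.\<close>

lemma has_derivative_metric:
  assumes u: "p y \<in> U"
    and p: "(p has_derivative p') (at y)" and E: "(E has_derivative E') (at y)" and F: "(F has_derivative F') (at y)"
  shows "((\<lambda>y. G (p y) (E y) (F y)) has_derivative (\<lambda>h.
    G (p y) (E' h + christoffel_form G (p y) (p' h) (E y)) (F y) +
    G (p y) (E y) (F' h + christoffel_form G (p y) (p' h) (F y)))) (at y)"
proof -
  have "((\<lambda>y. G (p y) (E y) (F y)) has_derivative (\<lambda>h.
    dG (p y) (p' h) (E y) (F y) + G (p y) (E' h) (F y) + G (p y) (E y) (F' h))) (at y)"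
    by (rule has_derivative_bilinear_family[OF open_U u bilinear_G _ p E F])
      (auto intro: smooth_on_differentiable[OF smooth_G u])
  then show ?thesis
    by (simp add: dG_christoffel[OF u] G_simps[OF u] algebra_simps)
qed

lemma has_derivative_christoffel:
  assumes u: "p y \<in> U"
    and p: "(p has_derivative p') (at y)" and E: "(E has_derivative E') (at y)" and F: "(F has_derivative F') (at y)"
  shows "((\<lambda>y. christoffel_form G (p y) (E y) (F y)) has_derivative (\<lambda>h.
    frechet_derivative (\<lambda>u. christoffel_form G u (E y) (F y)) (at (p y)) (p' h) +
    christoffel_form G (p y) (E' h) (F y) + christoffel_form G (p y) (E y) (F' h))) (at y)"
  by (rule has_derivative_bilinear_family[OF open_U u bilinear_christoffel _ p E F])
    (auto intro: smooth_on_differentiable[OF smooth_christoffel u])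

lemma curvature_skew: "curvature_form G u v w z = - curvature_form G u w v z"
  by (simp add: curvature_form_def Let_def)

lemma d_christoffel_lincomb:
  assumes u: "u \<in> U"
  defines "D \<equiv> \<lambda>v w z. frechet_derivative (\<lambda>u. christoffel_form G u w z) (at u) v"
  shows "D (a *\<^sub>R v + b *\<^sub>R v') w z = a *\<^sub>R D v w z + b *\<^sub>R D v' w z"
    and "D v (a *\<^sub>R w + b *\<^sub>R w') z = a *\<^sub>R D v w z + b *\<^sub>R D v w' z"
    and "D v w (a *\<^sub>R z + b *\<^sub>R z') = a *\<^sub>R D v w z + b *\<^sub>R D v w z'"
proof -
  have lin: "linear (\<lambda>v. D v w z)" unfolding D_def
    by (rule smooth_on_linear_derivative[OF smooth_christoffel u])
  show "D (a *\<^sub>R v + b *\<^sub>R v') w z = a *\<^sub>R D v w z + b *\<^sub>R D v' w z"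
    by (simp add: linear_add[OF lin] linear_scale[OF lin])
  note d = smooth_on_differentiable[OF smooth_christoffel u]
  have "D v (a *\<^sub>R w + b *\<^sub>R w') z =
      frechet_derivative (\<lambda>u. a *\<^sub>R christoffel_form G u w z + b *\<^sub>R christoffel_form G u w' z) (at u) v"
    unfolding D_def
    by (rule fun_cong[OF frechet_derivative_cong_open[OF open_U u]]) (simp add: christoffel_simps)
  then show "D v (a *\<^sub>R w + b *\<^sub>R w') z = a *\<^sub>R D v w z + b *\<^sub>R D v w' z"
    using frechet_derivative_lincomb[OF d d] by (simp add: D_def)
  have "D v w (a *\<^sub>R z + b *\<^sub>R z') =
      frechet_derivative (\<lambda>u. a *\<^sub>R christoffel_form G u w z + b *\<^sub>R christoffel_form G u w z') (at u) v"
    unfolding D_def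
    by (rule fun_cong[OF frechet_derivative_cong_open[OF open_U u]]) (simp add: christoffel_simps)
  then show "D v w (a *\<^sub>R z + b *\<^sub>R z') = a *\<^sub>R D v w z + b *\<^sub>R D v w z'"
    using frechet_derivative_lincomb[OF d d] by (simp add: D_def)
qed

lemma linear_curvature:
  assumes u: "u \<in> U"
  shows "linear (\<lambda>v. curvature_form G u v w z)" "linear (\<lambda>w. curvature_form G u v w z)"
    "linear (\<lambda>z. curvature_form G u v w z)"
proof -
  show 1: "linear (\<lambda>v. curvature_form G u v w z)" for w
    by (rule linearI_lincomb)
      (simp add: curvature_form_def Let_def d_christoffel_lincomb[OF u] christoffel_simps[OF u] algebra_simps)
  show "linear (\<lambda>w. curvature_form G u v w z)"
    unfolding curvature_skew[of u v] using linear_compose_neg[OF 1] by blast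
  show "linear (\<lambda>z. curvature_form G u v w z)"
    by (rule linearI_lincomb)
      (simp add: curvature_form_def Let_def d_christoffel_lincomb[OF u] christoffel_simps[OF u] algebra_simps)
qed

text \<open>The second derivative of \<open>G x z z\<close> in directions \<open>w\<close> and
  \<open>v\<close> is symmetric. Expressed by covariant derivatives it is twice the sum of a term in
  the second covariant derivative of \<open>z\<close> and the symmetric term
  \<open>G u (?\<Gamma> u w z) (?\<Gamma> u v z)\<close>; antisymmetrising in \<open>v\<close> and
  \<open>w\<close> leaves the curvature term alone.\<close>

lemma curvature_metric_zero:
  assumes u: "u \<in> U"
  shows "G u (curvature_form G u v w z) z = 0"
proof -
  let ?\<Gamma> = "christoffel_form G"
  have second: "frechet_derivative (\<lambda>x. frechet_derivative (\<lambda>x. G x z z) (at x) w) (at u) v =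
      2 * (G u (frechet_derivative (\<lambda>x. ?\<Gamma> x w z) (at u) v + ?\<Gamma> u v (?\<Gamma> u w z)) z + G u (?\<Gamma> u w z) (?\<Gamma> u v z))"
    for v w
  proof -
    have "frechet_derivative (\<lambda>x. frechet_derivative (\<lambda>x. G x z z) (at x) w) (at u) =
        frechet_derivative (\<lambda>x. 2 *\<^sub>R G x (?\<Gamma> x w z) z) (at u)"
      by (rule frechet_derivative_cong_open[OF open_U u]) (simp add: dG_christoffel sym_G[of _ z])
    also have "\<dots> = (\<lambda>h. 2 *\<^sub>R (G u (frechet_derivative (\<lambda>x. ?\<Gamma> x w z) (at u) h + ?\<Gamma> u h (?\<Gamma> u w z)) z +
        G u (?\<Gamma> u w z) (0 + ?\<Gamma> u h z)))"
      by (intro frechet_derivative_eqI has_derivative_scaleR_right has_derivative_metric[of "\<lambda>x. x"] u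
          has_derivative_ident has_derivative_const smooth_on_has_derivative[OF smooth_christoffel u])
    finally show ?thesis by simp
  qed
  have "frechet_derivative (\<lambda>x. frechet_derivative (\<lambda>x. G x z z) (at x) w) (at u) v =
        frechet_derivative (\<lambda>x. frechet_derivative (\<lambda>x. G x z z) (at x) v) (at u) w"
    by (rule symmetric_second_derivative_real[OF open_U smooth_G u])
  then show ?thesis
    unfolding second using sym_G[OF u, of "?\<Gamma> u w z" "?\<Gamma> u v z"]
    by (simp add: curvature_form_def Let_def G_simps[OF u])
qed

text \<open>Polarisation of the preceding lemma at \<open>z + y\<close>.\<close>

lemma curvature_metric_skew:
  assumes u: "u \<in> U"
  shows "G u (curvature_form G u v w z) y = - G u (curvature_form G u v w y) z"
  using curvature_metric_zero[OF u, of v w "z + y"] curvature_metric_zero[OF u, of v w z] curvature_metric_zero[OF u, of v w y]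
  by (simp add: linear_add[OF linear_curvature(3)[OF u]] G_simps[OF u])

text \<open>The curvature is skew in its first pair of arguments, and after pairing with
  \<open>G\<close> also in the second. In the plane each skew pair contributes one determinant,
  hence the square. The Gram determinant scales by the same factor in
  \<open>gram_change_basis\<close>, so their quotient does not depend on the basis.\<close>

lemma curvature_change_basis:
  assumes u: "u \<in> U"
  shows "G u (curvature_form G u v w w) v = (cross2 v w)\<^sup>2 * G u (curvature_form G u ax1 ax2 ax2) ax1"
proof -
  let ?R = "curvature_form G u"
  have z: "?R a a z = 0" for a z by (simp add: curvature_form_def Let_def)
  have 1: "?R v w z = cross2 v w *\<^sub>R ?R ax1 ax2 z" for z
  proof -
    have "?R v w z = v $ 1 *\<^sub>R ?R ax1 w z + v $ 2 *\<^sub>R ?R ax2 w z"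
      by (rule linear_vec2[OF linear_curvature(1)[OF u]])
    also have "?R ax1 w z = w $ 2 *\<^sub>R ?R ax1 ax2 z"
      using linear_vec2[OF linear_curvature(2)[OF u, of ax1 z], of w] z by simp
    also have "?R ax2 w z = - w $ 1 *\<^sub>R ?R ax1 ax2 z"
      using linear_vec2[OF linear_curvature(2)[OF u, of ax2 z], of w] z curvature_skew[of u ax2 ax1 z] by simp
    finally show ?thesis by (simp add: cross2_def algebra_simps)
  qed
  let ?B = "\<lambda>z y. G u (?R ax1 ax2 z) y"
  have B: "?B z y = z $ 1 * ?B ax1 y + z $ 2 * ?B ax2 y" "?B z y = y $ 1 * ?B z ax1 + y $ 2 * ?B z ax2" for z y
  proof -
    show "?B z y = z $ 1 * ?B ax1 y + z $ 2 * ?B ax2 y"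
      using linear_vec2[OF linear_curvature(3)[OF u, of ax1 ax2], of z] by (simp add: G_simps[OF u])
    have "linear (G u (?R ax1 ax2 z))" using bilinear_G[OF u] by (simp add: bilinear_def)
    from linear_vec2[OF this, of y] show "?B z y = y $ 1 * ?B z ax1 + y $ 2 * ?B z ax2" by simp
  qed
  have "?B w v = w $ 1 * ?B ax1 v + w $ 2 * ?B ax2 v" by (rule B(1))
  also have "?B ax1 v = v $ 2 * ?B ax1 ax2"
    using B(2)[of ax1 v] curvature_metric_zero[OF u] by simp
  also have "?B ax2 v = v $ 1 * ?B ax2 ax1"
    using B(2)[of ax2 v] curvature_metric_zero[OF u] by simp
  also have "?B ax1 ax2 = - ?B ax2 ax1" by (rule curvature_metric_skew[OF u])
  finally have "?B w v = cross2 v w * ?B ax2 ax1" by (simp add: cross2_def algebra_simps)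
  then show ?thesis unfolding 1 by (simp add: G_simps[OF u] power2_eq_square)
qed

lemma gram_change_basis:
  assumes u: "u \<in> U"
  shows "G u v v * G u w w - (G u v w)\<^sup>2 = (cross2 v w)\<^sup>2 * (G u ax1 ax1 * G u ax2 ax2 - (G u ax1 ax2)\<^sup>2)"
proof -
  have e: "G u a b = a $ 1 * b $ 1 * G u ax1 ax1 + (a $ 1 * b $ 2 + a $ 2 * b $ 1) * G u ax1 ax2 + a $ 2 * b $ 2 * G u ax2 ax2" for a b
    by (subst vec2_axis[of a], subst vec2_axis[of b])
      (simp add: G_simps[OF u] sym_G[OF u, of ax2 ax1] algebra_simps)
  show ?thesis unfolding e[of v v] e[of w w] e[of v w] cross2_def by (simp add: power2_eq_square algebra_simps)
qed

end

section \<open>Coordinate expressions of isometries\<close>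

locale local_isometry = S: local_metric U G + T: local_metric V H
  for U :: "(real^2) set" and G and V :: "(real^2) set" and H +
  fixes \<phi> :: "real^2 \<Rightarrow> real^2"
  assumes smooth: "smooth_on \<phi> U" and maps: "u \<in> U \<Longrightarrow> \<phi> u \<in> V"
    and pullback: "u \<in> U \<Longrightarrow>
      G u v w = H (\<phi> u) (frechet_derivative \<phi> (at u) v) (frechet_derivative \<phi> (at u) w)"
begin

abbreviation (input) D\<phi> :: "real^2 \<Rightarrow> real^2 \<Rightarrow> real^2" where
  "D\<phi> u \<equiv> frechet_derivative \<phi> (at u)"
abbreviation (input) DD\<phi> :: "real^2 \<Rightarrow> real^2 \<Rightarrow> real^2 \<Rightarrow> real^2" where
  "DD\<phi> u v w \<equiv> frechet_derivative (\<lambda>x. D\<phi> x w) (at u) v"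

lemma linear_D\<phi>: "u \<in> U \<Longrightarrow> linear (D\<phi> u)"
  by (rule smooth_on_linear_derivative[OF smooth])

text \<open>A vector killed by the derivative has \<open>G\<close>-length zero by
  \<open>pullback\<close>, so the derivative is injective, and source and target have equal
  dimension.\<close>

lemma D\<phi>_onto:
  assumes u: "u \<in> U"
  obtains v where "D\<phi> u v = x"
proof -
  have "v = 0" if "D\<phi> u v = 0" for v
    using pullback[OF u, of v v] S.pos_G[OF u, of v] that T.G_simps(9)[OF maps[OF u]] by auto
  then show ?thesis using linear_trivial_kernel_surj[OF linear_D\<phi>[OF u]] that by blast
qed

lemma DD\<phi>_sym: "u \<in> U \<Longrightarrow> DD\<phi> u v w = DD\<phi> u w v"
  by (rule symmetric_second_derivative[OF S.open_U smooth])

text \<open>The uniqueness of the Levi-Civita connection in the form that covers a change of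
  coordinates: the defect \<open>T\<close> is symmetric, and differentiating \<open>pullback\<close>
  in two ways shows that \<open>H (\<phi> u) (T v w) (D\<phi> u z)\<close> is skew in
  \<open>w\<close> and \<open>z\<close>. Such a trilinear pattern vanishes.\<close>

lemma christoffel_pushforward:
  assumes u: "u \<in> U"
  shows "D\<phi> u (christoffel_form G u v w) = christoffel_form H (\<phi> u) (D\<phi> u v) (D\<phi> u w) + DD\<phi> u v w"
proof -
  define T where "T v w = D\<phi> u (christoffel_form G u v w) - christoffel_form H (\<phi> u) (D\<phi> u v) (D\<phi> u w) - DD\<phi> u v w"
    for v w
  note fu = maps[OF u]
  have Tsym: "T v w = T w v" for v w
    unfolding T_def using S.christoffel_sym[OF u] T.christoffel_sym[OF fu] DD\<phi>_sym[OF u] by metis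
  have skew: "H (\<phi> u) (T v w) (D\<phi> u z) = - H (\<phi> u) (D\<phi> u w) (T v z)" for v w z
  proof -
    have "frechet_derivative (\<lambda>x. G x w z) (at u) = frechet_derivative (\<lambda>x. H (\<phi> x) (D\<phi> x w) (D\<phi> x z)) (at u)"
      by (rule frechet_derivative_cong_open[OF S.open_U u pullback])
    also have "\<dots> = (\<lambda>v. H (\<phi> u) (DD\<phi> u v w + christoffel_form H (\<phi> u) (D\<phi> u v) (D\<phi> u w)) (D\<phi> u z) +
        H (\<phi> u) (D\<phi> u w) (DD\<phi> u v z + christoffel_form H (\<phi> u) (D\<phi> u v) (D\<phi> u z)))"
      by (intro frechet_derivative_eqI T.has_derivative_metric fu smooth_on_has_derivative[OF smooth u]
          smooth_on_has_derivative[OF smooth_on_frechet_derivative_const[OF smooth] u])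
    finally have "frechet_derivative (\<lambda>x. G x w z) (at u) v = \<dots> v" by simp
    moreover have "frechet_derivative (\<lambda>x. G x w z) (at u) v =
        H (\<phi> u) (D\<phi> u (christoffel_form G u v w)) (D\<phi> u z) + H (\<phi> u) (D\<phi> u w) (D\<phi> u (christoffel_form G u v z))"
      by (simp add: S.dG_christoffel[OF u] pullback[OF u])
    ultimately show ?thesis unfolding T_def by (simp add: T.G_simps[OF fu])
  qed
  \<comment> \<open>Symmetric in the first two arguments and skew in the last two: alternating the
    two exchanges around all permutations returns the value with the opposite sign.\<close>
  have zero: "H (\<phi> u) (T v w) (D\<phi> u z) = 0" for v w z
    using skew[of v w z] skew[of w v z] skew[of z v w] skew[of v z w] skew[of w z v] skew[of z w v]
      Tsym[of v w] Tsym[of v z] Tsym[of w z] T.sym_G[OF fu] by (smt (verit, ccfv_threshold))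
  \<comment> \<open>The defect is tested against itself, which surjectivity of the derivative
    permits.\<close>
  obtain z where "D\<phi> u z = T v w" using D\<phi>_onto[OF u] by blast
  then have "T v w = 0" using zero[of v w z] T.pos_G[OF fu, of "T v w"] by auto
  then show ?thesis by (simp add: T_def algebra_simps)
qed

text \<open>After differentiating the law for \<Gamma> and antisymmetrising in \<open>v\<close> and
  \<open>w\<close>, third derivatives of \<phi> cancel by symmetry, and the second derivatives
  cancel against those that the quadratic terms in \<Gamma> produce.\<close>

lemma curvature_pushforward:
  assumes u: "u \<in> U"
  shows "D\<phi> u (curvature_form G u v w z) = curvature_form H (\<phi> u) (D\<phi> u v) (D\<phi> u w) (D\<phi> u z)"
proof -
  note fu = maps[OF u]
  let ?\<Gamma> = "christoffel_form G" and ?\<Delta> = "christoffel_form H"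
  note D = smooth_on_has_derivative[OF smooth u]
    and DD = smooth_on_has_derivative[OF smooth_on_frechet_derivative_const[OF smooth] u]
  have d: "DD\<phi> u v (?\<Gamma> u w z) + D\<phi> u (frechet_derivative (\<lambda>x. ?\<Gamma> x w z) (at u) v) =
     frechet_derivative (\<lambda>x. ?\<Delta> x (D\<phi> u w) (D\<phi> u z)) (at (\<phi> u)) (D\<phi> u v) +
     ?\<Delta> (\<phi> u) (DD\<phi> u v w) (D\<phi> u z) + ?\<Delta> (\<phi> u) (D\<phi> u w) (DD\<phi> u v z) +
     frechet_derivative (\<lambda>x. DD\<phi> x w z) (at u) v" for v w
  proof -
    have 1: "((\<lambda>x. D\<phi> x (?\<Gamma> x w z)) has_derivative
       (\<lambda>v. DD\<phi> u v (?\<Gamma> u w z) + D\<phi> u (frechet_derivative (\<lambda>x. ?\<Gamma> x w z) (at u) v))) (at u)"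
      by (rule has_derivative_linear_family[of _ "\<lambda>x. x", OF S.open_U u linear_D\<phi> _ has_derivative_ident
            smooth_on_has_derivative[OF S.smooth_christoffel u]])
        (auto intro: smooth_on_differentiable[OF smooth_on_frechet_derivative_const[OF smooth] u])
    have 2: "((\<lambda>x. ?\<Delta> (\<phi> x) (D\<phi> x w) (D\<phi> x z) + DD\<phi> x w z) has_derivative
      (\<lambda>v. frechet_derivative (\<lambda>x. ?\<Delta> x (D\<phi> u w) (D\<phi> u z)) (at (\<phi> u)) (D\<phi> u v) +
     ?\<Delta> (\<phi> u) (DD\<phi> u v w) (D\<phi> u z) + ?\<Delta> (\<phi> u) (D\<phi> u w) (DD\<phi> u v z) +
     frechet_derivative (\<lambda>x. DD\<phi> x w z) (at u) v)) (at u)"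
      by (intro has_derivative_add T.has_derivative_christoffel fu D DD smooth_on_has_derivative[OF _ u]
          smooth_on_frechet_derivative_const smooth)
    \<comment> \<open>Both sides of \<open>christoffel_pushforward\<close> are the same function
      near \<open>u\<close>; uniqueness of its derivative equates the results of the two
      computations.\<close>
    have "((\<lambda>x. ?\<Delta> (\<phi> x) (D\<phi> x w) (D\<phi> x z) + DD\<phi> x w z) has_derivative
       (\<lambda>v. DD\<phi> u v (?\<Gamma> u w z) + D\<phi> u (frechet_derivative (\<lambda>x. ?\<Gamma> x w z) (at u) v))) (at u)"
      by (rule has_derivative_transform_within_open[OF 1 S.open_U u]) (rule christoffel_pushforward)
    from has_derivative_unique[OF this 2] show ?thesis by meson
  qed
  have third: "frechet_derivative (\<lambda>x. DD\<phi> x w z) (at u) v = frechet_derivative (\<lambda>x. DD\<phi> x v z) (at u) w"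
    by (rule symmetric_second_derivative[OF S.open_U smooth_on_frechet_derivative_const[OF smooth] u])
  have q: "D\<phi> u (?\<Gamma> u v (?\<Gamma> u w z)) = ?\<Delta> (\<phi> u) (D\<phi> u v) (?\<Delta> (\<phi> u) (D\<phi> u w) (D\<phi> u z)) +
     ?\<Delta> (\<phi> u) (D\<phi> u v) (DD\<phi> u w z) + DD\<phi> u v (?\<Gamma> u w z)" for v w
    by (simp add: christoffel_pushforward[OF u] T.christoffel_simps[OF fu])
  \<comment> \<open>The terms in \<open>DD\<phi>\<close> are added and subtracted so that each
    bracket is the left side of \<open>d\<close> or a rearrangement of \<open>q\<close>.\<close>
  have "D\<phi> u (curvature_form G u v w z) =
      (DD\<phi> u v (?\<Gamma> u w z) + D\<phi> u (frechet_derivative (\<lambda>x. ?\<Gamma> x w z) (at u) v))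
      - (DD\<phi> u w (?\<Gamma> u v z) + D\<phi> u (frechet_derivative (\<lambda>x. ?\<Gamma> x v z) (at u) w))
      + (D\<phi> u (?\<Gamma> u v (?\<Gamma> u w z)) - DD\<phi> u v (?\<Gamma> u w z))
      - (D\<phi> u (?\<Gamma> u w (?\<Gamma> u v z)) - DD\<phi> u w (?\<Gamma> u v z))"
    using linear_D\<phi>[OF u] by (simp add: curvature_form_def Let_def linear_add linear_diff)
  also have "\<dots> = curvature_form H (\<phi> u) (D\<phi> u v) (D\<phi> u w) (D\<phi> u z)"
    unfolding d q by (simp add: curvature_form_def Let_def third DD\<phi>_sym[OF u, of w v])
  finally show ?thesis .
qed

lemma gauss_form_pushforward:
  assumes u: "u \<in> U"
  shows "gauss_form G u = gauss_form H (\<phi> u)"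
proof -
  note fu = maps[OF u]
  let ?c = "cross2 (D\<phi> u ax1) (D\<phi> u ax2)"
  have n: "G u (curvature_form G u ax1 ax2 ax2) ax1 =
      ?c\<^sup>2 * H (\<phi> u) (curvature_form H (\<phi> u) ax1 ax2 ax2) ax1"
    by (simp add: pullback[OF u] curvature_pushforward[OF u] T.curvature_change_basis[OF fu, of "D\<phi> u ax1"])
  have d: "G u ax1 ax1 * G u ax2 ax2 - (G u ax1 ax2)\<^sup>2 =
      ?c\<^sup>2 * (H (\<phi> u) ax1 ax1 * H (\<phi> u) ax2 ax2 - (H (\<phi> u) ax1 ax2)\<^sup>2)"
    by (simp add: pullback[OF u] T.gram_change_basis[OF fu, of "D\<phi> u ax1"])
  \<comment> \<open>Otherwise \<open>d\<close> would make the positive Gram determinant of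
    \<open>G\<close> vanish.\<close>
  then have "?c \<noteq> 0" using S.gram_pos[OF u] by auto
  then show ?thesis unfolding gauss_form_def n d by simp
qed

end


section \<open>Calculus on manifolds\<close>

lemma chart_inv_left: "is_chart c \<Longrightarrow> x \<in> fst c \<Longrightarrow> chart_inv c (snd c x) = x"
  by (simp add: chart_inv_def is_chart_def)

lemma chart_inv_right: "u \<in> snd c ` fst c \<Longrightarrow> snd c (chart_inv c u) = u"
  by (simp add: chart_inv_def f_inv_into_f)

lemma chart_inv_in: "u \<in> snd c ` fst c \<Longrightarrow> chart_inv c u \<in> fst c"
  by (simp add: chart_inv_def inv_into_into)

lemma charts_atD: "c \<in> charts_at A x \<Longrightarrow> c \<in> A" "c \<in> charts_at A x \<Longrightarrow> x \<in> fst c"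
  by (auto simp: charts_at_def)

lemma charts_atI: "c \<in> A \<Longrightarrow> x \<in> fst c \<Longrightarrow> c \<in> charts_at A x"
  by (auto simp: charts_at_def)

lemma carrier_ofI: "c \<in> A \<Longrightarrow> x \<in> fst c \<Longrightarrow> x \<in> carrier_of A"
  by (auto simp: carrier_of_def)

lemma charts_at_carrier: "c \<in> charts_at A x \<Longrightarrow> x \<in> carrier_of A"
  by (auto simp: carrier_of_def charts_at_def)

lemma carrier_ofE:
  assumes "x \<in> carrier_of A"
  obtains c where "c \<in> charts_at A x"
  using assms by (auto simp: carrier_of_def charts_at_def)

lemma some_chart_at: "c \<in> charts_at A x \<Longrightarrow> (SOME c. c \<in> charts_at A x) \<in> charts_at A x"
  by (rule someI)

lemma smooth_atlas_chart: "smooth_atlas A \<Longrightarrow> c \<in> A \<Longrightarrow> is_chart c"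
  by (simp add: smooth_atlas_def)

lemma smooth_transition:
  assumes "smooth_atlas A" "c \<in> A" "d \<in> A"
  shows "open (snd c ` (fst c \<inter> fst d))" "smooth_on (transition c d) (snd c ` (fst c \<inter> fst d))"
  using assms by (auto simp: smooth_atlas_def compatible_def)

lemma has_derivative_transition:
  assumes "smooth_atlas A" "c \<in> charts_at A x" "d \<in> charts_at A x"
  shows "(transition c d has_derivative frechet_derivative (transition c d) (at (snd c x))) (at (snd c x))"
  using assms by (intro smooth_on_has_derivative[OF smooth_transition(2)]) (auto simp: charts_at_def)

lemma transition_self:
  assumes "is_chart c" "x \<in> fst c"
  shows "frechet_derivative (transition c c) (at (snd c x)) = (\<lambda>v. v)"
proof -
  have "frechet_derivative (transition c c) (at (snd c x)) = frechet_derivative (\<lambda>u. u) (at (snd c x))"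
    by (rule frechet_derivative_cong_open[of "snd c ` fst c"])
      (use assms in \<open>auto simp: is_chart_def transition_def chart_inv_right\<close>)
  then show ?thesis by simp
qed

lemma tangent_space_transition:
  "v \<in> tangent_space A x \<Longrightarrow> c \<in> charts_at A x \<Longrightarrow> d \<in> charts_at A x \<Longrightarrow>
    v d = frechet_derivative (transition c d) (at (snd c x)) (v c)"
  unfolding tangent_space_def by blast

lemma tangent_space_outside: "v \<in> tangent_space A x \<Longrightarrow> c \<notin> charts_at A x \<Longrightarrow> v c = 0"
  unfolding tangent_space_def by blast

lemma tangent_spaceI:
  assumes "\<And>c d. c \<in> charts_at A x \<Longrightarrow> d \<in> charts_at A x \<Longrightarrow>
      v d = frechet_derivative (transition c d) (at (snd c x)) (v c)"
    and "\<And>c. c \<notin> charts_at A x \<Longrightarrow> v c = 0"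
  shows "v \<in> tangent_space A x"
  using assms unfolding tangent_space_def by blast

text \<open>Reduces equalities of tangent vectors to a single chart. The convention that tangent
  vectors are zero off \<open>charts_at A x\<close> makes this an equality of functions.\<close>

lemma tangent_space_eqI:
  assumes "v \<in> tangent_space A x" "w \<in> tangent_space A x" "c \<in> charts_at A x" "v c = w c"
  shows "v = w"
proof
  fix d show "v d = w d"
  proof (cases "d \<in> charts_at A x")
    case True
    show ?thesis
      unfolding tangent_space_transition[OF assms(1,3) True] tangent_space_transition[OF assms(2,3) True] assms(4) ..
  next
    case False
    then show ?thesis by (simp add: tangent_space_outside[OF assms(1)] tangent_space_outside[OF assms(2)])
  qed
qed

lemma tangent_space_lincomb:
  assumes "smooth_atlas A" "v \<in> tangent_space A x" "w \<in> tangent_space A x"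
  shows "(\<lambda>c. a *\<^sub>R v c + b *\<^sub>R w c) \<in> tangent_space A x"
proof -
  have "a *\<^sub>R v d + b *\<^sub>R w d = frechet_derivative (transition c d) (at (snd c x)) (a *\<^sub>R v c + b *\<^sub>R w c)"
    if "c \<in> charts_at A x" "d \<in> charts_at A x" for c d
  proof -
    have l: "linear (frechet_derivative (transition c d) (at (snd c x)))"
      using has_derivative_transition[OF assms(1) that] has_derivative_linear by blast
    show ?thesis
      using tangent_space_transition[OF assms(2) that] tangent_space_transition[OF assms(3) that]
      by (simp add: linear_add[OF l] linear_scale[OF l])
  qed
  then show ?thesis
    by (rule tangent_spaceI) (use tangent_space_outside[OF assms(2)] tangent_space_outside[OF assms(3)] in simp_all)
qed

lemma tangent_space_zero:
  assumes "smooth_atlas A"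
  shows "(\<lambda>c. 0) \<in> tangent_space A x"
  by (rule tangent_spaceI)
    (use linear_0[OF has_derivative_linear[OF has_derivative_transition[OF assms]]] in auto)

lemma has_derivative_chart_change:
  assumes A: "smooth_atlas A" and c: "c \<in> charts_at A x" and d: "d \<in> charts_at A x"
    and F: "(F \<circ> chart_inv c has_derivative D) (at (snd c x))"
  shows "(F \<circ> chart_inv d has_derivative
    D \<circ> frechet_derivative (transition d c) (at (snd d x))) (at (snd d x))"
proof -
  have cc: "is_chart c" "is_chart d" "x \<in> fst c" "x \<in> fst d" "c \<in> A" "d \<in> A"
    using A c d by (auto simp: charts_at_def smooth_atlas_chart)
  have t: "transition d c (snd d x) = snd c x"
    using cc by (simp add: transition_def chart_inv_left)
  have "((F \<circ> chart_inv c) \<circ> transition d c has_derivative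
    D \<circ> frechet_derivative (transition d c) (at (snd d x))) (at (snd d x))"
    by (rule diff_chain_at[OF has_derivative_transition[OF A d c]]) (simp add: t F)
  then show ?thesis
  proof (rule has_derivative_transform_within_open[where s = "snd d ` (fst d \<inter> fst c)"])
    show "open (snd d ` (fst d \<inter> fst c))" by (rule smooth_transition[OF A]) (use cc in auto)
    show "snd d x \<in> snd d ` (fst d \<inter> fst c)" using cc by auto
    show "(F \<circ> chart_inv c \<circ> transition d c) y = (F \<circ> chart_inv d) y" if "y \<in> snd d ` (fst d \<inter> fst c)" for y
      using that cc by (auto simp: transition_def chart_inv_left)
  qed
qed

text \<open>Frees \<open>fun_differential\<close> from the chart chosen by \<open>SOME\<close>: by
  the chain rule the Jacobian of the transition map enters the derivative of \<open>F\<close>, and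
  it cancels against the transformation law of \<open>v\<close>.\<close>

lemma fun_differential_eq:
  assumes A: "smooth_atlas A" and c: "c \<in> charts_at A x" and v: "v \<in> tangent_space A x"
    and F: "(F \<circ> chart_inv c has_derivative D) (at (snd c x))"
  shows "fun_differential A F x v = D (v c)"
proof -
  let ?d = "SOME c. c \<in> charts_at A x"
  have d: "?d \<in> charts_at A x" by (rule some_chart_at[OF c])
  show ?thesis
    unfolding fun_differential_def Let_def
      frechet_derivative_eqI[OF has_derivative_chart_change[OF A c d F]]
    by (simp add: tangent_space_transition[OF v d c])
qed

lemma fun_differential_chart:
  assumes A: "smooth_atlas A" and c: "c \<in> charts_at A x" and v: "v \<in> tangent_space A x"
  shows "fun_differential A (snd c) x v = v c"
proof -
  have "(snd c \<circ> chart_inv c has_derivative (\<lambda>v. v)) (at (snd c x))"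
    by (rule has_derivative_transform_within_open[OF has_derivative_ident, of "snd c ` fst c"])
      (use A c in \<open>auto simp: charts_at_def is_chart_def chart_inv_right dest: smooth_atlas_chart\<close>)
  then show ?thesis using fun_differential_eq[OF A c v] by blast
qed

text \<open>Agreement on the carrier suffices because chart inverses map the open chart images into
  it. Identities of bundle maps, such as \<open>frame_map_ident\<close>, hold only there.\<close>

lemma fun_differential_cong:
  assumes A: "smooth_atlas A" and c: "c \<in> charts_at A x" and F: "\<And>y. y \<in> carrier_of A \<Longrightarrow> F y = F' y"
  shows "fun_differential A F x = fun_differential A F' x"
proof -
  let ?d = "SOME c. c \<in> charts_at A x"
  have d: "?d \<in> charts_at A x" by (rule some_chart_at[OF c])
  have "frechet_derivative (F \<circ> chart_inv ?d) (at (snd ?d x)) = frechet_derivative (F' \<circ> chart_inv ?d) (at (snd ?d x))"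
    by (rule frechet_derivative_cong_open[of "snd ?d ` fst ?d"])
      (use A charts_atD[OF d] in \<open>auto simp: is_chart_def intro!: F dest: smooth_atlas_chart chart_inv_in intro: carrier_ofI chart_inv_in\<close>)
  then show ?thesis by (simp add: fun_differential_def fun_eq_iff)
qed

lemma differential_cong:
  fixes B :: "('n, 'f::euclidean_space) chart set"
  assumes A: "smooth_atlas A" and x: "x \<in> carrier_of A" and f: "\<And>y. y \<in> carrier_of A \<Longrightarrow> f y = f' y"
  shows "differential A B f x = differential A B f' x"
proof -
  obtain c where c: "c \<in> charts_at A x" using x by (rule carrier_ofE)
  have "fun_differential A (snd d \<circ> f) x = fun_differential A (snd d \<circ> f') x" for d :: "('n, 'f) chart"
    by (rule fun_differential_cong[OF A c]) (simp add: f)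
  then show ?thesis unfolding differential_def f[OF x] by (intro ext) simp
qed

lemma differential_ident:
  assumes A: "smooth_atlas A" and v: "v \<in> tangent_space A x"
  shows "differential A A (\<lambda>x. x) x v = v"
  using fun_differential_chart[OF A _ v] tangent_space_outside[OF v]
  by (auto simp: differential_def o_def)

section \<open>Differentials of smooth maps in charts, and their functoriality\<close>

lemma smooth_map_coord:
  assumes "smooth_map A W B W' f" "c \<in> A" "d \<in> B"
  shows "open (snd c ` (fst c \<inter> W \<inter> f -` fst d))"
    "smooth_on (snd d \<circ> f \<circ> chart_inv c) (snd c ` (fst c \<inter> W \<inter> f -` fst d))"
  using assms by (auto simp: smooth_map_def Let_def)

lemma smooth_map_has_derivative:
  assumes "smooth_map A W B W' f" "x \<in> W" "c \<in> charts_at A x" "d \<in> charts_at B (f x)"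
  shows "(snd d \<circ> f \<circ> chart_inv c has_derivative
    frechet_derivative (snd d \<circ> f \<circ> chart_inv c) (at (snd c x))) (at (snd c x))"
  using assms by (intro smooth_on_has_derivative[OF smooth_map_coord(2)[OF assms(1)]]) (auto simp: charts_at_def)

lemma differential_coord:
  assumes A: "smooth_atlas A" and f: "smooth_map A W B W' f" "x \<in> W"
    and c: "c \<in> charts_at A x" and d: "d \<in> charts_at B (f x)" and v: "v \<in> tangent_space A x"
  shows "differential A B f x v d = frechet_derivative (snd d \<circ> f \<circ> chart_inv c) (at (snd c x)) (v c)"
  using fun_differential_eq[OF A c v smooth_map_has_derivative[OF f c d]] d by (simp add: differential_def)

lemma differential_outside: "d \<notin> charts_at B (f x) \<Longrightarrow> differential A B f x v d = 0"
  by (simp add: differential_def)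

lemma has_derivative_comp_smooth_map:
  assumes A: "smooth_atlas A" and B: "smooth_atlas B"
    and f: "smooth_map A W B W' f" "x \<in> W"
    and c: "c \<in> charts_at A x" and d: "d \<in> charts_at B (f x)"
    and F: "(F \<circ> chart_inv d has_derivative D) (at (snd d (f x)))"
  shows "((F \<circ> f) \<circ> chart_inv c has_derivative
    D \<circ> frechet_derivative (snd d \<circ> f \<circ> chart_inv c) (at (snd c x))) (at (snd c x))"
proof -
  have cc: "is_chart c" "is_chart d" "x \<in> fst c" "f x \<in> fst d" "c \<in> A" "d \<in> B"
    using A B c d by (auto simp: charts_at_def smooth_atlas_chart)
  have "((F \<circ> chart_inv d) \<circ> (snd d \<circ> f \<circ> chart_inv c) has_derivative
    D \<circ> frechet_derivative (snd d \<circ> f \<circ> chart_inv c) (at (snd c x))) (at (snd c x))"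
    by (rule diff_chain_at[OF smooth_map_has_derivative[OF f c d]]) (simp add: chart_inv_left cc F)
  then show ?thesis
    by (rule has_derivative_transform_within_open[OF _ smooth_map_coord(1)[OF f(1) cc(5,6)]])
      (use cc f(2) in \<open>auto simp: chart_inv_left\<close>)
qed

lemma differential_in_tangent_space:
  assumes A: "smooth_atlas A" and B: "smooth_atlas B"
    and f: "smooth_map A W B W' f" "x \<in> W" and c: "c \<in> charts_at A x" and v: "v \<in> tangent_space A x"
  shows "differential A B f x v \<in> tangent_space B (f x)"
proof -
  have "differential A B f x v e = frechet_derivative (transition d e) (at (snd d (f x))) (differential A B f x v d)"
    if d: "d \<in> charts_at B (f x)" and e: "e \<in> charts_at B (f x)" for d e
  proof -
    have "(snd e \<circ> chart_inv d has_derivative frechet_derivative (transition d e) (at (snd d (f x)))) (at (snd d (f x)))"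
      using has_derivative_transition[OF B d e] by (simp add: transition_def)
    from has_derivative_comp_smooth_map[OF A B f c d this]
    have "fun_differential A (snd e \<circ> f) x v = (frechet_derivative (transition d e) (at (snd d (f x))) \<circ>
        frechet_derivative (snd d \<circ> f \<circ> chart_inv c) (at (snd c x))) (v c)"
      by (intro fun_differential_eq[OF A c v])
    then show ?thesis
      using e by (simp add: differential_coord[OF A f c d v]) (simp add: differential_def)
  qed
  then show ?thesis by (rule tangent_spaceI) (auto simp: differential_outside)
qed

lemma fun_differential_comp:
  assumes A: "smooth_atlas A" and B: "smooth_atlas B"
    and f: "smooth_map A W B W' f" "x \<in> W" and c: "c \<in> charts_at A x" and v: "v \<in> tangent_space A x"
    and d: "d \<in> charts_at B (f x)" and F: "(F \<circ> chart_inv d has_derivative D) (at (snd d (f x)))"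
  shows "fun_differential B F (f x) (differential A B f x v) = fun_differential A (F \<circ> f) x v"
  using fun_differential_eq[OF B d differential_in_tangent_space[OF A B f c v] F]
    fun_differential_eq[OF A c v has_derivative_comp_smooth_map[OF A B f c d F]]
  by (simp add: differential_coord[OF A f c d v])

lemma differential_comp:
  assumes A: "smooth_atlas A" and B: "smooth_atlas B" and C: "smooth_atlas C"
    and f: "smooth_map A W B W' f" "x \<in> W" and g: "smooth_map B X C X' g" "f x \<in> X"
    and c: "c \<in> charts_at A x" and d: "d \<in> charts_at B (f x)" and v: "v \<in> tangent_space A x"
  shows "differential B C g (f x) (differential A B f x v) = differential A C (g \<circ> f) x v"
proof
  fix e
  show "differential B C g (f x) (differential A B f x v) e = differential A C (g \<circ> f) x v e"
  proof (cases "e \<in> charts_at C (g (f x))")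
    case True
    have "(snd e \<circ> g \<circ> chart_inv d has_derivative frechet_derivative (snd e \<circ> g \<circ> chart_inv d) (at (snd d (f x)))) (at (snd d (f x)))"
      by (rule smooth_map_has_derivative[OF g d True])
    from fun_differential_comp[where F = "snd e \<circ> g", OF A B f c v d this] True
    show ?thesis by (simp add: differential_def o_assoc)
  qed (simp add: differential_def)
qed

lemma fun_differential_lincomb:
  assumes A: "smooth_atlas A" and c: "c \<in> charts_at A x"
    and v: "v \<in> tangent_space A x" and w: "w \<in> tangent_space A x"
    and F: "(F \<circ> chart_inv c has_derivative D) (at (snd c x))"
  shows "fun_differential A F x (\<lambda>c. a *\<^sub>R v c + b *\<^sub>R w c) =
    a *\<^sub>R fun_differential A F x v + b *\<^sub>R fun_differential A F x w"
proof -
  have D: "linear D" using F has_derivative_linear by blast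
  show ?thesis
    unfolding fun_differential_eq[OF A c v F] fun_differential_eq[OF A c w F]
      fun_differential_eq[OF A c tangent_space_lincomb[OF A v w] F]
    by (simp add: linear_add[OF D] linear_scale[OF D])
qed

lemma differential_lincomb:
  assumes A: "smooth_atlas A" and f: "smooth_map A W B W' f" "x \<in> W" and c: "c \<in> charts_at A x"
    and v: "v \<in> tangent_space A x" and w: "w \<in> tangent_space A x"
  shows "differential A B f x (\<lambda>c. a *\<^sub>R v c + b *\<^sub>R w c) =
    (\<lambda>d. a *\<^sub>R differential A B f x v d + b *\<^sub>R differential A B f x w d)"
proof
  fix d
  show "differential A B f x (\<lambda>c. a *\<^sub>R v c + b *\<^sub>R w c) d =
    a *\<^sub>R differential A B f x v d + b *\<^sub>R differential A B f x w d"
    using fun_differential_lincomb[OF A c v w smooth_map_has_derivative[OF f c]]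
    by (simp add: differential_def)
qed

text \<open>The cocycle law for the Jacobians of transition maps, obtained from the chain rule on
  overlaps.\<close>

lemma coord_vector_in_tangent_space:
  assumes A: "smooth_atlas A" and c: "c \<in> charts_at A x"
  shows "coord_vector A c x a \<in> tangent_space A x"
proof -
  have "frechet_derivative (transition c e) (at (snd c x)) a =
      frechet_derivative (transition d e) (at (snd d x)) (frechet_derivative (transition c d) (at (snd c x)) a)"
    if d: "d \<in> charts_at A x" and e: "e \<in> charts_at A x" for d e
  proof -
    have "(snd e \<circ> chart_inv d has_derivative frechet_derivative (transition d e) (at (snd d x))) (at (snd d x))"
      using has_derivative_transition[OF A d e] by (simp add: transition_def)
    from frechet_derivative_eqI[OF has_derivative_chart_change[OF A d c this]]
    show ?thesis by (simp add: transition_def)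
  qed
  note chain = this
  show ?thesis
  proof (rule tangent_spaceI)
    fix d e assume d: "d \<in> charts_at A x" and e: "e \<in> charts_at A x"
    show "coord_vector A c x a e = frechet_derivative (transition d e) (at (snd d x)) (coord_vector A c x a d)"
      using d e by (simp add: coord_vector_def) (rule chain[OF d e])
  qed (simp add: coord_vector_def)
qed

lemma coord_vector_self:
  assumes "smooth_atlas A" "c \<in> charts_at A x"
  shows "coord_vector A c x a c = a"
  using assms transition_self[of c x] by (auto simp: coord_vector_def charts_at_def smooth_atlas_chart)

lemma coord_vector_tangent:
  assumes "smooth_atlas A" "c \<in> charts_at A x" "v \<in> tangent_space A x"
  shows "coord_vector A c x (v c) = v"
  by (rule tangent_space_eqI[OF coord_vector_in_tangent_space assms(3)]) (use assms in \<open>auto simp: coord_vector_self\<close>)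

lemma coord_vector_lincomb:
  assumes "smooth_atlas A" "c \<in> charts_at A x"
  shows "coord_vector A c x (a *\<^sub>R v + b *\<^sub>R w) =
    (\<lambda>d. a *\<^sub>R coord_vector A c x v d + b *\<^sub>R coord_vector A c x w d)"
  using assms
  by (intro tangent_space_eqI[OF _ tangent_space_lincomb assms(2)])
    (auto simp: coord_vector_in_tangent_space coord_vector_self)

lemma smooth_map_ident:
  assumes "smooth_atlas A"
  shows "smooth_map A (carrier_of A) A (carrier_of A) (\<lambda>x. x)"
proof -
  have "fst c \<inter> carrier_of A \<inter> (\<lambda>x. x) -` fst d = fst c \<inter> fst d" if "c \<in> A" for c d
    using that by (auto simp: carrier_of_def)
  then show ?thesis
    using smooth_transition[OF assms] by (auto simp: smooth_map_def Let_def transition_def comp_def)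
qed

lemma sym_bilinear_onD:
  assumes "sym_bilinear_on T h" "v \<in> T" "w \<in> T"
  shows "h v w = h w v"
    and "z \<in> T \<Longrightarrow> h (\<lambda>c. a *\<^sub>R v c + b *\<^sub>R w c) z = a * h v z + b * h w z"
  using assms unfolding sym_bilinear_on_def by blast+


section \<open>Oriented surfaces and their isometries\<close>

lemma cross2_det: "det (vector [v, w] :: real^2^2) = cross2 v w"
  by (simp add: det_2 cross2_def)

lemma det_matrix_cross2: "det (matrix L :: real^2^2) = cross2 (L ax1) (L ax2)"
  by (simp add: det_2 cross2_def matrix_def)

lemma (in local_metric) local_metric_subset: "open S \<Longrightarrow> S \<subseteq> U \<Longrightarrow> local_metric S G"
  by unfold_locales (auto intro: bilinear_G sym_G pos_G smooth_on_subset[OF smooth_G])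

lemma christoffel_eq_form: "christoffel A g c = christoffel_form (metric_coord A g c)"
  by (simp add: christoffel_def christoffel_form_def is_christoffel_def fun_eq_iff)

lemma gauss_curvature_eq_form:
  "gauss_curvature A g x =
    (let c = (SOME c. c \<in> charts_at A x) in gauss_form (metric_coord A g c) (snd c x))"
  by (simp add: gauss_curvature_def gauss_form_def Let_def curvature_form_def curvature_tensor_def christoffel_eq_form)

locale oriented_surface =
  fixes A :: "('m, real^2) chart set" and g :: "('m, real^2) metric"
  assumes atlas: "smooth_atlas A" and oriented: "oriented_atlas A" and metric: "riemannian_metric A g"
begin

abbreviation (input) "G \<equiv> metric_coord A g"
abbreviation (input) "M \<equiv> carrier_of A"

lemma g_sym_bilinear: "x \<in> M \<Longrightarrow> sym_bilinear_on (tangent_space A x) (g x)"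
  using metric by (auto simp: riemannian_metric_def)

lemma chart_is_chart: "c \<in> A \<Longrightarrow> is_chart c"
  using atlas smooth_atlas_chart by blast

lemma metric_coord_eq:
  assumes "c \<in> charts_at A x" "v \<in> tangent_space A x" "w \<in> tangent_space A x"
  shows "G c (snd c x) (v c) (w c) = g x v w"
  using assms chart_inv_left[OF chart_is_chart, of c x]
  by (simp add: metric_coord_def Let_def charts_at_def coord_vector_tangent[OF atlas])

lemma local_metric_chart:
  assumes c: "c \<in> A"
  shows "local_metric (snd c ` fst c) (G c)"
proof
  show "open (snd c ` fst c)" using chart_is_chart[OF c] by (simp add: is_chart_def)
  show "smooth_on (\<lambda>u. G c u v w) (snd c ` fst c)" for v w
    using metric c by (simp add: riemannian_metric_def)
  fix u assume "u \<in> snd c ` fst c"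
  then obtain x where x: "x \<in> fst c" "u = snd c x" by blast
  have cx: "c \<in> charts_at A x" using c x by (simp add: charts_at_def)
  have inv: "chart_inv c u = x" using chart_inv_left[OF chart_is_chart[OF c]] x by simp
  have xM: "x \<in> M" by (rule carrier_ofI[OF c x(1)])
  note b = sym_bilinear_onD[OF g_sym_bilinear[OF xM]] and T = coord_vector_in_tangent_space[OF atlas cx]
  have Gu: "G c u = (\<lambda>v w. g x (coord_vector A c x v) (coord_vector A c x w))"
    by (simp add: metric_coord_def Let_def inv fun_eq_iff)
  show s: "G c u v w = G c u w v" for v w unfolding Gu by (rule b(1)[OF T T])
  have l: "linear (\<lambda>v. G c u v w)" for w
    by (rule linearI_lincomb) (simp add: Gu coord_vector_lincomb[OF atlas cx] b(2)[OF T T T])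
  show "bilinear (G c u)"
  proof -
    have "(\<lambda>v. G c u v w) = G c u w" for w by (rule ext, rule s)
    then show ?thesis using l by (simp add: bilinear_def)
  qed
  show "G c u v v > 0" if "v \<noteq> 0" for v
  proof -
    have "coord_vector A c x v \<noteq> (\<lambda>c. 0)"
      using coord_vector_self[OF atlas cx, of v] that by metis
    then show ?thesis
      using metric xM T[of v] by (auto simp: riemannian_metric_def Gu)
  qed
qed

lemma cross2_transition:
  assumes "c \<in> charts_at A x" "d \<in> charts_at A x" "v \<in> tangent_space A x" "w \<in> tangent_space A x"
    "cross2 (v c) (w c) > 0"
  shows "cross2 (v d) (w d) > 0"
proof -
  let ?L = "frechet_derivative (transition c d) (at (snd c x))"
  have L: "linear ?L" using has_derivative_transition[OF atlas assms(1,2)] has_derivative_linear by blast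
  have "cross2 (?L ax1) (?L ax2) > 0"
    using oriented assms(1,2) unfolding det_matrix_cross2[symmetric] oriented_atlas_def charts_at_def by blast
  then show ?thesis
    unfolding tangent_space_transition[OF assms(3,1,2)] tangent_space_transition[OF assms(4,1,2)]
      cross2_linear[OF L, of "v c" "w c"]
    using assms(5) by (rule mult_pos_pos)
qed

text \<open>\<open>positive_basis\<close> quantifies over all charts; transition determinants of an
  oriented atlas are positive, so the sign in one chart decides.\<close>

lemma positive_basis_iff:
  assumes "c \<in> charts_at A x" "v \<in> tangent_space A x" "w \<in> tangent_space A x"
  shows "positive_basis A x v w \<longleftrightarrow> cross2 (v c) (w c) > 0"
  using assms cross2_transition[OF assms(1) _ assms(2,3)] by (auto simp: positive_basis_def cross2_det)

end

text \<open>Contains only pointwise and local properties of \<open>f\<close>, so that the naturality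
  results can be instantiated with the given isometry, with its inverse and with the
  identity.\<close>

locale surface_isometry = oriented_surface A g for A g +
  fixes f
  assumes smooth_f: "smooth_map A (carrier_of A) A (carrier_of A) f"
    and isometric: "x \<in> carrier_of A \<Longrightarrow> v \<in> tangent_space A x \<Longrightarrow> w \<in> tangent_space A x \<Longrightarrow>
      g (f x) (differential A A f x v) (differential A A f x w) = g x v w"
    and orientation: "orientation_preserving A f"
begin

abbreviation (input) "df \<equiv> differential A A f"
abbreviation (input) "loc c d \<equiv> snd d \<circ> f \<circ> chart_inv c"
abbreviation (input) "ldom c d \<equiv> snd c ` (fst c \<inter> f -` fst d)"

lemma f_in: "x \<in> M \<Longrightarrow> f x \<in> M"
  using smooth_f by (auto simp: smooth_map_def)

lemma df_in:
  assumes "c \<in> charts_at A x" "v \<in> tangent_space A x"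
  shows "df x v \<in> tangent_space A (f x)"
  by (rule differential_in_tangent_space[OF atlas atlas smooth_f _ assms])
    (rule charts_at_carrier[OF assms(1)])

lemma df_coord:
  assumes "c \<in> charts_at A x" "d \<in> charts_at A (f x)" "v \<in> tangent_space A x"
  shows "df x v d = frechet_derivative (loc c d) (at (snd c x)) (v c)"
  by (rule differential_coord[OF atlas smooth_f _ assms])
    (rule charts_at_carrier[OF assms(1)])

lemma ldom_smooth:
  assumes "c \<in> A" "d \<in> A"
  shows "open (ldom c d)" "smooth_on (loc c d) (ldom c d)"
proof -
  have "fst c \<inter> carrier_of A \<inter> f -` fst d = fst c \<inter> f -` fst d"
    using assms by (auto simp: carrier_of_def)
  then show "open (ldom c d)" "smooth_on (loc c d) (ldom c d)"
    using smooth_map_coord[OF smooth_f assms] by auto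
qed

text \<open>The bridge to the coordinate calculus: \<open>ldom c d\<close> consists of the
  coordinates in \<open>c\<close> of the points that \<open>f\<close> sends into the domain of
  \<open>d\<close>.\<close>

lemma local_isometry_charts:
  assumes c: "c \<in> A" and d: "d \<in> A"
  shows "local_isometry (ldom c d) (G c) (snd d ` fst d) (G d) (loc c d)"
proof -
  interpret S: local_metric "ldom c d" "G c"
    by (rule local_metric.local_metric_subset[OF local_metric_chart[OF c] ldom_smooth(1)[OF c d]]) auto
  interpret T: local_metric "snd d ` fst d" "G d" by (rule local_metric_chart[OF d])
  show ?thesis
  proof
    show "smooth_on (loc c d) (ldom c d)" by (rule ldom_smooth[OF c d])
    fix u assume "u \<in> ldom c d"
    then obtain x where x: "x \<in> fst c" "f x \<in> fst d" "u = snd c x" by auto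
    have inv: "chart_inv c u = x" using chart_inv_left[OF chart_is_chart[OF c]] x by simp
    show "loc c d u \<in> snd d ` fst d" using x inv by auto
    have cx: "c \<in> charts_at A x" and dx: "d \<in> charts_at A (f x)" using c d x by (auto simp: charts_at_def)
    fix v w
    let ?v = "coord_vector A c x v" and ?w = "coord_vector A c x w"
    note T = coord_vector_in_tangent_space[OF atlas cx]
    have "G c u v w = g x ?v ?w" by (simp add: metric_coord_def inv)
    also have "\<dots> = g (f x) (df x ?v) (df x ?w)"
      by (rule isometric[symmetric, OF carrier_ofI[OF c x(1)] T T])
    also have "\<dots> = G d (snd d (f x)) (df x ?v d) (df x ?w d)"
      by (rule metric_coord_eq[symmetric, OF dx df_in[OF cx T] df_in[OF cx T]])
    finally show "G c u v w = G d (loc c d u) (frechet_derivative (loc c d) (at u) v) (frechet_derivative (loc c d) (at u) w)"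
      by (simp add: df_coord[OF cx dx T] coord_vector_self[OF atlas cx] inv x(3)[symmetric])
  qed
qed

text \<open>The charts chosen by \<open>gauss_curvature\<close> at \<open>x\<close> and at
  \<open>f x\<close> are unrelated, which is harmless because the local law holds for every pair of
  charts.\<close>

lemma gauss_curvature_invariant:
  assumes "x \<in> M"
  shows "gauss_curvature A g (f x) = gauss_curvature A g x"
proof -
  let ?c = "SOME c. c \<in> charts_at A x" and ?d = "SOME c. c \<in> charts_at A (f x)"
  have c: "?c \<in> charts_at A x" using assms some_chart_at carrier_ofE by metis
  have d: "?d \<in> charts_at A (f x)" using f_in[OF assms] some_chart_at carrier_ofE by metis
  have "gauss_form (G ?c) (snd ?c x) = gauss_form (G ?d) (loc ?c ?d (snd ?c x))"
    by (rule local_isometry.gauss_form_pushforward[OF local_isometry_charts])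
      (use c d in \<open>auto simp: charts_at_def\<close>)
  also have "loc ?c ?d (snd ?c x) = snd ?d (f x)"
    using c chart_inv_left[OF chart_is_chart, of ?c x] by (simp add: charts_at_def)
  finally show ?thesis by (simp add: gauss_curvature_eq_form Let_def)
qed

text \<open>Applying \<open>orientation_preserving\<close> to the coordinate basis at
  \<open>x\<close> turns it into positivity of the Jacobian determinant.\<close>

lemma cross2_loc:
  assumes c: "c \<in> charts_at A x" and d: "d \<in> charts_at A (f x)"
  defines "L \<equiv> frechet_derivative (loc c d) (at (snd c x))"
  shows "cross2 (L ax1) (L ax2) > 0" "linear L"
proof -
  note T = coord_vector_in_tangent_space[OF atlas c]
  have xM: "x \<in> M" by (rule charts_at_carrier[OF c])
  show "linear L" unfolding L_def
    using smooth_map_has_derivative[OF smooth_f xM c d] has_derivative_linear by blast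
  have "positive_basis A x (coord_vector A c x ax1) (coord_vector A c x ax2)"
    unfolding positive_basis_iff[OF c T T] coord_vector_self[OF atlas c] by (simp add: cross2_def axis_def)
  then have "positive_basis A (f x) (df x (coord_vector A c x ax1)) (df x (coord_vector A c x ax2))"
    using orientation xM T by (auto simp: orientation_preserving_def)
  then show "cross2 (L ax1) (L ax2) > 0"
    unfolding positive_basis_iff[OF d df_in[OF c T] df_in[OF c T]] df_coord[OF c d T] coord_vector_self[OF atlas c] L_def .
qed

lemma positive_basis_df:
  assumes c: "c \<in> charts_at A x" and v: "v \<in> tangent_space A x" and w: "w \<in> tangent_space A x"
  shows "positive_basis A (f x) (df x v) (df x w) \<longleftrightarrow> positive_basis A x v w"
proof -
  obtain d where d: "d \<in> charts_at A (f x)"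
    using f_in[OF charts_at_carrier[OF c]] by (rule carrier_ofE)
  show ?thesis
    unfolding positive_basis_iff[OF c v w] positive_basis_iff[OF d df_in[OF c v] df_in[OF c w]]
      df_coord[OF c d v] df_coord[OF c d w] cross2_linear[OF cross2_loc(2)[OF c d], of "v c" "w c"]
    using cross2_loc(1)[OF c d] by (simp add: zero_less_mult_iff)
qed

text \<open>The chain rule applied to \<open>f \<circ> h\<close> gives \<open>df\<close> after the
  differential of \<open>h\<close> as the identity. The metric property of \<open>h\<close> is then
  that of \<open>f\<close> read backwards, and its orientation property is the converse direction of
  \<open>positive_basis_df\<close>.\<close>

lemma surface_isometry_inverse:
  assumes h: "smooth_map A M A M h" and fh: "\<And>y. y \<in> M \<Longrightarrow> f (h y) = y"
  shows "surface_isometry A g h"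
proof (unfold_locales, rule h)
  have hM: "h y \<in> M" if "y \<in> M" for y using h that by (auto simp: smooth_map_def)
  have dfdh: "df (h y) (differential A A h y v) = v"
    if y: "y \<in> M" and v: "v \<in> tangent_space A y" for y v
  proof -
    obtain c where c: "c \<in> charts_at A y" using y by (rule carrier_ofE)
    obtain d where d: "d \<in> charts_at A (h y)" using hM[OF y] by (rule carrier_ofE)
    have "df (h y) (differential A A h y v) = differential A A (f \<circ> h) y v"
      by (rule differential_comp[OF atlas atlas atlas h y smooth_f hM[OF y] c d v])
    also have "\<dots> = differential A A (\<lambda>y. y) y v"
      by (rule fun_cong[OF differential_cong[OF atlas y]]) (simp add: fh)
    finally show ?thesis using differential_ident[OF atlas v] by simp
  qed
  have dh: "differential A A h y v \<in> tangent_space A (h y)"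
    if y: "y \<in> M" and v: "v \<in> tangent_space A y" for y v
    using differential_in_tangent_space[OF atlas atlas h y _ v] carrier_ofE[OF y] by metis
  show "g (h y) (differential A A h y v) (differential A A h y w) = g y v w"
    if "y \<in> M" "v \<in> tangent_space A y" "w \<in> tangent_space A y" for y v w
    using isometric[OF hM dh dh, of y v w] that by (simp add: dfdh fh)
  show "orientation_preserving A h"
    unfolding orientation_preserving_def
  proof (intro ballI impI)
    fix y v w assume y: "y \<in> M" and v: "v \<in> tangent_space A y" and w: "w \<in> tangent_space A y"
      and p: "positive_basis A y v w"
    obtain d where d: "d \<in> charts_at A (h y)" using hM[OF y] by (rule carrier_ofE)
    show "positive_basis A (h y) (differential A A h y v) (differential A A h y w)"
      using positive_basis_df[OF d dh[OF y v] dh[OF y w]] p by (simp add: dfdh y v w fh)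
  qed
qed

end

lemma (in oriented_surface) surface_isometry_ident: "surface_isometry A g (\<lambda>x. x)"
  by unfold_locales
    (auto simp: smooth_map_ident atlas orientation_preserving_def differential_ident[OF atlas])


section \<open>Orthonormal frames in the plane\<close>

lemma one_plus_cos_pos:
  assumes "- pi < t" "t < pi"
  shows "1 + cos t > 0"
proof -
  have "cos pi < cos \<bar>t\<bar>" by (rule cos_monotone_0_pi) (use assms in auto)
  then show ?thesis by simp
qed

text \<open>The quotient is \<open>tan (t / 2)\<close>, so unlike
  \<open>arctan (sin t / cos t)\<close> this formula recovers the angle on the whole open
  interval.\<close>

lemma half_angle_arctan:
  assumes "- pi < t" "t < pi"
  shows "2 * arctan (sin t / (1 + cos t)) = t"
proof -
  have "sin t / (1 + cos t) = tan (t / 2)"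
    using tan_half[of "t / 2"] by (simp add: add.commute)
  then show ?thesis using arctan_tan[of "t / 2"] assms by simp
qed

lemma angle_exists:
  assumes "x\<^sup>2 + y\<^sup>2 = (1::real)"
  obtains t where "- pi < t" "t \<le> pi" "x = cos t" "y = sin t"
proof -
  obtain t where t: "0 \<le> t" "t < 2 * pi" "x = cos t" "y = sin t"
    using sincos_total_2pi[OF assms] by blast
  show ?thesis
  proof (cases "t \<le> pi")
    case True
    then show ?thesis using t pi_gt_zero by (intro that[of t]) linarith+
  next
    case False
    then show ?thesis using t by (intro that[of "t - 2 * pi"]) (auto simp: cos_diff sin_diff)
  qed
qed

text \<open>The bound is the one satisfied by two points of an open interval of length 2 pi, as in
  the frame charts.\<close>

lemma rotation_parameter_unique:
  assumes "cos s = cos t" "sin s = sin t" "\<bar>s - t\<bar> < 2 * pi"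
  shows "s = t"
proof -
  obtain n :: int where n: "s = t + 2 * pi * n"
    using assms(1,2) sin_cos_eq_iff[of s t] by auto
  then have "2 * pi * \<bar>n\<bar> < 2 * pi * 1" using assms(3) by (simp add: abs_mult)
  then have "\<bar>real_of_int n\<bar> < 1" by (subst (asm) mult_less_cancel_left_pos) auto
  then show ?thesis using n by simp
qed

lemma smooth_on_inv_sqrt_scale:
  assumes "open S" "smooth_on f S" "smooth_on v S" "\<And>x. x \<in> S \<Longrightarrow> f x > (0::real)"
  shows "smooth_on (\<lambda>x. inverse (sqrt (f x)) *\<^sub>R v x) S"
  using assms
  by (intro smooth_on_scaleR smooth_on_inverse_compose smooth_on_sqrt_compose) (auto simp: less_imp_neq[THEN not_sym])

context local_metric
begin

definition orthoframe :: "real^2 \<Rightarrow> real^2 \<Rightarrow> real^2 \<Rightarrow> bool" where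
  "orthoframe u v w \<longleftrightarrow> G u v v = 1 \<and> G u w w = 1 \<and> G u v w = 0 \<and> cross2 v w > 0"

lemma orthoframe_inner:
  assumes u: "u \<in> U" and e: "orthoframe u v w"
  shows "G u (a *\<^sub>R v + b *\<^sub>R w) (c *\<^sub>R v + d *\<^sub>R w) = a * c + b * d"
  using e sym_G[OF u, of w v] by (simp add: orthoframe_def G_simps[OF u])

lemma orthoframe_rotate:
  assumes u: "u \<in> U" and e: "orthoframe u v w"
  shows "orthoframe u (cos t *\<^sub>R v + sin t *\<^sub>R w) (- sin t *\<^sub>R v + cos t *\<^sub>R w)"
proof -
  have rot: "cross2 (x *\<^sub>R v + y *\<^sub>R w) (- y *\<^sub>R v + x *\<^sub>R w) = (x * x + y * y) * cross2 v w" for x y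
    by (simp add: cross2_def algebra_simps)
  have "cross2 (cos t *\<^sub>R v + sin t *\<^sub>R w) (- sin t *\<^sub>R v + cos t *\<^sub>R w) = ((cos t)\<^sup>2 + (sin t)\<^sup>2) * cross2 v w"
    using rot[of "cos t" "sin t"] by (simp only: power2_eq_square)
  then show ?thesis
    using e unfolding orthoframe_def orthoframe_inner[OF u e]
    by (simp add: power2_eq_square[symmetric])
qed

lemma orthoframe_expand:
  assumes u: "u \<in> U" and e: "orthoframe u v w"
  shows "x = G u x v *\<^sub>R v + G u x w *\<^sub>R w"
proof -
  \<comment> \<open>The coefficients of \<open>x\<close> by Cramer's rule; orthonormality then
    identifies them with the inner products.\<close>
  define a b where "a = cross2 x w / cross2 v w" and "b = cross2 v x / cross2 v w"
  have "cross2 v w \<noteq> 0" using e by (simp add: orthoframe_def)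
  then have x: "x = a *\<^sub>R v + b *\<^sub>R w"
    unfolding a_def b_def by (simp add: vec_eq_iff forall_2 cross2_def divide_simps) (simp add: algebra_simps)
  have "G u x v = a" "G u x w = b"
    unfolding x using orthoframe_inner[OF u e, of a b 1 0] orthoframe_inner[OF u e, of a b 0 1] by simp_all
  then show ?thesis using x by simp
qed

lemma orthoframe_related:
  assumes u: "u \<in> U" and e: "orthoframe u v w" and k: "orthoframe u v' w'"
  obtains t where "- pi < t" "t \<le> pi"
    "v' = cos t *\<^sub>R v + sin t *\<^sub>R w" "w' = - sin t *\<^sub>R v + cos t *\<^sub>R w"
proof -
  define a b c d where "a = G u v' v" and "b = G u v' w" and "c = G u w' v" and "d = G u w' w"
  have v': "v' = a *\<^sub>R v + b *\<^sub>R w" and w': "w' = c *\<^sub>R v + d *\<^sub>R w"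
    unfolding a_def b_def c_def d_def by (rule orthoframe_expand[OF u e])+
  have ab: "a\<^sup>2 + b\<^sup>2 = 1" and cd: "c\<^sup>2 + d\<^sup>2 = 1" and o: "a * c + b * d = 0"
    using k unfolding orthoframe_def v' w' orthoframe_inner[OF u e] by (auto simp: power2_eq_square)
  have "cross2 v' w' = (a * d - b * c) * cross2 v w"
    unfolding v' w' cross2_def by (simp add: algebra_simps)
  then have pos: "a * d - b * c > 0"
    using k e by (auto simp: orthoframe_def zero_less_mult_iff)
  \<comment> \<open>Lagrange's identity: an orthogonal 2 by 2 matrix has determinant of square 1,
    and the orientation of the frames selects the value 1.\<close>
  have "(a * d - b * c)\<^sup>2 = (a\<^sup>2 + b\<^sup>2) * (c\<^sup>2 + d\<^sup>2) - (a * c + b * d)\<^sup>2"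
    by (simp add: power2_eq_square algebra_simps)
  then have det: "a * d - b * c = 1"
    using pos by (simp add: ab cd o power2_eq_1_iff)
  \<comment> \<open>With unit rows and determinant 1 this sum of squares is 1 + 1 - 2, so the matrix
    is a rotation.\<close>
  have "(c + b)\<^sup>2 + (d - a)\<^sup>2 = (c\<^sup>2 + d\<^sup>2) + (a\<^sup>2 + b\<^sup>2) - 2 * (a * d - b * c)"
    by (simp add: power2_eq_square algebra_simps)
  then have "(c + b)\<^sup>2 + (d - a)\<^sup>2 = 0" unfolding ab cd det by simp
  then have "c = - b" "d = a" by (simp_all add: sum_power2_eq_zero_iff)
  moreover obtain t where "- pi < t" "t \<le> pi" "a = cos t" "b = sin t"
    using angle_exists[OF ab] .
  ultimately show ?thesis using that v' w' by simp
qed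

text \<open>\<open>gram1\<close> and \<open>gram2\<close> are the Gram-Schmidt process applied to
  the coordinate basis. The radicand in \<open>gram2\<close> is the square length of the vector
  being normalised.\<close>

definition gram1 :: "real^2 \<Rightarrow> real^2" where
  "gram1 u = inverse (sqrt (G u ax1 ax1)) *\<^sub>R ax1"

definition gram2 :: "real^2 \<Rightarrow> real^2" where
  "gram2 u = inverse (sqrt (G u ax1 ax1 * (G u ax1 ax1 * G u ax2 ax2 - G u ax1 ax2 * G u ax1 ax2))) *\<^sub>R
    (G u ax1 ax1 *\<^sub>R ax2 - G u ax1 ax2 *\<^sub>R ax1)"

lemma orthoframe_gram:
  assumes u: "u \<in> U"
  shows "orthoframe u (gram1 u) (gram2 u)"
proof -
  let ?E = "G u ax1 ax1" and ?F = "G u ax1 ax2" and ?H = "G u ax2 ax2"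
  let ?d = "?E * ?H - ?F * ?F"
  have E: "?E > 0" using pos_G[OF u] by (simp add: axis_eq_0_iff)
  have d: "?d > 0" using gram_pos[OF u] by (simp add: power2_eq_square)
  have s: "G u ax2 ax1 = ?F" using sym_G[OF u] by blast
  have 1: "inverse (sqrt x) * (inverse (sqrt x) * x) = 1" if "x > 0" for x
    using that by (simp add: field_simps)
  have "G u (?E *\<^sub>R ax2 - ?F *\<^sub>R ax1) (?E *\<^sub>R ax2 - ?F *\<^sub>R ax1) = ?E * ?d"
    by (simp add: G_simps[OF u] s algebra_simps)
  moreover have "G u ax1 (?E *\<^sub>R ax2 - ?F *\<^sub>R ax1) = 0"
    by (simp add: G_simps[OF u] s algebra_simps)
  moreover have "cross2 ax1 (?E *\<^sub>R ax2 - ?F *\<^sub>R ax1) = ?E"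
    by (simp add: cross2_def axis_def)
  moreover have "cross2 (a *\<^sub>R v) (b *\<^sub>R w) = a * b * cross2 v w" for a b v w
    by (simp add: cross2_def algebra_simps)
  ultimately show ?thesis
    using E d 1[OF E] 1[OF mult_pos_pos[OF E d]]
    unfolding orthoframe_def gram1_def gram2_def bilinear_lmul[OF bilinear_G[OF u]] bilinear_rmul[OF bilinear_G[OF u]]
    by simp
qed

lemma smooth_gram: "smooth_on gram1 U" "smooth_on gram2 U"
  unfolding gram1_def[abs_def] gram2_def[abs_def]
   apply (rule smooth_on_inv_sqrt_scale[OF open_U smooth_G smooth_on_const])
   apply (simp add: pos_G axis_eq_0_iff)
  apply (intro smooth_on_inv_sqrt_scale smooth_on_mult smooth_on_diff smooth_on_scaleR smooth_G smooth_on_const open_U)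
  using gram_pos pos_G by (simp add: power2_eq_square axis_eq_0_iff)

end


section \<open>The frame bundle\<close>

text \<open>\<open>frame_par\<close> and \<open>frame_dom\<close> name the parametrisation and the
  domain that \<open>frame_chart\<close> keeps in its \<open>let\<close>.\<close>

definition frame_par :: "('m, real^2) chart \<Rightarrow> ('m \<Rightarrow> 'm frame) \<Rightarrow> (real^2) \<times> real \<Rightarrow> 'm frame" where
  "frame_par c s = (\<lambda>(u, t). rotate_frame (s (chart_inv c u)) t)"

definition frame_dom :: "('m, real^2) chart \<Rightarrow> real \<Rightarrow> ((real^2) \<times> real) set" where
  "frame_dom c a = (snd c ` fst c) \<times> {a - pi <..< a + pi}"

lemma frame_dom_fst: "y \<in> frame_dom c a \<Longrightarrow> fst y \<in> snd c ` fst c"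
  by (cases y) (simp add: frame_dom_def)

lemma frame_chart_eq: "frame_chart c s a = (frame_par c s ` frame_dom c a, inv_into (frame_dom c a) (frame_par c s))"
  by (simp add: frame_chart_def frame_par_def frame_dom_def Let_def)

lemma frame_par_Pair: "frame_par c s (u, t) = rotate_frame (s (chart_inv c u)) t"
  by (simp add: frame_par_def)

lemma rotate_frame_sel [simp]:
  "fst (rotate_frame p t) = fst p"
  "fst (snd (rotate_frame p t)) = (\<lambda>c. cos t *\<^sub>R fst (snd p) c + sin t *\<^sub>R snd (snd p) c)"
  "snd (snd (rotate_frame p t)) = (\<lambda>c. - sin t *\<^sub>R fst (snd p) c + cos t *\<^sub>R snd (snd p) c)"
  by (auto simp: rotate_frame_def split: prod.splits)

lemma frame_eqI:
  "fst p = fst q \<Longrightarrow> fst (snd p) = fst (snd q) \<Longrightarrow> snd (snd p) = snd (snd q) \<Longrightarrow> p = q"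
  by (simp add: prod_eq_iff)

lemma rotate_frame_add: "rotate_frame (rotate_frame p a) b = rotate_frame p (a + b)"
  by (rule frame_eqI) (auto simp: fun_eq_iff cos_add sin_add algebra_simps)

lemma rotate_frame_0 [simp]: "rotate_frame p 0 = p"
  by (rule frame_eqI) auto

lemma frame_map_sel [simp]:
  "fst (frame_map A f p) = f (fst p)"
  "fst (snd (frame_map A f p)) = differential A A f (fst p) (fst (snd p))"
  "snd (snd (frame_map A f p)) = differential A A f (fst p) (snd (snd p))"
  by (auto simp: frame_map_def split: prod.splits)

section \<open>Frames over a surface and the charts of the frame bundle\<close>

context oriented_surface
begin

abbreviation (input) "FB \<equiv> frame_bundle A g"
abbreviation (input) "FA \<equiv> frame_atlas A g"
abbreviation (input) "ortho c \<equiv> local_metric.orthoframe (G c)"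

lemma frame_bundle_sel:
  assumes "p \<in> FB"
  shows "fst p \<in> M" "fst (snd p) \<in> tangent_space A (fst p)" "snd (snd p) \<in> tangent_space A (fst p)"
  using assms by (auto simp: frame_bundle_def)

lemma frame_bundle_iff:
  assumes c: "c \<in> charts_at A (fst p)"
    and T: "fst (snd p) \<in> tangent_space A (fst p)" "snd (snd p) \<in> tangent_space A (fst p)"
  shows "p \<in> FB \<longleftrightarrow> ortho c (snd c (fst p)) (fst (snd p) c) (snd (snd p) c)"
proof -
  interpret L: local_metric "snd c ` fst c" "G c" by (rule local_metric_chart[OF charts_atD(1)[OF c]])
  show ?thesis
    using T charts_at_carrier[OF c] positive_basis_iff[OF c T]
      metric_coord_eq[OF c T(1) T(1)] metric_coord_eq[OF c T(1) T(2)] metric_coord_eq[OF c T(2) T(2)]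
    by (cases p) (auto simp: frame_bundle_def L.orthoframe_def)
qed

lemma frame_bundle_ortho:
  assumes "p \<in> FB" "c \<in> charts_at A (fst p)"
  shows "ortho c (snd c (fst p)) (fst (snd p) c) (snd (snd p) c)"
  using frame_bundle_iff[OF assms(2)] frame_bundle_sel[OF assms(1)] assms(1) by blast

lemma rotate_in_frame_bundle:
  assumes p: "p \<in> FB"
  shows "rotate_frame p t \<in> FB"
proof -
  obtain c where c: "c \<in> charts_at A (fst p)" using frame_bundle_sel(1)[OF p] by (rule carrier_ofE)
  interpret L: local_metric "snd c ` fst c" "G c" by (rule local_metric_chart[OF charts_atD(1)[OF c]])
  have u: "snd c (fst p) \<in> snd c ` fst c" using charts_atD(2)[OF c] by blast
  note T = frame_bundle_sel(2,3)[OF p]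
  show ?thesis
    by (subst frame_bundle_iff[of c])
      (use c tangent_space_lincomb[OF atlas T, of "cos t" "sin t"] tangent_space_lincomb[OF atlas T, of "- sin t" "cos t"]
        L.orthoframe_rotate[OF u frame_bundle_ortho[OF p c]] in simp_all)
qed

lemma frames_related:
  assumes p: "p \<in> FB" and q: "q \<in> FB" and pq: "fst q = fst p"
  obtains t where "- pi < t" "t \<le> pi" "q = rotate_frame p t"
proof -
  obtain c where c: "c \<in> charts_at A (fst p)" using frame_bundle_sel(1)[OF p] by (rule carrier_ofE)
  interpret L: local_metric "snd c ` fst c" "G c" by (rule local_metric_chart[OF charts_atD(1)[OF c]])
  have u: "snd c (fst p) \<in> snd c ` fst c" using charts_atD(2)[OF c] by blast
  obtain t where t: "- pi < t" "t \<le> pi"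
    "fst (snd q) c = cos t *\<^sub>R fst (snd p) c + sin t *\<^sub>R snd (snd p) c"
    "snd (snd q) c = - sin t *\<^sub>R fst (snd p) c + cos t *\<^sub>R snd (snd p) c"
    using frame_bundle_ortho[OF q, of c] c pq
    by (metis L.orthoframe_related[OF u frame_bundle_ortho[OF p c]])
  note r = frame_bundle_sel(2,3)[OF rotate_in_frame_bundle[OF p, of t]]
  note s = frame_bundle_sel(2,3)[OF q, unfolded pq]
  have "q = rotate_frame p t"
    by (rule frame_eqI; (rule tangent_space_eqI[OF _ _ c])?) (use r s t pq in auto)
  then show ?thesis using that t by blast
qed

text \<open>Reads the cosine and sine of the rotation angle off the first frame vector alone. This
  gives injectivity of the parametrisation and, through the half-angle formula, the angle
  coordinate.\<close>

lemma frame_inner_rotate: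
  assumes p: "p \<in> FB" and c: "c \<in> charts_at A (fst p)"
  shows "G c (snd c (fst p)) (fst (snd (rotate_frame p t)) c) (fst (snd p) c) = cos t"
    and "G c (snd c (fst p)) (fst (snd (rotate_frame p t)) c) (snd (snd p) c) = sin t"
proof -
  interpret L: local_metric "snd c ` fst c" "G c" by (rule local_metric_chart[OF charts_atD(1)[OF c]])
  have u: "snd c (fst p) \<in> snd c ` fst c" using charts_atD(2)[OF c] by blast
  note o = L.orthoframe_inner[OF u frame_bundle_ortho[OF p c], of "cos t" "sin t"]
  show "G c (snd c (fst p)) (fst (snd (rotate_frame p t)) c) (fst (snd p) c) = cos t"
    "G c (snd c (fst p)) (fst (snd (rotate_frame p t)) c) (snd (snd p) c) = sin t"
    using o[of 1 0] o[of 0 1] by simp_all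
qed

lemma sectionD:
  assumes "smooth_section A g c s" "x \<in> fst c"
  shows "s x \<in> FB" "fst (s x) = x"
  using assms by (auto simp: smooth_section_def)

lemma frame_par_inj:
  assumes c: "c \<in> A" and s: "smooth_section A g c s"
  shows "inj_on (frame_par c s) (frame_dom c a)"
proof (rule inj_onI)
  fix y z assume y: "y \<in> frame_dom c a" and z: "z \<in> frame_dom c a" and e: "frame_par c s y = frame_par c s z"
  obtain u t where ut: "y = (u, t)" by force
  obtain v r where vr: "z = (v, r)" by force
  let ?x = "chart_inv c u"
  have u: "u \<in> snd c ` fst c" and v: "v \<in> snd c ` fst c" and tr: "\<bar>t - r\<bar> < 2 * pi"
    using y z by (auto simp: ut vr frame_dom_def)
  have "?x = chart_inv c v"
    using e sectionD(2)[OF s chart_inv_in] u v by (metis ut vr frame_par_Pair rotate_frame_sel(1))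
  then have uv: "u = v" using chart_inv_right u v by metis
  have x: "?x \<in> fst c" by (rule chart_inv_in[OF u])
  have rot: "rotate_frame (s ?x) t = rotate_frame (s ?x) r"
    using e by (simp add: ut vr uv frame_par_Pair)
  have c': "c \<in> charts_at A (fst (s ?x))" using sectionD(2)[OF s x] c x by (simp add: charts_at_def)
  have "cos t = cos r" "sin t = sin r"
    using frame_inner_rotate[OF sectionD(1)[OF s x] c', of t] frame_inner_rotate[OF sectionD(1)[OF s x] c', of r]
    unfolding rot by simp_all
  then show "y = z" using rotation_parameter_unique tr by (simp add: ut vr uv)
qed

lemma frame_par_in:
  assumes "smooth_section A g c s" "y \<in> frame_dom c a"
  shows "frame_par c s y \<in> FB" "fst (frame_par c s y) = chart_inv c (fst y)"
proof -
  have u: "fst y \<in> snd c ` fst c" by (rule frame_dom_fst[OF assms(2)])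
  have "frame_par c s y = rotate_frame (s (chart_inv c (fst y))) (snd y)"
    by (simp add: frame_par_def split_beta)
  then show "frame_par c s y \<in> FB" "fst (frame_par c s y) = chart_inv c (fst y)"
    using sectionD[OF assms(1) chart_inv_in[OF u]] rotate_in_frame_bundle by simp_all
qed

lemma frame_chart_coord:
  assumes c: "c \<in> A" and s: "smooth_section A g c s" and y: "y \<in> frame_dom c a"
  shows "snd (frame_chart c s a) (frame_par c s y) = y"
    and "chart_inv (frame_chart c s a) y = frame_par c s y"
    and "frame_par c s y \<in> fst (frame_chart c s a)"
proof -
  note inj = frame_par_inj[OF c s, of a]
  show 1: "snd (frame_chart c s a) (frame_par c s y) = y" and 2: "frame_par c s y \<in> fst (frame_chart c s a)"
    using y inj by (auto simp: frame_chart_eq)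
  have "inj_on (snd (frame_chart c s a)) (fst (frame_chart c s a))"
    by (simp add: frame_chart_eq inj_on_inv_into)
  then show "chart_inv (frame_chart c s a) y = frame_par c s y"
    unfolding chart_inv_def using 2 1
    by (rule inv_into_f_eq[of "snd (frame_chart c s a)" "fst (frame_chart c s a)" "frame_par c s y" y])
qed

lemma frame_chart_image:
  assumes c: "c \<in> A" and s: "smooth_section A g c s"
  shows "snd (frame_chart c s a) ` fst (frame_chart c s a) = frame_dom c a"
    "fst (frame_chart c s a) \<subseteq> FB" "q \<in> fst (frame_chart c s a) \<Longrightarrow> fst q \<in> fst c"
proof -
  have f: "fst (frame_chart c s a) = frame_par c s ` frame_dom c a" by (simp add: frame_chart_eq)
  show "snd (frame_chart c s a) ` fst (frame_chart c s a) = frame_dom c a"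
    using frame_chart_coord(1)[OF c s] unfolding f by force
  show "fst (frame_chart c s a) \<subseteq> FB" unfolding f using frame_par_in(1)[OF s] by blast
  show "fst q \<in> fst c" if q: "q \<in> fst (frame_chart c s a)"
  proof -
    obtain y where y: "y \<in> frame_dom c a" "q = frame_par c s y" using q unfolding f by blast
    show ?thesis using frame_par_in(2)[OF s y(1)] chart_inv_in[OF frame_dom_fst[OF y(1)]] y(2) by simp
  qed
qed

lemma open_frame_dom: "c \<in> A \<Longrightarrow> open (frame_dom c a)"
  using chart_is_chart[of c] by (auto simp: frame_dom_def is_chart_def intro!: open_Times)

text \<open>Base coordinate \<open>u\<close> and vector \<open>e\<close> are independent arguments
  here and in \<open>sinang\<close>, so that \<open>smooth_on_bilinear_compose\<close> applies when
  both vary; for the first vector \<open>e\<close> of a frame over \<open>u\<close> the values are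
  the cosine and sine of its angle from the section turned by \<open>a\<close>.\<close>

definition cosang :: "('m, real^2) chart \<Rightarrow> ('m \<Rightarrow> 'm frame) \<Rightarrow> real \<Rightarrow> real^2 \<Rightarrow> real^2 \<Rightarrow> real" where
  "cosang c s a u e = G c u e (cos a *\<^sub>R fst (snd (s (chart_inv c u))) c + sin a *\<^sub>R snd (snd (s (chart_inv c u))) c)"

definition sinang :: "('m, real^2) chart \<Rightarrow> ('m \<Rightarrow> 'm frame) \<Rightarrow> real \<Rightarrow> real^2 \<Rightarrow> real^2 \<Rightarrow> real" where
  "sinang c s a u e = G c u e (- sin a *\<^sub>R fst (snd (s (chart_inv c u))) c + cos a *\<^sub>R snd (snd (s (chart_inv c u))) c)"

text \<open>The angle coordinate is the angle from the reference frame rotated by \<open>a\<close>, recovered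
  from its cosine and sine by \<open>\<theta> = 2 arctan (sin \<theta> / (1 + cos \<theta>))\<close>; it exists unless \<open>cos \<theta> = -1\<close>.\<close>

lemma frame_chart_angle:
  fixes a :: real
  assumes c: "c \<in> A" and s: "smooth_section A g c s" and q: "q \<in> FB" and x: "fst q \<in> fst c"
  defines "C \<equiv> cosang c s a (snd c (fst q)) (fst (snd q) c)" and "S \<equiv> sinang c s a (snd c (fst q)) (fst (snd q) c)"
  shows "q \<in> fst (frame_chart c s a) \<longleftrightarrow> 1 + C \<noteq> 0"
    and "q \<in> fst (frame_chart c s a) \<Longrightarrow> snd (frame_chart c s a) q = (snd c (fst q), a + 2 * arctan (S / (1 + C)))"
proof -
  let ?x = "fst q" and ?k = "rotate_frame (s (fst q)) a"
  have inv: "chart_inv c (snd c ?x) = ?x" by (rule chart_inv_left[OF chart_is_chart[OF c] x])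
  have k: "?k \<in> FB" "fst ?k = ?x" using sectionD[OF s x] rotate_in_frame_bundle by auto
  have cx: "c \<in> charts_at A (fst ?k)" using c x k(2) by (simp add: charts_at_def)
  obtain t where t: "- pi < t" "t \<le> pi" "q = rotate_frame ?k t"
    using frames_related[OF k(1) q] k(2) by metis
  have CS: "C = cos t" "S = sin t"
    using frame_inner_rotate[OF k(1) cx, of t] unfolding t(3)[symmetric] k(2) C_def S_def cosang_def sinang_def inv by simp_all
  have par: "q = frame_par c s (snd c ?x, a + t)"
    using t(3) by (simp add: frame_par_Pair inv rotate_frame_add)
  show iff: "q \<in> fst (frame_chart c s a) \<longleftrightarrow> 1 + C \<noteq> 0"
  proof
    assume "1 + C \<noteq> 0"
    \<comment> \<open>In the half-open interval of admissible \<open>t\<close> only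
      \<open>pi\<close> has cosine -1.\<close>
    then have "t < pi" using t CS by (cases "t = pi") auto
    then have "(snd c ?x, a + t) \<in> frame_dom c a" using t x by (auto simp: frame_dom_def)
    then show "q \<in> fst (frame_chart c s a)" using frame_chart_coord(3)[OF c s] par by metis
  next
    assume "q \<in> fst (frame_chart c s a)"
    then obtain v r where vr: "(v, r) \<in> frame_dom c a" "q = frame_par c s (v, r)"
      by (auto simp: frame_chart_eq)
    have "chart_inv c v = ?x" using frame_par_in(2)[OF s vr(1)] vr(2) by simp
    \<comment> \<open>The angle \<open>r - a\<close> need not be known to equal \<open>t\<close>;
      comparing their cosines is enough.\<close>
    then have "q = rotate_frame ?k (r - a)" using vr(2) by (simp add: frame_par_Pair rotate_frame_add)
    then have "cos t = cos (r - a)"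
      using frame_inner_rotate(1)[OF k(1) cx, of t] frame_inner_rotate(1)[OF k(1) cx, of "r - a"] t(3) by metis
    moreover have "1 + cos (r - a) > 0" by (rule one_plus_cos_pos) (use vr(1) in \<open>auto simp: frame_dom_def\<close>)
    ultimately show "1 + C \<noteq> 0" unfolding CS by simp
  qed
  assume "q \<in> fst (frame_chart c s a)"
  then have "t < pi" using t CS iff by (cases "t = pi") auto
  then have "(snd c ?x, a + t) \<in> frame_dom c a" "2 * arctan (S / (1 + C)) = t"
    using t x CS half_angle_arctan by (auto simp: frame_dom_def)
  then show "snd (frame_chart c s a) q = (snd c ?x, a + 2 * arctan (S / (1 + C)))"
    using frame_chart_coord(1)[OF c s] par by metis
qed

lemma smooth_section_exists:
  assumes c: "c \<in> A"
  obtains s where "smooth_section A g c s"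
proof -
  interpret L: local_metric "snd c ` fst c" "G c" by (rule local_metric_chart[OF c])
  let ?v = "\<lambda>x. coord_vector A c x (L.gram1 (snd c x))" and ?w = "\<lambda>x. coord_vector A c x (L.gram2 (snd c x))"
  have at: "c \<in> charts_at A x" if "x \<in> fst c" for x using c that by (simp add: charts_at_def)
  have "(x, ?v x, ?w x) \<in> FB" if x: "x \<in> fst c" for x
    by (subst frame_bundle_iff[of c])
      (use x L.orthoframe_gram[of "snd c x"] in
        \<open>auto simp: at coord_vector_in_tangent_space[OF atlas at] coord_vector_self[OF atlas at]\<close>)
  moreover have "smooth_on (\<lambda>u. ?v (chart_inv c u) c) (snd c ` fst c)"
    by (rule smooth_on_cong[OF L.open_U _ L.smooth_gram(1)])
      (simp add: coord_vector_self[OF atlas at] chart_inv_in chart_inv_right)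
  moreover have "smooth_on (\<lambda>u. ?w (chart_inv c u) c) (snd c ` fst c)"
    by (rule smooth_on_cong[OF L.open_U _ L.smooth_gram(2)])
      (simp add: coord_vector_self[OF atlas at] chart_inv_in chart_inv_right)
  ultimately have "smooth_section A g c (\<lambda>x. (x, ?v x, ?w x))"
    by (simp add: smooth_section_def)
  then show ?thesis by (rule that)
qed

lemma frame_chart_exists:
  assumes p: "p \<in> FB" and c: "c \<in> charts_at A (fst p)"
  obtains s a where "smooth_section A g c s" "frame_chart c s a \<in> charts_at FA p"
proof -
  obtain s where s: "smooth_section A g c s" using smooth_section_exists charts_atD(1)[OF c] by metis
  note cA = charts_atD(1)[OF c] and x = charts_atD(2)[OF c]
  obtain t where t: "p = rotate_frame (s (fst p)) t"
    using frames_related[OF sectionD(1)[OF s x] p] sectionD(2)[OF s x] by metis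
  have "p = frame_par c s (snd c (fst p), t)"
    using t chart_inv_left[OF chart_is_chart[OF cA] x] by (simp add: frame_par_Pair)
  \<comment> \<open>The angle interval is centred at the angle of \<open>p\<close> itself.\<close>
  moreover have "(snd c (fst p), t) \<in> frame_dom c t" using x by (auto simp: frame_dom_def)
  ultimately have "p \<in> fst (frame_chart c s t)" using frame_chart_coord(3)[OF cA s] by metis
  moreover have "frame_chart c s t \<in> FA" using s cA unfolding frame_atlas_def by blast
  ultimately have "frame_chart c s t \<in> charts_at FA p" by (rule charts_atI[rotated])
  then show ?thesis using that s by blast
qed

lemma frame_atlasE:
  assumes "C \<in> FA"
  obtains c s a where "C = frame_chart c s a" "c \<in> A" "smooth_section A g c s"
  using assms by (auto simp: frame_atlas_def)

lemma smooth_section_coord: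
  assumes "smooth_section A g c s"
  shows "smooth_on (\<lambda>u. fst (snd (s (chart_inv c u))) c) (snd c ` fst c)"
    "smooth_on (\<lambda>u. snd (snd (s (chart_inv c u))) c) (snd c ` fst c)"
  using assms by (auto simp: smooth_section_def)

lemma smooth_frame_par:
  assumes c: "c \<in> A" and s: "smooth_section A g c s"
  shows "smooth_on (\<lambda>y. fst (snd (frame_par c s y)) c) (frame_dom c a)"
    "smooth_on (\<lambda>y. snd (snd (frame_par c s y)) c) (frame_dom c a)"
proof -
  let ?O = "frame_dom c a"
  have O: "open ?O" by (rule open_frame_dom[OF c])
  have U: "open (snd c ` fst c)" using chart_is_chart[OF c] by (simp add: is_chart_def)
  have sndO: "smooth_on snd ?O" by (rule smooth_on_snd[OF O smooth_on_ident])
  have fromU: "smooth_on (\<lambda>y. h (fst y)) ?O" if "smooth_on h (snd c ` fst c)" for h :: "real^2 \<Rightarrow> real^2"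
    by (rule smooth_on_compose[OF that O U smooth_on_fst[OF O smooth_on_ident]]) (rule frame_dom_fst)
  note sec = smooth_section_coord[OF s]
  show "smooth_on (\<lambda>y. fst (snd (frame_par c s y)) c) ?O" "smooth_on (\<lambda>y. snd (snd (frame_par c s y)) c) ?O"
    unfolding frame_par_def split_beta rotate_frame_sel
    by (intro smooth_on_add smooth_on_scaleR smooth_on_uminus smooth_on_sin_compose smooth_on_cos_compose O sndO fromU sec)+
qed

end

section \<open>Smoothness of the induced map of frames\<close>

context surface_isometry
begin

lemma frame_map_in:
  assumes p: "p \<in> FB"
  shows "frame_map A f p \<in> FB"
proof -
  obtain c where c: "c \<in> charts_at A (fst p)" using frame_bundle_sel(1)[OF p] by (rule carrier_ofE)
  note T = frame_bundle_sel[OF p]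
  show ?thesis
    using p df_in[OF c T(2)] df_in[OF c T(3)] isometric[OF T(1) T(2) T(2)] isometric[OF T(1) T(2) T(3)]
      isometric[OF T(1) T(3) T(3)] positive_basis_df[OF c T(2,3)] f_in[OF T(1)]
    by (cases p) (auto simp: frame_bundle_def frame_map_def)
qed

lemma frame_map_rotate:
  assumes p: "p \<in> FB"
  shows "frame_map A f (rotate_frame p t) = rotate_frame (frame_map A f p) t"
proof -
  obtain c where c: "c \<in> charts_at A (fst p)" using frame_bundle_sel(1)[OF p] by (rule carrier_ofE)
  note T = frame_bundle_sel[OF p]
  show ?thesis
    by (rule frame_eqI)
      (use differential_lincomb[OF atlas smooth_f T(1) c T(2,3), of "cos t" "sin t"]
        differential_lincomb[OF atlas smooth_f T(1) c T(2,3), of "- sin t" "cos t"] in simp_all)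
qed

lemma frame_map_coord:
  assumes c: "c \<in> A" and d: "d \<in> A" and s: "smooth_section A g c s"
    and y: "y \<in> frame_dom c a" and fd: "f (chart_inv c (fst y)) \<in> fst d"
  shows "fst (snd (frame_map A f (frame_par c s y))) d =
      frechet_derivative (loc c d) (at (fst y)) (fst (snd (frame_par c s y)) c)"
    and "snd (snd (frame_map A f (frame_par c s y))) d =
      frechet_derivative (loc c d) (at (fst y)) (snd (snd (frame_par c s y)) c)"
proof -
  have "c \<in> charts_at A (chart_inv c (fst y))" "d \<in> charts_at A (f (chart_inv c (fst y)))"
    using c d chart_inv_in[OF frame_dom_fst[OF y]] fd by (auto simp: charts_at_def)
  note df = df_coord[OF this]
  show "fst (snd (frame_map A f (frame_par c s y))) d =
      frechet_derivative (loc c d) (at (fst y)) (fst (snd (frame_par c s y)) c)"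
    "snd (snd (frame_map A f (frame_par c s y))) d =
      frechet_derivative (loc c d) (at (fst y)) (snd (snd (frame_par c s y)) c)"
    using df frame_bundle_sel(2,3)[OF frame_par_in(1)[OF s y]] frame_par_in(2)[OF s y]
      chart_inv_right[OF frame_dom_fst[OF y]] by simp_all
qed

text \<open>In frame charts the map is \<phi> on the base coordinate, and its angle is given by
  \<open>frame_chart_angle\<close> from the image of the first frame vector under the derivative of
  \<phi>. The argument uses no compatibility of the frame charts, since the identity case is to
  provide it.\<close>

lemma smooth_frame_map: "smooth_map FA FB FA FB (frame_map A f)"
  unfolding smooth_map_def Let_def
proof (intro conjI ballI)
  show "frame_map A f ` FB \<subseteq> FB" using frame_map_in by blast
  fix C C' assume "C \<in> FA" "C' \<in> FA"
  then obtain c s a c' s' a' where C: "C = frame_chart c s a" "c \<in> A" and s: "smooth_section A g c s"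
    and C': "C' = frame_chart c' s' a'" "c' \<in> A" and s': "smooth_section A g c' s'"
    by (metis frame_atlasE)
  let ?F = "frame_map A f" and ?\<phi> = "loc c c'"
  let ?O = "ldom c c' \<times> {a - pi <..< a + pi}"
  interpret L: local_isometry "ldom c c'" "G c" "snd c' ` fst c'" "G c'" ?\<phi>
    by (rule local_isometry_charts[OF C(2) C'(2)])
  have O: "open ?O" by (intro open_Times L.S.open_U) auto
  have Osub: "?O \<subseteq> frame_dom c a" by (auto simp: frame_dom_def)
  \<comment> \<open>The coordinates in \<open>c'\<close> of the first vector of the image frame;
    \<open>Cf\<close> and \<open>Sf\<close> are then the cosine and sine of its angle in the target
    chart.\<close>
  define e where "e y = frechet_derivative ?\<phi> (at (fst y)) (fst (snd (frame_par c s y)) c)" for y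
  define Cf where "Cf y = cosang c' s' a' (?\<phi> (fst y)) (e y)" for y
  define Sf where "Sf y = sinang c' s' a' (?\<phi> (fst y)) (e y)" for y
  have fstO: "smooth_on fst ?O" by (rule smooth_on_fst[OF O smooth_on_ident])
  have fromU: "smooth_on (\<lambda>y. h (fst y)) ?O" if "smooth_on h (ldom c c')" for h :: "real^2 \<Rightarrow> 'z::real_normed_vector"
    by (rule smooth_on_compose[OF that O L.S.open_U fstO]) auto
  have frO: "smooth_on (\<lambda>y. fst (snd (frame_par c s y)) c) ?O"
    by (rule smooth_on_subset[OF smooth_frame_par(1)[OF C(2) s] Osub])
  have eO: "smooth_on e ?O"
  proof -
    have 1: "smooth_on (\<lambda>y. frechet_derivative ?\<phi> (at (fst y)) b) ?O" for b
      by (rule fromU[OF smooth_on_frechet_derivative_const[OF L.smooth]])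
    have "smooth_on (\<lambda>y. \<Sum>b\<in>Basis. (fst (snd (frame_par c s y)) c \<bullet> b) *\<^sub>R frechet_derivative ?\<phi> (at (fst y)) b) ?O"
      by (intro smooth_on_sum smooth_on_scaleR smooth_on_bounded_linear[OF _ bounded_linear_inner_left] O frO 1)
    then show ?thesis
      by (rule smooth_on_cong[OF O, rotated])
        (unfold e_def, rule linear_basis_sum[symmetric, OF L.linear_D\<phi>], auto)
  qed
  have \<phi>O: "smooth_on (\<lambda>y. ?\<phi> (fst y)) ?O" by (rule fromU[OF L.smooth])
  have \<phi>in: "?\<phi> (fst y) \<in> snd c' ` fst c'" if "y \<in> ?O" for y
    using L.maps[of "fst y"] that by auto
  have sec': "smooth_on (\<lambda>y. fst (snd (s' (chart_inv c' (?\<phi> (fst y))))) c') ?O"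
    "smooth_on (\<lambda>y. snd (snd (s' (chart_inv c' (?\<phi> (fst y))))) c') ?O"
    by (rule smooth_on_compose[OF smooth_section_coord(1)[OF s'] O L.T.open_U \<phi>O \<phi>in], simp)
      (rule smooth_on_compose[OF smooth_section_coord(2)[OF s'] O L.T.open_U \<phi>O \<phi>in], simp)
  have CSf: "smooth_on Cf ?O" "smooth_on Sf ?O"
    unfolding Cf_def[abs_def] Sf_def[abs_def] cosang_def sinang_def
    by (intro smooth_on_bilinear_compose[OF O L.T.open_U \<phi>O \<phi>in L.T.bilinear_G L.T.smooth_G eO]
        smooth_on_add smooth_on_scaleR smooth_on_const sec' O; assumption)+
  \<comment> \<open>\<open>?O\<close> ensures that the base point lands in \<open>c'\<close>; the
    inequation removes the frames opposite to the reference frame, which the target chart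
    misses.\<close>
  define D where "D = {y \<in> ?O. 1 + Cf y \<noteq> 0}"
  have Dopen: "open D"
  proof -
    have "D = ?O \<inter> (\<lambda>y. 1 + Cf y) -` (- {0})" by (auto simp: D_def)
    moreover have "continuous_on ?O (\<lambda>y. 1 + Cf y)"
      by (intro continuous_on_add continuous_on_const smooth_on_continuous[OF CSf(1)])
    ultimately show ?thesis using continuous_open_preimage[OF _ O, of "\<lambda>y. 1 + Cf y" "- {0}"] by auto
  qed
  have pt: "fst (?F (frame_par c s y)) = f (chart_inv c (fst y))"
    "snd c' (f (chart_inv c (fst y))) = ?\<phi> (fst y)"
    if "y \<in> frame_dom c a" for y
  proof -
    show "fst (?F (frame_par c s y)) = f (chart_inv c (fst y))"
      "snd c' (f (chart_inv c (fst y))) = ?\<phi> (fst y)"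
      using frame_par_in(2)[OF s that] by simp_all
  qed
  have ey: "fst (snd (?F (frame_par c s y))) c' = e y"
    if y: "y \<in> frame_dom c a" and fc: "f (chart_inv c (fst y)) \<in> fst c'" for y
    unfolding e_def by (rule frame_map_coord(1)[OF C(2) C'(2) s y fc])
  have inO: "y \<in> ?O \<longleftrightarrow> f (chart_inv c (fst y)) \<in> fst c'" if y: "y \<in> frame_dom c a" for y
    using y chart_inv_left[OF chart_is_chart[OF C(2)]] by (cases y) (auto simp: frame_dom_def)
  have mem: "?F (frame_par c s y) \<in> fst C' \<longleftrightarrow> y \<in> D" if y: "y \<in> frame_dom c a" for y
  proof (cases "y \<in> ?O")
    case True
    then have fc: "f (chart_inv c (fst y)) \<in> fst c'" using inO[OF y] by blast
    show ?thesis
      using frame_chart_angle(1)[OF C'(2) s' frame_map_in[OF frame_par_in(1)[OF s y]], of a'] fc True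
      unfolding pt(1)[OF y] pt(2)[OF y] ey[OF y fc] C'(1) D_def Cf_def by simp
  next
    case False
    then have "f (chart_inv c (fst y)) \<notin> fst c'" using inO[OF y] by blast
    then show ?thesis using False frame_chart_image(3)[OF C'(2) s'] pt(1)[OF y] unfolding C'(1) D_def by fastforce
  qed
  have Dsub: "D \<subseteq> frame_dom c a" using Osub by (auto simp: D_def)
  have dom: "snd C ` (fst C \<inter> FB \<inter> ?F -` fst C') = D"
  proof (intro equalityI subsetI)
    fix y assume "y \<in> snd C ` (fst C \<inter> FB \<inter> ?F -` fst C')"
    then obtain z where z: "z \<in> frame_dom c a" "?F (frame_par c s z) \<in> fst C'" "y = snd C (frame_par c s z)"
      unfolding C(1) by (auto simp: frame_chart_eq)
    then show "y \<in> D" using mem frame_chart_coord(1)[OF C(2) s z(1)] by (simp add: C(1))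
  next
    fix y assume y: "y \<in> D"
    then have yd: "y \<in> frame_dom c a" using Dsub by blast
    show "y \<in> snd C ` (fst C \<inter> FB \<inter> ?F -` fst C')"
      by (rule image_eqI[of _ _ "frame_par c s y"])
        (use mem[OF yd] y frame_chart_coord[OF C(2) s yd] frame_par_in[OF s yd] in \<open>auto simp: C(1)\<close>)
  qed
  show "open (snd C ` (fst C \<inter> FB \<inter> ?F -` fst C'))" unfolding dom by (rule Dopen)
  have DO: "D \<subseteq> ?O" by (auto simp: D_def)
  have "smooth_on (\<lambda>y. (?\<phi> (fst y), a' + 2 * arctan (Sf y / (1 + Cf y)))) D"
    by (intro smooth_on_Pair smooth_on_add smooth_on_mult smooth_on_const smooth_on_arctan_compose smooth_on_divide
        Dopen smooth_on_subset[OF \<phi>O DO] smooth_on_subset[OF CSf(1) DO] smooth_on_subset[OF CSf(2) DO])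
      (simp add: D_def)
  moreover have "(snd C' \<circ> ?F \<circ> chart_inv C) y = (?\<phi> (fst y), a' + 2 * arctan (Sf y / (1 + Cf y)))" if y: "y \<in> D" for y
  proof -
    have yd: "y \<in> frame_dom c a" using Dsub y by blast
    have fc: "f (chart_inv c (fst y)) \<in> fst c'" using inO[OF yd] y DO by blast
    have "?F (frame_par c s y) \<in> fst (frame_chart c' s' a')" using mem[OF yd] y by (simp add: C'(1))
    then have "snd C' (?F (frame_par c s y)) = (?\<phi> (fst y), a' + 2 * arctan (Sf y / (1 + Cf y)))"
      using frame_chart_angle(2)[OF C'(2) s' frame_map_in[OF frame_par_in(1)[OF s yd]], of a'] fc
      unfolding pt(1)[OF yd] pt(2)[OF yd] ey[OF yd fc] C'(1) Cf_def Sf_def by simp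
    then show ?thesis using frame_chart_coord(2)[OF C(2) s yd] by (simp add: C(1))
  qed
  ultimately show "smooth_on (snd C' \<circ> ?F \<circ> chart_inv C) (snd C ` (fst C \<inter> FB \<inter> ?F -` fst C'))"
    unfolding dom using smooth_on_cong[OF Dopen] by (metis (no_types, lifting))
qed

end

section \<open>The frame bundle as a smooth manifold with smooth projection\<close>

context oriented_surface
begin

lemma frame_map_ident:
  assumes "p \<in> FB"
  shows "frame_map A (\<lambda>x. x) p = p"
  by (rule frame_eqI) (use frame_bundle_sel[OF assms] in \<open>simp_all add: differential_ident[OF atlas]\<close>)

text \<open>On the bundle \<open>frame_map A (\<lambda>x. x)\<close> is the identity, so its
  coordinate expressions are the transition maps, and the inverse transition follows by exchanging
  the two charts.\<close>

lemma smooth_frame_atlas: "smooth_atlas FA"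
proof -
  note id = surface_isometry.smooth_frame_map[OF surface_isometry_ident]
  have sub: "fst C \<subseteq> FB" if "C \<in> FA" for C
    using that frame_chart_image(2) by (metis frame_atlasE)
  have chart: "is_chart C" if "C \<in> FA" for C
  proof -
    obtain c s a where C: "C = frame_chart c s a" "c \<in> A" "smooth_section A g c s" using frame_atlasE[OF \<open>C \<in> FA\<close>] .
    show ?thesis
      using frame_chart_image(1)[OF C(2,3)] open_frame_dom[OF C(2)]
      by (simp add: is_chart_def C(1)) (simp add: frame_chart_eq inj_on_inv_into)
  qed
  have "open (snd C ` (fst C \<inter> fst D)) \<and> smooth_on (transition C D) (snd C ` (fst C \<inter> fst D))"
    if C: "C \<in> FA" and D: "D \<in> FA" for C D
  proof -
    have e: "fst C \<inter> FB \<inter> frame_map A (\<lambda>x. x) -` fst D = fst C \<inter> fst D"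
      using sub[OF C] frame_map_ident by auto
    note m = smooth_map_coord[OF id C D, unfolded e]
    have "smooth_on (transition C D) (snd C ` (fst C \<inter> fst D))"
      by (rule smooth_on_cong[OF m(1) _ m(2)])
        (use sub[OF C] frame_map_ident chart_inv_left[OF chart[OF C]] in \<open>auto simp: transition_def subset_iff\<close>)
    then show ?thesis using m(1) by blast
  qed
  then have "compatible C D" if "C \<in> FA" "D \<in> FA" for C D
    using that unfolding compatible_def by (metis Int_commute)
  then show ?thesis using chart by (simp add: smooth_atlas_def)
qed

lemma smooth_frame_proj: "smooth_map FA FB A M fst"
  unfolding smooth_map_def Let_def
proof (intro conjI ballI)
  show "fst ` FB \<subseteq> M" using frame_bundle_sel(1) by blast
  fix C d assume "C \<in> FA" and d: "d \<in> A"
  then obtain c s a where C: "C = frame_chart c s a" "c \<in> A" and s: "smooth_section A g c s" by (metis frame_atlasE)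
  let ?D = "(snd c ` (fst c \<inter> fst d)) \<times> {a - pi <..< a + pi}"
  note t = smooth_transition[OF atlas C(2) d]
  have O: "open ?D" by (intro open_Times t) auto
  have inD: "y \<in> ?D \<longleftrightarrow> fst (frame_par c s y) \<in> fst d" if y: "y \<in> frame_dom c a" for y
    using y chart_inv_left[OF chart_is_chart[OF C(2)]] frame_par_in(2)[OF s y] by (cases y) (auto simp: frame_dom_def)
  have Dsub: "?D \<subseteq> frame_dom c a" by (auto simp: frame_dom_def)
  have dom: "snd C ` (fst C \<inter> FB \<inter> fst -` fst d) = ?D"
  proof (intro equalityI subsetI)
    fix y assume "y \<in> snd C ` (fst C \<inter> FB \<inter> fst -` fst d)"
    then obtain z where z: "z \<in> frame_dom c a" "fst (frame_par c s z) \<in> fst d" "y = snd C (frame_par c s z)"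
      unfolding C(1) by (auto simp: frame_chart_eq)
    then show "y \<in> ?D" using inD[OF z(1)] frame_chart_coord(1)[OF C(2) s z(1)] unfolding C(1) by metis
  next
    fix y assume y: "y \<in> ?D"
    then have yd: "y \<in> frame_dom c a" using Dsub by blast
    show "y \<in> snd C ` (fst C \<inter> FB \<inter> fst -` fst d)"
      by (rule image_eqI[of _ _ "frame_par c s y"])
        (use inD[OF yd] y frame_chart_coord[OF C(2) s yd] frame_par_in[OF s yd] in \<open>auto simp: C(1)\<close>)
  qed
  show "open (snd C ` (fst C \<inter> FB \<inter> fst -` fst d))" unfolding dom by (rule O)
  have "smooth_on (\<lambda>y. transition c d (fst y)) ?D"
    by (rule smooth_on_compose[OF t(2) O t(1) smooth_on_fst[OF O smooth_on_ident]]) auto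
  then show "smooth_on (snd d \<circ> fst \<circ> chart_inv C) (snd C ` (fst C \<inter> FB \<inter> fst -` fst d))"
    unfolding dom
  proof (rule smooth_on_cong[OF O, rotated])
    fix y assume "y \<in> ?D"
    then have yd: "y \<in> frame_dom c a" using Dsub by blast
    show "transition c d (fst y) = (snd d \<circ> fst \<circ> chart_inv C) y"
      using frame_chart_coord(2)[OF C(2) s yd] frame_par_in(2)[OF s yd] by (simp add: C(1) transition_def)
  qed
qed

end


section \<open>The Wagner lift\<close>

lemma smooth_map_restrict:
  assumes A: "smooth_atlas A" and f: "smooth_map A X B Y f" and V: "V \<subseteq> X" "f ` V \<subseteq> V'"
    and open_V: "\<And>c. c \<in> A \<Longrightarrow> open (snd c ` (fst c \<inter> V))"
  shows "smooth_map A V B V' f"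
  unfolding smooth_map_def Let_def
proof (intro conjI ballI)
  fix c d assume c: "c \<in> A" and d: "d \<in> B"
  have inj: "inj_on (snd c) (fst c)" using smooth_atlas_chart[OF A c] by (simp add: is_chart_def)
  have "fst c \<inter> V \<inter> f -` fst d = (fst c \<inter> X \<inter> f -` fst d) \<inter> (fst c \<inter> V)" using V by blast
  then have e: "snd c ` (fst c \<inter> V \<inter> f -` fst d) = snd c ` (fst c \<inter> X \<inter> f -` fst d) \<inter> snd c ` (fst c \<inter> V)"
    using inj_on_image_Int[OF inj, of "fst c \<inter> X \<inter> f -` fst d" "fst c \<inter> V"] by (simp add: le_infI1)
  note s = smooth_map_coord[OF f c d]
  show "open (snd c ` (fst c \<inter> V \<inter> f -` fst d))" unfolding e by (intro open_Int s open_V c)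
  show "smooth_on (snd d \<circ> f \<circ> chart_inv c) (snd c ` (fst c \<inter> V \<inter> f -` fst d))"
    by (rule smooth_on_subset[OF s(2)]) (use e in blast)
qed (use V in blast)

lemma smooth_map_cong:
  assumes A: "smooth_atlas A" and f: "smooth_map A W B W' f" and eq: "\<And>x. x \<in> W \<Longrightarrow> f x = f' x"
  shows "smooth_map A W B W' f'"
  unfolding smooth_map_def Let_def
proof (intro conjI ballI)
  show "f' ` W \<subseteq> W'" using f eq by (auto simp: smooth_map_def)
  fix c d assume c: "c \<in> A" and d: "d \<in> B"
  have e: "fst c \<inter> W \<inter> f' -` fst d = fst c \<inter> W \<inter> f -` fst d" using eq by auto
  note s = smooth_map_coord[OF f c d]
  show "open (snd c ` (fst c \<inter> W \<inter> f' -` fst d))" unfolding e by (rule s)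
  show "smooth_on (snd d \<circ> f' \<circ> chart_inv c) (snd c ` (fst c \<inter> W \<inter> f' -` fst d))"
    unfolding e
    by (rule smooth_on_cong[OF s(1) _ s(2)])
      (use eq chart_inv_left[OF smooth_atlas_chart[OF A c]] in auto)
qed

section \<open>Horizontal and vertical directions\<close>

context oriented_surface
begin

abbreviation (input) "TF p \<equiv> tangent_space (frame_atlas A g) p"
abbreviation (input) "d\<pi> p \<equiv> differential (frame_atlas A g) A fst p"
abbreviation (input) "vphi p \<equiv> fundamental_vector A g p"

lemma frame_chart_atE:
  assumes "C \<in> charts_at FA p"
  obtains c s a where "C = frame_chart c s a" "c \<in> A" "smooth_section A g c s"
    "c \<in> charts_at A (fst p)" "snd C p \<in> frame_dom c a" "p = frame_par c s (snd C p)"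
    "p \<in> FB" "fst (snd C p) = snd c (fst p)"
proof -
  obtain c s a where C: "C = frame_chart c s a" "c \<in> A" "smooth_section A g c s"
    by (rule frame_atlasE[OF charts_atD(1)[OF assms]])
  have p: "p \<in> fst (frame_chart c s a)" using charts_atD(2)[OF assms] C(1) by simp
  obtain y where y: "y \<in> frame_dom c a" "p = frame_par c s y" using p by (auto simp: frame_chart_eq)
  have y': "snd C p = y" using frame_chart_coord(1)[OF C(2,3) y(1)] C(1) y(2) by simp
  have "fst p = chart_inv c (fst y)" using frame_par_in(2)[OF C(3) y(1)] y(2) by simp
  then have "snd c (fst p) = fst y" using chart_inv_right[OF frame_dom_fst[OF y(1)]] by simp
  moreover have "c \<in> charts_at A (fst p)"
    using C(2) frame_chart_image(3)[OF C(2,3) p] by (simp add: charts_at_def)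
  moreover have "p \<in> FB" using frame_par_in(1)[OF C(3) y(1)] y(2) by simp
  ultimately show ?thesis using that[OF C] y y' by simp
qed

lemma charts_at_frame_bundle: "C \<in> charts_at FA p \<Longrightarrow> p \<in> FB"
  by (erule frame_chart_atE)

lemma carrier_frame_atlas: "carrier_of FA = FB"
proof
  show "carrier_of FA \<subseteq> FB"
  proof
    fix p assume "p \<in> carrier_of FA"
    then obtain C where "C \<in> charts_at FA p" by (rule carrier_ofE)
    then show "p \<in> FB" by (rule charts_at_frame_bundle)
  qed
  show "FB \<subseteq> carrier_of FA"
  proof
    fix p assume p: "p \<in> FB"
    obtain c where c: "c \<in> charts_at A (fst p)" using frame_bundle_sel(1)[OF p] by (rule carrier_ofE)
    obtain s a where "frame_chart c s a \<in> charts_at FA p" by (rule frame_chart_exists[OF p c])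
    then show "p \<in> carrier_of FA" by (rule charts_at_carrier)
  qed
qed

definition fvec1 :: "('m, real^2) chart \<Rightarrow> 'm frame \<Rightarrow> real^2" where
  "fvec1 c p = fst (snd p) c"

definition fvec2 :: "('m, real^2) chart \<Rightarrow> 'm frame \<Rightarrow> real^2" where
  "fvec2 c p = snd (snd p) c"

text \<open>\<open>cov1\<close> and \<open>cov2\<close> are the coordinates in \<open>c\<close> of
  the covariant derivatives of the two frame vectors along \<open>X\<close>, that is, of the
  quantities whose vanishing defines \<open>horizontal_space\<close>.\<close>

definition cov1 :: "('m, real^2) chart \<Rightarrow> 'm frame \<Rightarrow> ('m frame, (real^2) \<times> real) tvec \<Rightarrow> real^2" where
  "cov1 c p X = fun_differential FA (fvec1 c) p X + christoffel_form (G c) (snd c (fst p)) (d\<pi> p X c) (fvec1 c p)"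

definition cov2 :: "('m, real^2) chart \<Rightarrow> 'm frame \<Rightarrow> ('m frame, (real^2) \<times> real) tvec \<Rightarrow> real^2" where
  "cov2 c p X = fun_differential FA (fvec2 c) p X + christoffel_form (G c) (snd c (fst p)) (d\<pi> p X c) (fvec2 c p)"

lemma horizontal_space_iff:
  "X \<in> horizontal_space A g p \<longleftrightarrow>
    X \<in> TF p \<and> (\<forall>c\<in>charts_at A (fst p). cov1 c p X = 0 \<and> cov2 c p X = 0)"
proof -
  have e: "(\<lambda>(y, e1, e2). e1 c) = fvec1 c" "(\<lambda>(y, e1, e2). e2 c) = fvec2 c" for c :: "('m, real^2) chart"
    by (auto simp: fvec1_def fvec2_def fun_eq_iff)
  show ?thesis
    unfolding horizontal_space_def cov1_def cov2_def christoffel_eq_form Let_def e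
    by (simp add: fvec1_def fvec2_def)
qed

lemma fvec_has_derivative:
  assumes C: "frame_chart c s a \<in> charts_at FA p" "c \<in> A" "smooth_section A g c s"
    and y: "snd (frame_chart c s a) p \<in> frame_dom c a"
  defines "y0 \<equiv> snd (frame_chart c s a) p"
  shows "(fvec1 c \<circ> chart_inv (frame_chart c s a) has_derivative
      frechet_derivative (\<lambda>y. fvec1 c (frame_par c s y)) (at y0)) (at y0)"
    and "((\<lambda>y. fvec1 c (frame_par c s y)) has_derivative
      frechet_derivative (\<lambda>y. fvec1 c (frame_par c s y)) (at y0)) (at y0)"
    and "(fvec2 c \<circ> chart_inv (frame_chart c s a) has_derivative
      frechet_derivative (\<lambda>y. fvec2 c (frame_par c s y)) (at y0)) (at y0)"
    and "((\<lambda>y. fvec2 c (frame_par c s y)) has_derivative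
      frechet_derivative (\<lambda>y. fvec2 c (frame_par c s y)) (at y0)) (at y0)"
proof -
  note y' = y[folded y0_def]
  show 1: "((\<lambda>y. fvec1 c (frame_par c s y)) has_derivative
      frechet_derivative (\<lambda>y. fvec1 c (frame_par c s y)) (at y0)) (at y0)"
    using smooth_on_has_derivative[OF smooth_frame_par(1)[OF C(2,3)] y'] by (simp add: fvec1_def)
  show 2: "((\<lambda>y. fvec2 c (frame_par c s y)) has_derivative
      frechet_derivative (\<lambda>y. fvec2 c (frame_par c s y)) (at y0)) (at y0)"
    using smooth_on_has_derivative[OF smooth_frame_par(2)[OF C(2,3)] y'] by (simp add: fvec2_def)
  show "(fvec1 c \<circ> chart_inv (frame_chart c s a) has_derivative
      frechet_derivative (\<lambda>y. fvec1 c (frame_par c s y)) (at y0)) (at y0)"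
    by (rule has_derivative_transform_within_open[OF 1 open_frame_dom[OF C(2)] y'])
      (simp add: frame_chart_coord(2)[OF C(2,3)])
  show "(fvec2 c \<circ> chart_inv (frame_chart c s a) has_derivative
      frechet_derivative (\<lambda>y. fvec2 c (frame_par c s y)) (at y0)) (at y0)"
    by (rule has_derivative_transform_within_open[OF 2 open_frame_dom[OF C(2)] y'])
      (simp add: frame_chart_coord(2)[OF C(2,3)])
qed

lemma proj_coord:
  assumes C: "frame_chart c s a \<in> charts_at FA p" "c \<in> A" "smooth_section A g c s"
    and y: "snd (frame_chart c s a) p \<in> frame_dom c a" and X: "X \<in> TF p"
    and c: "c \<in> charts_at A (fst p)"
  shows "d\<pi> p X c = fst (X (frame_chart c s a))"
proof -
  let ?y = "snd (frame_chart c s a) p"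
  have "(fst has_derivative fst) (at ?y)" by (rule bounded_linear_imp_has_derivative[OF bounded_linear_fst])
  then have "(snd c \<circ> fst \<circ> chart_inv (frame_chart c s a) has_derivative fst) (at ?y)"
    by (rule has_derivative_transform_within_open[OF _ open_frame_dom[OF C(2)] y])
      (simp add: frame_chart_coord(2)[OF C(2,3)] frame_par_in(2)[OF C(3)] chart_inv_right frame_dom_fst)
  then show ?thesis
    using differential_coord[OF smooth_frame_atlas smooth_frame_proj charts_at_frame_bundle[OF C(1)] C(1) c X]
    by (simp add: frechet_derivative_eqI)
qed

lemma frame_chart_at_base:
  assumes p: "p \<in> FB" and c: "c \<in> charts_at A (fst p)"
  obtains s a where "c \<in> A" "smooth_section A g c s" "frame_chart c s a \<in> charts_at FA p"
    "snd (frame_chart c s a) p \<in> frame_dom c a" "frame_par c s (snd (frame_chart c s a) p) = p"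
    "fst (snd (frame_chart c s a) p) = snd c (fst p)"
proof -
  note cA = charts_atD(1)[OF c]
  obtain s a where s: "smooth_section A g c s" and C: "frame_chart c s a \<in> charts_at FA p"
    by (rule frame_chart_exists[OF p c])
  obtain y where y: "y \<in> frame_dom c a" "p = frame_par c s y"
    using charts_atD(2)[OF C] by (auto simp: frame_chart_eq)
  have y': "snd (frame_chart c s a) p = y" using frame_chart_coord(1)[OF cA s y(1)] y(2) by simp
  have "fst p = chart_inv c (fst y)" using frame_par_in(2)[OF s y(1)] y(2) by simp
  then have "snd c (fst p) = fst y" using chart_inv_right[OF frame_dom_fst[OF y(1)]] by simp
  then show ?thesis using that[OF cA s C] y y' by simp
qed

lemma cov_coord:
  assumes C: "frame_chart c s a \<in> charts_at FA p" "c \<in> A" "smooth_section A g c s"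
    and y: "snd (frame_chart c s a) p \<in> frame_dom c a" and X: "X \<in> TF p"
    and c: "c \<in> charts_at A (fst p)"
  defines "y0 \<equiv> snd (frame_chart c s a) p" and "h \<equiv> X (frame_chart c s a)"
  shows "cov1 c p X = frechet_derivative (\<lambda>y. fvec1 c (frame_par c s y)) (at y0) h +
      christoffel_form (G c) (snd c (fst p)) (fst h) (fvec1 c p)"
    and "cov2 c p X = frechet_derivative (\<lambda>y. fvec2 c (frame_par c s y)) (at y0) h +
      christoffel_form (G c) (snd c (fst p)) (fst h) (fvec2 c p)"
  using fun_differential_eq[OF smooth_frame_atlas C(1) X fvec_has_derivative(1)[OF C y]]
    fun_differential_eq[OF smooth_frame_atlas C(1) X fvec_has_derivative(3)[OF C y]] proj_coord[OF C y X c]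
  by (simp_all add: cov1_def cov2_def y0_def h_def)

lemma proj_lincomb:
  assumes p: "p \<in> FB" and X: "X \<in> TF p" and Y: "Y \<in> TF p"
  shows "d\<pi> p (\<lambda>C. a *\<^sub>R X C + b *\<^sub>R Y C) = (\<lambda>c. a *\<^sub>R d\<pi> p X c + b *\<^sub>R d\<pi> p Y c)"
proof -
  obtain C where C: "C \<in> charts_at FA p" using p carrier_frame_atlas carrier_ofE by metis
  show ?thesis by (rule differential_lincomb[OF smooth_frame_atlas smooth_frame_proj p C X Y])
qed

lemma proj_in:
  assumes p: "p \<in> FB" and X: "X \<in> TF p"
  shows "d\<pi> p X \<in> tangent_space A (fst p)"
proof -
  obtain C where C: "C \<in> charts_at FA p" using p carrier_frame_atlas carrier_ofE by metis
  show ?thesis by (rule differential_in_tangent_space[OF smooth_frame_atlas atlas smooth_frame_proj p C X])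
qed

lemma cov_lincomb:
  assumes p: "p \<in> FB" and c: "c \<in> charts_at A (fst p)" and X: "X \<in> TF p" and Y: "Y \<in> TF p"
  shows "cov1 c p (\<lambda>C. a *\<^sub>R X C + b *\<^sub>R Y C) = a *\<^sub>R cov1 c p X + b *\<^sub>R cov1 c p Y"
    "cov2 c p (\<lambda>C. a *\<^sub>R X C + b *\<^sub>R Y C) = a *\<^sub>R cov2 c p X + b *\<^sub>R cov2 c p Y"
proof -
  interpret L: local_metric "snd c ` fst c" "G c" by (rule local_metric_chart[OF charts_atD(1)[OF c]])
  have u: "snd c (fst p) \<in> snd c ` fst c" using charts_atD(2)[OF c] by blast
  obtain s r where C: "c \<in> A" "smooth_section A g c s" "frame_chart c s r \<in> charts_at FA p"
    and y: "snd (frame_chart c s r) p \<in> frame_dom c r"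
    using frame_chart_at_base[OF p c] by metis
  note d = fvec_has_derivative[OF C(3,1,2) y]
  show "cov1 c p (\<lambda>C. a *\<^sub>R X C + b *\<^sub>R Y C) = a *\<^sub>R cov1 c p X + b *\<^sub>R cov1 c p Y"
    "cov2 c p (\<lambda>C. a *\<^sub>R X C + b *\<^sub>R Y C) = a *\<^sub>R cov2 c p X + b *\<^sub>R cov2 c p Y"
    unfolding cov1_def cov2_def proj_lincomb[OF p X Y]
      fun_differential_lincomb[OF smooth_frame_atlas C(3) X Y d(1)]
      fun_differential_lincomb[OF smooth_frame_atlas C(3) X Y d(3)]
    by (simp_all add: L.christoffel_simps[OF u] algebra_simps)
qed

lemma fvec_ortho:
  "p \<in> FB \<Longrightarrow> c \<in> charts_at A (fst p) \<Longrightarrow> ortho c (snd c (fst p)) (fvec1 c p) (fvec2 c p)"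
  using frame_bundle_ortho by (simp add: fvec1_def fvec2_def)

text \<open>Differentiating the orthonormality relations.\<close>

lemma cov_skew:
  assumes p: "p \<in> FB" and c: "c \<in> charts_at A (fst p)" and X: "X \<in> TF p"
  defines "H \<equiv> G c (snd c (fst p))"
  shows "H (cov1 c p X) (fvec1 c p) = 0" "H (cov2 c p X) (fvec2 c p) = 0"
    "H (cov1 c p X) (fvec2 c p) + H (fvec1 c p) (cov2 c p X) = 0"
proof -
  interpret L: local_metric "snd c ` fst c" "G c" by (rule local_metric_chart[OF charts_atD(1)[OF c]])
  have u: "snd c (fst p) \<in> snd c ` fst c" using charts_atD(2)[OF c] by blast
  obtain s r where C: "c \<in> A" "smooth_section A g c s" "frame_chart c s r \<in> charts_at FA p"
    and y: "snd (frame_chart c s r) p \<in> frame_dom c r" "frame_par c s (snd (frame_chart c s r) p) = p"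
      "fst (snd (frame_chart c s r) p) = snd c (fst p)"
    using frame_chart_at_base[OF p c] by metis
  let ?y = "snd (frame_chart c s r) p" and ?h = "X (frame_chart c s r)"
  let ?E = "\<lambda>y. fvec1 c (frame_par c s y)" and ?F = "\<lambda>y. fvec2 c (frame_par c s y)"
  note d = fvec_has_derivative(2,4)[OF C(3,1,2) y(1)]
  have fst': "(fst has_derivative fst) (at ?y)" by (rule bounded_linear_imp_has_derivative[OF bounded_linear_fst])
  have orth: "ortho c (fst z) (?E z) (?F z)" if z: "z \<in> frame_dom c r" for z
  proof -
    have "snd c (fst (frame_par c s z)) = fst z"
      using frame_par_in(2)[OF C(2) z] chart_inv_right[OF frame_dom_fst[OF z]] by simp
    moreover have "c \<in> charts_at A (fst (frame_par c s z))"
      using frame_par_in(2)[OF C(2) z] chart_inv_in[OF frame_dom_fst[OF z]] C(1) by (simp add: charts_at_def)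
    ultimately show ?thesis using fvec_ortho[OF frame_par_in(1)[OF C(2) z]] by metis
  qed
  have const: "frechet_derivative (\<lambda>z. G c (fst z) (P z) (Q z)) (at ?y) ?h = 0"
    if "\<And>z. z \<in> frame_dom c r \<Longrightarrow> G c (fst z) (P z) (Q z) = k" for P Q and k :: real
    using fun_cong[OF frechet_derivative_cong_open[OF open_frame_dom[OF C(1)] y(1) that], of "\<lambda>z. z"] by simp
  \<comment> \<open>With \<open>fst\<close> as base map, \<open>has_derivative_metric\<close>
    produces exactly the covariant derivatives that \<open>cov_coord\<close> identifies with
    \<open>cov1\<close> and \<open>cov2\<close>.\<close>
  note D = frechet_derivative_eqI[OF L.has_derivative_metric[where p = fst and y = ?y, unfolded y(3), OF u fst']]
  note cov = cov_coord[OF C(3,1,2) y(1) X c]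
  have "H (cov1 c p X) (fvec1 c p) + H (fvec1 c p) (cov1 c p X) = 0"
    using const[of ?E ?E 1] orth unfolding D[OF d(1) d(1)] L.orthoframe_def y(2) H_def cov by simp
  then show "H (cov1 c p X) (fvec1 c p) = 0" using L.sym_G[OF u] unfolding H_def by simp
  have "H (cov2 c p X) (fvec2 c p) + H (fvec2 c p) (cov2 c p X) = 0"
    using const[of ?F ?F 1] orth unfolding D[OF d(2) d(2)] L.orthoframe_def y(2) H_def cov by simp
  then show "H (cov2 c p X) (fvec2 c p) = 0" using L.sym_G[OF u] unfolding H_def by simp
  show "H (cov1 c p X) (fvec2 c p) + H (fvec1 c p) (cov2 c p X) = 0"
    using const[of ?E ?F 0] orth unfolding D[OF d(1) d(2)] L.orthoframe_def y(2) H_def cov by simp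
qed

text \<open>Rotation adds to the angle coordinate and fixes the base coordinate; \<open>V\<close>
  consists of the angles that keep the sum inside the interval of the chart.\<close>

lemma rotation_in_chart:
  assumes C: "C \<in> charts_at FA p"
  shows "\<exists>V. open V \<and> 0 \<in> V \<and> (\<forall>t\<in>V. rotate_frame p t \<in> fst C \<and> snd C (rotate_frame p t) = snd C p + t *\<^sub>R (0, 1))"
proof -
  obtain c s a where C': "C = frame_chart c s a" "c \<in> A" "smooth_section A g c s"
    and y: "snd C p \<in> frame_dom c a" "p = frame_par c s (snd C p)"
    by (rule frame_chart_atE[OF C])
  obtain u r where ur: "snd C p = (u, r)" by force
  let ?V = "{a - pi - r <..< a + pi - r}"
  have "rotate_frame p t = frame_par c s (u, r + t)" for t
    using y(2) by (simp add: ur frame_par_Pair rotate_frame_add)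
  moreover have "(u, r + t) \<in> frame_dom c a" if "t \<in> ?V" for t
    using that y(1) by (auto simp: ur frame_dom_def)
  ultimately have "\<forall>t\<in>?V. rotate_frame p t \<in> fst C \<and> snd C (rotate_frame p t) = snd C p + t *\<^sub>R (0, 1)"
    using frame_chart_coord(1,3)[OF C'(2,3)] by (simp add: C'(1) ur[unfolded C'(1)])
  moreover have "open ?V" by simp
  moreover have "0 \<in> ?V" using y(1) by (auto simp: ur frame_dom_def)
  ultimately show ?thesis by blast
qed

lemma rotation_has_derivative:
  assumes C: "C \<in> charts_at FA p"
  shows "((\<lambda>t. snd C (rotate_frame p t)) has_derivative (\<lambda>t. t *\<^sub>R (0, 1))) (at 0)"
proof -
  obtain V where V: "open V" "0 \<in> V" "\<And>t. t \<in> V \<Longrightarrow> snd C (rotate_frame p t) = snd C p + t *\<^sub>R (0, 1)"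
    using rotation_in_chart[OF C] by blast
  have "((\<lambda>t::real. snd C p + t *\<^sub>R (0, 1)) has_derivative (\<lambda>t. t *\<^sub>R (0, 1))) (at 0)"
    by (auto intro!: derivative_eq_intros)
  then show ?thesis
    by (rule has_derivative_transform_within_open[OF _ V(1,2)]) (simp add: V(3))
qed

lemma fundamental_vector_coord:
  assumes C: "C \<in> charts_at FA p"
  shows "vphi p C = (0, 1)"
proof -
  have "((snd C \<circ> rotate_frame p) has_vector_derivative (0, 1)) (at 0)"
    using rotation_has_derivative[OF C] by (simp add: has_vector_derivative_def o_def)
  then show ?thesis
    using C by (simp add: fundamental_vector_def velocity_def vector_derivative_at)
qed

lemma derivative_along_rotation:
  assumes C: "C \<in> charts_at FA p" and F: "(F \<circ> chart_inv C has_derivative D) (at (snd C p))"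
  shows "((\<lambda>t. F (rotate_frame p t)) has_derivative (\<lambda>t. D (t *\<^sub>R (0, 1)))) (at 0)"
proof -
  obtain V where V: "open V" "0 \<in> V" "\<And>t. t \<in> V \<Longrightarrow> rotate_frame p t \<in> fst C"
    using rotation_in_chart[OF C] by blast
  have ch: "is_chart C" by (rule smooth_atlas_chart[OF smooth_frame_atlas charts_atD(1)[OF C]])
  have "((F \<circ> chart_inv C) \<circ> (\<lambda>t. snd C (rotate_frame p t)) has_derivative D \<circ> (\<lambda>t. t *\<^sub>R (0, 1))) (at 0)"
    by (rule diff_chain_at[OF rotation_has_derivative[OF C]]) (simp add: F)
  then have "((F \<circ> chart_inv C) \<circ> (\<lambda>t. snd C (rotate_frame p t)) has_derivative (\<lambda>t. D (t *\<^sub>R (0, 1)))) (at 0)"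
    by (simp add: o_def)
  then show ?thesis
    by (rule has_derivative_transform_within_open[OF _ V(1,2)]) (simp add: chart_inv_left[OF ch V(3)])
qed

text \<open>An equivariant map carries the rotation curve through \<open>p\<close> to the one
  through \<open>F p\<close>, and both have coordinate velocity \<open>(0, 1)\<close>. With the
  identity this makes the fundamental vector a tangent vector; with \<open>frame_map\<close> it
  gives its invariance.\<close>

lemma rotation_equivariant_derivative:
  assumes F: "smooth_map FA W FA W' F" "p \<in> W" and rot: "\<And>t. F (rotate_frame p t) = rotate_frame (F p) t"
    and C: "C \<in> charts_at FA p" and D: "D \<in> charts_at FA (F p)"
  shows "frechet_derivative (snd D \<circ> F \<circ> chart_inv C) (at (snd C p)) (0, 1) = (0, 1)"
proof -
  let ?L = "frechet_derivative (snd D \<circ> F \<circ> chart_inv C) (at (snd C p))"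
  have "((\<lambda>t. (snd D \<circ> F) (rotate_frame p t)) has_derivative (\<lambda>t. ?L (t *\<^sub>R (0, 1)))) (at 0)"
    by (rule derivative_along_rotation[OF C smooth_map_has_derivative[OF F C D]])
  then have "((\<lambda>t. snd D (rotate_frame (F p) t)) has_derivative (\<lambda>t. ?L (t *\<^sub>R (0, 1)))) (at 0)"
    by (simp add: rot)
  from fun_cong[OF has_derivative_unique[OF this rotation_has_derivative[OF D]], of 1]
  show ?thesis by simp
qed

lemma fundamental_vector_in:
  assumes p: "p \<in> FB"
  shows "vphi p \<in> TF p"
proof (rule tangent_spaceI)
  fix C D assume C: "C \<in> charts_at FA p" and D: "D \<in> charts_at FA p"
  \<comment> \<open>The Jacobian of a transition map is the derivative of the identity in two
    charts.\<close>
  have "frechet_derivative (snd D \<circ> (\<lambda>p. p) \<circ> chart_inv C) (at (snd C p)) (0, 1) = (0, 1)"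
    by (rule rotation_equivariant_derivative[OF smooth_map_ident[OF smooth_frame_atlas] charts_at_carrier[OF C]])
      (use C D in auto)
  then show "vphi p D = frechet_derivative (transition C D) (at (snd C p)) (vphi p C)"
    by (simp add: fundamental_vector_coord C D transition_def comp_def)
qed (simp add: fundamental_vector_def velocity_def)

lemma fundamental_vector_vertical:
  assumes p: "p \<in> FB"
  shows "d\<pi> p (vphi p) = (\<lambda>c. 0)" "vphi p \<in> vertical_space A g p"
proof -
  obtain c where c: "c \<in> charts_at A (fst p)" using frame_bundle_sel(1)[OF p] by (rule carrier_ofE)
  obtain s r where C: "c \<in> A" "smooth_section A g c s" "frame_chart c s r \<in> charts_at FA p"
    and y: "snd (frame_chart c s r) p \<in> frame_dom c r"
    using frame_chart_at_base[OF p c] by metis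
  note X = fundamental_vector_in[OF p]
  show 1: "d\<pi> p (vphi p) = (\<lambda>c. 0)"
    by (rule tangent_space_eqI[OF proj_in[OF p X] tangent_space_zero[OF atlas] c])
      (simp add: proj_coord[OF C(3,1,2) y X c] fundamental_vector_coord[OF C(3)])
  show "vphi p \<in> vertical_space A g p" using X 1 by (simp add: vertical_space_def)
qed

text \<open>The base point does not move along a fibre, so the Christoffel term drops out; what
  remains is the derivative at 0 of the first rotated vector, whose sine term contributes the second
  frame vector.\<close>

lemma cov_fundamental:
  assumes p: "p \<in> FB" and c: "c \<in> charts_at A (fst p)"
  shows "cov1 c p (vphi p) = fvec2 c p"
proof -
  interpret L: local_metric "snd c ` fst c" "G c" by (rule local_metric_chart[OF charts_atD(1)[OF c]])
  have u: "snd c (fst p) \<in> snd c ` fst c" using charts_atD(2)[OF c] by blast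
  obtain s r where C: "c \<in> A" "smooth_section A g c s" "frame_chart c s r \<in> charts_at FA p"
    and y: "snd (frame_chart c s r) p \<in> frame_dom c r"
    using frame_chart_at_base[OF p c] by metis
  let ?D = "frechet_derivative (\<lambda>y. fvec1 c (frame_par c s y)) (at (snd (frame_chart c s r) p))"
  have 1: "((\<lambda>t. fvec1 c (rotate_frame p t)) has_derivative (\<lambda>t. ?D (t *\<^sub>R (0, 1)))) (at 0)"
    by (rule derivative_along_rotation[OF C(3) fvec_has_derivative(1)[OF C(3,1,2) y]])
  have 2: "((\<lambda>t. fvec1 c (rotate_frame p t)) has_derivative (\<lambda>t. t *\<^sub>R fvec2 c p)) (at 0)"
    unfolding fvec1_def fvec2_def rotate_frame_sel
    by (rule has_derivative_eq_rhs, (rule derivative_intros)+) simp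
  have "?D (0, 1) = fvec2 c p" using fun_cong[OF has_derivative_unique[OF 1 2], of 1] by simp
  then show ?thesis
    unfolding cov1_def fundamental_vector_vertical(1)[OF p]
      fun_differential_eq[OF smooth_frame_atlas C(3) fundamental_vector_in[OF p] fvec_has_derivative(1)[OF C(3,1,2) y]]
      fundamental_vector_coord[OF C(3)]
    by (simp add: L.christoffel_simps[OF u])
qed

end

section \<open>The differential of the frame map\<close>

context surface_isometry
begin

abbreviation (input) "F \<equiv> frame_map A f"
abbreviation (input) "dF p \<equiv> differential (frame_atlas A g) (frame_atlas A g) (frame_map A f) p"

lemma frame_charts_exist:
  assumes p: "p \<in> FB"
  obtains C D where "C \<in> charts_at FA p" "D \<in> charts_at FA (F p)"
  using p frame_map_in[OF p] carrier_frame_atlas carrier_ofE by metis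

lemma dF_in:
  assumes p: "p \<in> FB" and X: "X \<in> TF p"
  shows "dF p X \<in> TF (F p)"
proof -
  obtain C where C: "C \<in> charts_at FA p" using frame_charts_exist[OF p] .
  show ?thesis
    by (rule differential_in_tangent_space[OF smooth_frame_atlas smooth_frame_atlas smooth_frame_map p C X])
qed

lemma dF_lincomb:
  assumes p: "p \<in> FB" and X: "X \<in> TF p" and Y: "Y \<in> TF p"
  shows "dF p (\<lambda>C. a *\<^sub>R X C + b *\<^sub>R Y C) = (\<lambda>C. a *\<^sub>R dF p X C + b *\<^sub>R dF p Y C)"
proof -
  obtain C where C: "C \<in> charts_at FA p" using frame_charts_exist[OF p] .
  show ?thesis by (rule differential_lincomb[OF smooth_frame_atlas smooth_frame_map p C X Y])
qed

text \<open>The chain rule applied to both sides of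
  \<open>fst \<circ> F = f \<circ> fst\<close>.\<close>

lemma proj_dF:
  assumes p: "p \<in> FB" and X: "X \<in> TF p"
  shows "d\<pi> (F p) (dF p X) = df (fst p) (d\<pi> p X)"
proof -
  obtain C D where C: "C \<in> charts_at FA p" "D \<in> charts_at FA (F p)" using frame_charts_exist[OF p] .
  obtain c where c: "c \<in> charts_at A (fst p)" using frame_bundle_sel(1)[OF p] by (rule carrier_ofE)
  have "d\<pi> (F p) (dF p X) = differential FA A (fst \<circ> F) p X"
    by (rule differential_comp[OF smooth_frame_atlas smooth_frame_atlas atlas smooth_frame_map p
          smooth_frame_proj frame_map_in[OF p] C X])
  also have "fst \<circ> F = f \<circ> fst" by auto
  also have "differential FA A (f \<circ> fst) p X = df (fst p) (d\<pi> p X)"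
    by (rule differential_comp[symmetric, OF smooth_frame_atlas atlas atlas smooth_frame_proj p
          smooth_f frame_bundle_sel(1)[OF p] C(1) c X])
  finally show ?thesis .
qed

lemma dF_fundamental:
  assumes p: "p \<in> FB"
  shows "dF p (vphi p) = vphi (F p)"
proof -
  obtain C D where C: "C \<in> charts_at FA p" "D \<in> charts_at FA (F p)" using frame_charts_exist[OF p] .
  note X = fundamental_vector_in[OF p]
  have "dF p (vphi p) D = (0, 1)"
    unfolding differential_coord[OF smooth_frame_atlas smooth_frame_map p C X] fundamental_vector_coord[OF C(1)]
    by (rule rotation_equivariant_derivative[OF smooth_frame_map p frame_map_rotate[OF p] C])
  then show ?thesis
    by (intro tangent_space_eqI[OF dF_in[OF p X] fundamental_vector_in[OF frame_map_in[OF p]] C(2)])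
      (simp add: fundamental_vector_coord[OF C(2)])
qed

text \<open>The image frame vectors are the derivative of \<phi> applied to the original ones.
  Differentiating this product creates a second derivative of \<phi>, which is precisely the
  inhomogeneous term of \<open>christoffel_pushforward\<close>.\<close>

lemma cov_pushforward:
  assumes p: "p \<in> FB" and c: "c \<in> charts_at A (fst p)" and d: "d \<in> charts_at A (f (fst p))" and X: "X \<in> TF p"
  defines "L \<equiv> frechet_derivative (loc c d) (at (snd c (fst p)))"
  shows "cov1 d (F p) (dF p X) = L (cov1 c p X)" "cov2 d (F p) (dF p X) = L (cov2 c p X)"
proof -
  obtain s r where C: "c \<in> A" "smooth_section A g c s" "frame_chart c s r \<in> charts_at FA p"
    and y: "snd (frame_chart c s r) p \<in> frame_dom c r" "frame_par c s (snd (frame_chart c s r) p) = p"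
      "fst (snd (frame_chart c s r) p) = snd c (fst p)"
    using frame_chart_at_base[OF p c] by metis
  have d': "d \<in> charts_at A (fst (F p))" using d by simp
  obtain s' r' where D: "d \<in> A" "smooth_section A g d s'" "frame_chart d s' r' \<in> charts_at FA (F p)"
    and y': "snd (frame_chart d s' r') (F p) \<in> frame_dom d r'"
    using frame_chart_at_base[OF frame_map_in[OF p] d'] by metis
  let ?\<phi> = "loc c d" and ?y = "snd (frame_chart c s r) p" and ?h = "X (frame_chart c s r)"
  interpret I: local_isometry "ldom c d" "G c" "snd d ` fst d" "G d" ?\<phi>
    by (rule local_isometry_charts[OF C(1) D(1)])
  have u: "fst ?y \<in> ldom c d" using charts_atD(2)[OF c] charts_atD(2)[OF d] by (simp add: y(3))
  have inv: "chart_inv c (snd c (fst p)) = fst p"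
    by (rule chart_inv_left[OF chart_is_chart[OF C(1)] charts_atD(2)[OF c]])
  have \<phi>u: "?\<phi> (snd c (fst p)) = snd d (f (fst p))" by (simp add: inv)
  let ?O = "frame_dom c r \<inter> (ldom c d \<times> UNIV)"
  have O: "open ?O" by (intro open_Int open_frame_dom C open_Times I.S.open_U) auto
  have yO: "?y \<in> ?O" using y(1) u by (simp add: mem_Times_iff)
  have onO: "f (chart_inv c (fst z)) \<in> fst d" if "z \<in> ?O" for z
    using that chart_inv_left[OF chart_is_chart[OF C(1)]] by (auto simp: frame_dom_def)
  have fst': "(fst has_derivative fst) (at ?y)" by (rule bounded_linear_imp_has_derivative[OF bounded_linear_fst])
  \<comment> \<open>Stated for an arbitrary coordinate vector \<open>E\<close> and its image
    \<open>w\<close>, to serve both frame vectors.\<close>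
  have push: "fun_differential FA (w \<circ> F) p X + christoffel_form (G d) (snd d (f (fst p))) (L (fst ?h)) (L (E ?y)) =
      L (frechet_derivative E (at ?y) ?h + christoffel_form (G c) (snd c (fst p)) (fst ?h) (E ?y))"
    if E: "(E has_derivative frechet_derivative E (at ?y)) (at ?y)"
      and w: "\<And>z. z \<in> ?O \<Longrightarrow> w (F (frame_par c s z)) = frechet_derivative ?\<phi> (at (fst z)) (E z)"
    for E :: "(real^2) \<times> real \<Rightarrow> real^2" and w
  proof -
    have "((\<lambda>z. frechet_derivative ?\<phi> (at (fst z)) (E z)) has_derivative
      (\<lambda>h. I.DD\<phi> (fst ?y) (fst h) (E ?y) + I.D\<phi> (fst ?y) (frechet_derivative E (at ?y) h))) (at ?y)"
      by (rule has_derivative_linear_family[OF I.S.open_U u I.linear_D\<phi> _ fst' E])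
        (auto intro: smooth_on_differentiable[OF smooth_on_frechet_derivative_const[OF I.smooth] u])
    then have "((w \<circ> F) \<circ> chart_inv (frame_chart c s r) has_derivative
      (\<lambda>h. I.DD\<phi> (fst ?y) (fst h) (E ?y) + I.D\<phi> (fst ?y) (frechet_derivative E (at ?y) h))) (at ?y)"
      by (rule has_derivative_transform_within_open[OF _ O yO]) (simp add: w frame_chart_coord(2)[OF C(1,2)])
    from fun_differential_eq[OF smooth_frame_atlas C(3) X this]
    have 1: "fun_differential FA (w \<circ> F) p X = I.DD\<phi> (snd c (fst p)) (fst ?h) (E ?y) + L (frechet_derivative E (at ?y) ?h)"
      by (simp add: y(3) L_def)
    have "L (christoffel_form (G c) (snd c (fst p)) (fst ?h) (E ?y)) =
      christoffel_form (G d) (snd d (f (fst p))) (L (fst ?h)) (L (E ?y)) + I.DD\<phi> (snd c (fst p)) (fst ?h) (E ?y)"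
      using I.christoffel_pushforward[of "snd c (fst p)" "fst ?h" "E ?y"] u \<phi>u by (simp add: L_def y(3))
    then show ?thesis
      using linear_add[OF I.linear_D\<phi>[OF u]] 1 by (simp add: L_def y(3))
  qed
  have proj: "d\<pi> (F p) (dF p X) d = L (fst ?h)"
    using proj_dF[OF p X] df_coord[OF c d proj_in[OF p X]] proj_coord[OF C(3,1,2) y(1) X c] by (simp add: L_def)
  have zO: "z \<in> frame_dom c r" if "z \<in> ?O" for z using that by blast
  note fc = fun_differential_comp[OF smooth_frame_atlas smooth_frame_atlas smooth_frame_map p C(3) X D(3)]
  note fd = fvec_has_derivative[OF C(3,1,2) y(1)] and fd' = fvec_has_derivative[OF D(3,1,2) y']
  have "fun_differential FA (fvec1 d \<circ> F) p X + christoffel_form (G d) (snd d (f (fst p))) (L (fst ?h)) (L (fvec1 c p)) =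
      L (cov1 c p X)"
    unfolding cov_coord(1)[OF C(3,1,2) y(1) X c]
    using push[OF fd(2), of "fvec1 d"] frame_map_coord(1)[OF C(1) D(1) C(2) zO onO] by (simp add: y(2) fvec1_def)
  moreover have "fvec1 d (F p) = L (fvec1 c p)"
    using frame_map_coord(1)[OF C(1) D(1) C(2) y(1) onO[OF yO]] by (simp add: fvec1_def y(2,3) L_def)
  ultimately show "cov1 d (F p) (dF p X) = L (cov1 c p X)"
    unfolding cov1_def[of d] fc[OF fd'(1)] proj by simp
  have "fun_differential FA (fvec2 d \<circ> F) p X + christoffel_form (G d) (snd d (f (fst p))) (L (fst ?h)) (L (fvec2 c p)) =
      L (cov2 c p X)"
    unfolding cov_coord(2)[OF C(3,1,2) y(1) X c]
    using push[OF fd(4), of "fvec2 d"] frame_map_coord(2)[OF C(1) D(1) C(2) zO onO] by (simp add: y(2) fvec2_def)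
  moreover have "fvec2 d (F p) = L (fvec2 c p)"
    using frame_map_coord(2)[OF C(1) D(1) C(2) y(1) onO[OF yO]] by (simp add: fvec2_def y(2,3) L_def)
  ultimately show "cov2 d (F p) (dF p X) = L (cov2 c p X)"
    unfolding cov2_def[of d] fc[OF fd'(3)] proj by simp
qed

text \<open>From one chart at \<open>p\<close> to an arbitrary chart at \<open>F p\<close>; for the
  identity this changes the chart over a fixed frame.\<close>

lemma cov_zero_pushforward:
  assumes p: "p \<in> FB" and X: "X \<in> TF p" and c: "c \<in> charts_at A (fst p)" and d: "d \<in> charts_at A (f (fst p))"
    and "cov1 c p X = 0" "cov2 c p X = 0"
  shows "cov1 d (F p) (dF p X) = 0" "cov2 d (F p) (dF p X) = 0"
  unfolding cov_pushforward[OF p c d X] assms(5,6) by (rule linear_0[OF cross2_loc(2)[OF c d]])+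

lemma dF_horizontal:
  assumes p: "p \<in> FB" and X: "X \<in> horizontal_space A g p"
  shows "dF p X \<in> horizontal_space A g (F p)"
proof -
  obtain c where c: "c \<in> charts_at A (fst p)" using frame_bundle_sel(1)[OF p] by (rule carrier_ofE)
  show ?thesis
    using X cov_zero_pushforward[OF p _ c] c dF_in[OF p] by (simp add: horizontal_space_iff)
qed

lemma dF_vertical:
  assumes p: "p \<in> FB" and X: "X \<in> vertical_space A g p"
  shows "dF p X \<in> vertical_space A g (F p)"
proof -
  have XT: "X \<in> TF p" and 0: "d\<pi> p X = (\<lambda>c. 0)" using X by (auto simp: vertical_space_def)
  obtain c where c: "c \<in> charts_at A (fst p)" using frame_bundle_sel(1)[OF p] by (rule carrier_ofE)
  \<comment> \<open>Linearity of the differential, with both coefficients 0.\<close>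
  have "df (fst p) (\<lambda>c. 0) = (\<lambda>c. 0)"
    using differential_lincomb[OF atlas smooth_f charts_at_carrier[OF c] c tangent_space_zero[OF atlas] tangent_space_zero[OF atlas], of 0 0]
    by simp
  then show ?thesis using dF_in[OF p XT] proj_dF[OF p XT] 0 by (simp add: vertical_space_def)
qed

end

section \<open>Existence and uniqueness of the Wagner form\<close>

context oriented_surface
begin

text \<open>\<open>horizontal_space\<close> asks for vanishing in every chart of the surface; the
  pushforward law for the identity carries it over from \<open>c\<close>.\<close>

lemma horizontal_spaceI:
  assumes p: "p \<in> FB" and X: "X \<in> TF p" and c: "c \<in> charts_at A (fst p)"
    and 0: "cov1 c p X = 0" "cov2 c p X = 0"
  shows "X \<in> horizontal_space A g p"
proof -
  interpret I: surface_isometry A g "\<lambda>x. x" by (rule surface_isometry_ident)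
  have "differential FA FA (frame_map A (\<lambda>x. x)) p X = differential FA FA (\<lambda>p. p) p X"
    by (rule fun_cong[OF differential_cong[OF smooth_frame_atlas]])
      (use p frame_map_ident in \<open>auto simp: carrier_frame_atlas\<close>)
  then have "differential FA FA (frame_map A (\<lambda>x. x)) p X = X"
    using differential_ident[OF smooth_frame_atlas X] by simp
  then show ?thesis
    using I.cov_zero_pushforward[OF p X c _ 0] X by (simp add: horizontal_space_iff frame_map_ident[OF p])
qed

definition is_wagner :: "'m frame \<Rightarrow> (('m frame, (real^2) \<times> real) tvec \<Rightarrow> ('m frame, (real^2) \<times> real) tvec \<Rightarrow> real) \<Rightarrow> bool" where
  "is_wagner p h \<longleftrightarrow>
     sym_bilinear_on (TF p) h \<and>
     (\<forall>X\<in>horizontal_space A g p. \<forall>Y\<in>horizontal_space A g p. h X Y = g (fst p) (d\<pi> p X) (d\<pi> p Y)) \<and>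
     (\<forall>X\<in>horizontal_space A g p. \<forall>Y\<in>vertical_space A g p. h X Y = 0) \<and>
     h (vphi p) (vphi p) = 1 / (gauss_curvature A g (fst p))\<^sup>2"

lemma wagner_lift_eq: "wagner_lift A g p = (SOME h. is_wagner p h)"
  by (simp add: wagner_lift_def is_wagner_def)

text \<open>The form is \<open>g(d\<pi> X, d\<pi> Y) + \<omega>(X) \<omega>(Y) / K\<^sup>2\<close> with the connection form \<open>\<omega>(X) = g(\<nabla>\<^sub>X e\<^sub>1, e\<^sub>2)\<close>.\<close>

lemma is_wagner_exists:
  assumes p: "p \<in> FB"
  shows "\<exists>h. is_wagner p h"
proof -
  obtain c where c: "c \<in> charts_at A (fst p)" using frame_bundle_sel(1)[OF p] by (rule carrier_ofE)
  interpret L: local_metric "snd c ` fst c" "G c" by (rule local_metric_chart[OF charts_atD(1)[OF c]])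
  have u: "snd c (fst p) \<in> snd c ` fst c" using charts_atD(2)[OF c] by blast
  define \<omega> where "\<omega> X = G c (snd c (fst p)) (cov1 c p X) (fvec2 c p)" for X
  define h where "h X Y = g (fst p) (d\<pi> p X) (d\<pi> p Y) + \<omega> X * \<omega> Y / (gauss_curvature A g (fst p))\<^sup>2" for X Y
  note b = sym_bilinear_onD[OF g_sym_bilinear[OF frame_bundle_sel(1)[OF p]]]
  have "sym_bilinear_on (TF p) h"
    unfolding sym_bilinear_on_def
  proof (intro conjI ballI allI)
    fix X Y assume X: "X \<in> TF p" and Y: "Y \<in> TF p"
    show "h X Y = h Y X" using b(1)[OF proj_in[OF p X] proj_in[OF p Y]] by (simp add: h_def)
    fix Z a r assume Z: "Z \<in> TF p"
    have "\<omega> (\<lambda>C. a *\<^sub>R X C + r *\<^sub>R Y C) = a * \<omega> X + r * \<omega> Y"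
      unfolding \<omega>_def cov_lincomb[OF p c X Y] by (simp add: L.G_simps[OF u])
    then show "h (\<lambda>C. a *\<^sub>R X C + r *\<^sub>R Y C) Z = a * h X Z + r * h Y Z"
      unfolding h_def proj_lincomb[OF p X Y] b(2)[OF proj_in[OF p X] proj_in[OF p Y] proj_in[OF p Z]]
      by (simp add: algebra_simps add_divide_distrib)
  qed
  moreover have \<omega>H: "\<omega> X = 0" if "X \<in> horizontal_space A g p" for X
    using that c by (simp add: \<omega>_def horizontal_space_iff L.G_simps[OF u])
  moreover have "h X Y = 0" if X: "X \<in> horizontal_space A g p" and Y: "Y \<in> vertical_space A g p" for X Y
  proof -
    have XT: "d\<pi> p X \<in> tangent_space A (fst p)" using X proj_in[OF p] by (simp add: horizontal_space_iff)
    have zT: "(\<lambda>c. 0) \<in> tangent_space A (fst p)" by (rule tangent_space_zero[OF atlas])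
    have "g (fst p) (d\<pi> p X) (\<lambda>c. 0) = 0"
      using b(1)[OF XT zT] b(2)[OF zT zT XT, of 0 0] by simp
    then show ?thesis using Y \<omega>H[OF X] by (simp add: h_def vertical_space_def)
  qed
  moreover have "h (vphi p) (vphi p) = 1 / (gauss_curvature A g (fst p))\<^sup>2"
  proof -
    have zT: "(\<lambda>c. 0) \<in> tangent_space A (fst p)" by (rule tangent_space_zero[OF atlas])
    have "g (fst p) (\<lambda>c. 0) (\<lambda>c. 0) = 0" using b(2)[OF zT zT zT, of 0 0] by simp
    moreover have "\<omega> (vphi p) = 1"
      using fvec_ortho[OF p c] by (simp add: \<omega>_def cov_fundamental[OF p c] L.orthoframe_def)
    ultimately show ?thesis by (simp add: h_def fundamental_vector_vertical(1)[OF p])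
  qed
  ultimately have "is_wagner p h" by (simp add: is_wagner_def) (simp add: h_def)
  then show ?thesis by blast
qed

text \<open>Subtracting from \<open>X\<close> the multiple of the fundamental vector given by the
  connection form removes the component of \<open>cov1\<close> along the second frame vector. The
  relations of \<open>cov_skew\<close> then force all other components of \<open>cov1\<close> and
  \<open>cov2\<close> to vanish.\<close>

lemma horizontal_vertical_decomposition:
  assumes p: "p \<in> FB" and X: "X \<in> TF p"
  obtains Y w where "Y \<in> horizontal_space A g p" "X = (\<lambda>C. 1 *\<^sub>R Y C + w *\<^sub>R vphi p C)"
proof -
  obtain c where c: "c \<in> charts_at A (fst p)" using frame_bundle_sel(1)[OF p] by (rule carrier_ofE)
  interpret L: local_metric "snd c ` fst c" "G c" by (rule local_metric_chart[OF charts_atD(1)[OF c]])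
  have u: "snd c (fst p) \<in> snd c ` fst c" using charts_atD(2)[OF c] by blast
  define H where "H = G c (snd c (fst p))"
  \<comment> \<open>The value of the connection form on \<open>X\<close>; it is 1 on the fundamental
    vector by \<open>cov_fundamental\<close>.\<close>
  define w where "w = H (cov1 c p X) (fvec2 c p)"
  define Y where "Y = (\<lambda>C. 1 *\<^sub>R X C + (- w) *\<^sub>R vphi p C)"
  note V = fundamental_vector_in[OF p]
  have Y: "Y \<in> TF p" unfolding Y_def by (rule tangent_space_lincomb[OF smooth_frame_atlas X V])
  note sk = cov_skew[OF p c Y, folded H_def] and o = fvec_ortho[OF p c]
  have "cov1 c p Y = 1 *\<^sub>R cov1 c p X + (- w) *\<^sub>R fvec2 c p"
    unfolding Y_def cov_lincomb[OF p c X V] cov_fundamental[OF p c] ..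
  then have 12: "H (cov1 c p Y) (fvec2 c p) = 0"
    using o by (simp add: w_def H_def L.G_simps[OF u] L.orthoframe_def)
  have "cov1 c p Y = 0"
    using L.orthoframe_expand[OF u o, of "cov1 c p Y"] sk(1) 12 by (simp add: H_def)
  moreover have "H (cov2 c p Y) (fvec1 c p) = 0"
    using sk(3) 12 L.sym_G[OF u] by (simp add: H_def)
  then have "cov2 c p Y = 0"
    using L.orthoframe_expand[OF u o, of "cov2 c p Y"] sk(2) by (simp add: H_def)
  ultimately have "Y \<in> horizontal_space A g p" by (rule horizontal_spaceI[OF p Y c])
  then show ?thesis by (rule that[of Y w]) (simp add: Y_def fun_eq_iff)
qed

text \<open>The right-hand side does not mention \<open>h\<close>, which yields uniqueness. As
  \<open>sym_bilinear_on\<close> states linearity in the first argument only, the second argument is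
  expanded after a swap by symmetry.\<close>

lemma is_wagner_decomposition:
  assumes p: "p \<in> FB" and h: "is_wagner p h"
    and X: "X \<in> horizontal_space A g p" and Y: "Y \<in> horizontal_space A g p"
  shows "h (\<lambda>C. 1 *\<^sub>R X C + v *\<^sub>R vphi p C) (\<lambda>C. 1 *\<^sub>R Y C + w *\<^sub>R vphi p C) =
    g (fst p) (d\<pi> p X) (d\<pi> p Y) + v * w / (gauss_curvature A g (fst p))\<^sup>2"
proof -
  have b: "sym_bilinear_on (TF p) h" using h by (simp add: is_wagner_def)
  note V = fundamental_vector_in[OF p] and VV = fundamental_vector_vertical(2)[OF p]
  have XT: "X \<in> TF p" and YT: "Y \<in> TF p" using X Y by (auto simp: horizontal_space_iff)
  note Z = tangent_space_lincomb[OF smooth_frame_atlas YT V]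
  have "h (\<lambda>C. 1 *\<^sub>R X C + v *\<^sub>R vphi p C) (\<lambda>C. 1 *\<^sub>R Y C + w *\<^sub>R vphi p C) =
      h (\<lambda>C. 1 *\<^sub>R Y C + w *\<^sub>R vphi p C) X + v * h (\<lambda>C. 1 *\<^sub>R Y C + w *\<^sub>R vphi p C) (vphi p)"
    unfolding sym_bilinear_onD(2)[OF b XT V Z]
      sym_bilinear_onD(1)[OF b XT Z] sym_bilinear_onD(1)[OF b V Z] by simp
  also have "\<dots> = h Y X + w * h (vphi p) X + v * (h Y (vphi p) + w * h (vphi p) (vphi p))"
    unfolding sym_bilinear_onD(2)[OF b YT V XT] sym_bilinear_onD(2)[OF b YT V V] by simp
  also have "\<dots> = h X Y + w * h X (vphi p) + v * (h Y (vphi p) + w * h (vphi p) (vphi p))"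
    unfolding sym_bilinear_onD(1)[OF b YT XT] sym_bilinear_onD(1)[OF b V XT] ..
  also have "\<dots> = g (fst p) (d\<pi> p X) (d\<pi> p Y) + v * w / (gauss_curvature A g (fst p))\<^sup>2"
    using h X Y VV by (simp add: is_wagner_def)
  finally show ?thesis .
qed

lemma is_wagner_unique:
  assumes p: "p \<in> FB" and "is_wagner p h" "is_wagner p h'" and X: "X \<in> TF p" and Y: "Y \<in> TF p"
  shows "h X Y = h' X Y"
proof -
  obtain X' v where X': "X' \<in> horizontal_space A g p" "X = (\<lambda>C. 1 *\<^sub>R X' C + v *\<^sub>R vphi p C)"
    by (rule horizontal_vertical_decomposition[OF p X])
  obtain Y' w where Y': "Y' \<in> horizontal_space A g p" "Y = (\<lambda>C. 1 *\<^sub>R Y' C + w *\<^sub>R vphi p C)"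
    by (rule horizontal_vertical_decomposition[OF p Y])
  show ?thesis
    unfolding X'(2) Y'(2) is_wagner_decomposition[OF p assms(2) X'(1) Y'(1)]
      is_wagner_decomposition[OF p assms(3) X'(1) Y'(1)] ..
qed

end

context surface_isometry
begin

lemma is_wagner_pullback:
  assumes p: "p \<in> FB" and h: "is_wagner (F p) h"
  shows "is_wagner p (\<lambda>X Y. h (dF p X) (dF p Y))"
proof -
  have b: "sym_bilinear_on (TF (F p)) h" using h by (simp add: is_wagner_def)
  have "sym_bilinear_on (TF p) (\<lambda>X Y. h (dF p X) (dF p Y))"
    unfolding sym_bilinear_on_def
  proof (intro conjI ballI allI)
    fix X Y assume X: "X \<in> TF p" and Y: "Y \<in> TF p"
    show "h (dF p X) (dF p Y) = h (dF p Y) (dF p X)"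
      by (rule sym_bilinear_onD(1)[OF b dF_in[OF p X] dF_in[OF p Y]])
    fix Z a r assume Z: "Z \<in> TF p"
    show "h (dF p (\<lambda>C. a *\<^sub>R X C + r *\<^sub>R Y C)) (dF p Z) = a * h (dF p X) (dF p Z) + r * h (dF p Y) (dF p Z)"
      unfolding dF_lincomb[OF p X Y]
      by (rule sym_bilinear_onD(2)[OF b dF_in[OF p X] dF_in[OF p Y] dF_in[OF p Z]])
  qed
  moreover have "h (dF p X) (dF p Y) = g (fst p) (d\<pi> p X) (d\<pi> p Y)"
    if X: "X \<in> horizontal_space A g p" and Y: "Y \<in> horizontal_space A g p" for X Y
  proof -
    have XT: "X \<in> TF p" and YT: "Y \<in> TF p" using X Y by (auto simp: horizontal_space_iff)
    have "h (dF p X) (dF p Y) = g (f (fst p)) (d\<pi> (F p) (dF p X)) (d\<pi> (F p) (dF p Y))"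
      using h dF_horizontal[OF p X] dF_horizontal[OF p Y] by (simp add: is_wagner_def)
    then show ?thesis
      unfolding proj_dF[OF p XT] proj_dF[OF p YT]
      using isometric[OF frame_bundle_sel(1)[OF p] proj_in[OF p XT] proj_in[OF p YT]] by simp
  qed
  moreover have "h (dF p X) (dF p Y) = 0"
    if X: "X \<in> horizontal_space A g p" and Y: "Y \<in> vertical_space A g p" for X Y
    using h dF_horizontal[OF p X] dF_vertical[OF p Y] by (simp add: is_wagner_def)
  moreover have "h (dF p (vphi p)) (dF p (vphi p)) = 1 / (gauss_curvature A g (fst p))\<^sup>2"
    using h gauss_curvature_invariant[OF frame_bundle_sel(1)[OF p]]
    by (simp add: dF_fundamental[OF p] is_wagner_def)
  ultimately show ?thesis by (simp add: is_wagner_def)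
qed

lemma wagner_lift_isometric:
  assumes p: "p \<in> FB" and X: "X \<in> TF p" and Y: "Y \<in> TF p"
  shows "wagner_lift A g (F p) (dF p X) (dF p Y) = wagner_lift A g p X Y"
proof -
  have w: "is_wagner q (wagner_lift A g q)" if "q \<in> FB" for q
    unfolding wagner_lift_eq by (rule someI_ex[OF is_wagner_exists[OF that]])
  show ?thesis
    by (rule is_wagner_unique[OF p is_wagner_pullback[OF p w[OF frame_map_in[OF p]]] w[OF p] X Y])
qed

end

section \<open>Restriction to frames over points of nonzero curvature\<close>

lemma frame_map_inverse:
  assumes f: "surface_isometry A g f" and h: "surface_isometry A g h"
    and hf: "\<And>x. x \<in> carrier_of A \<Longrightarrow> h (f x) = x" and p: "p \<in> frame_bundle A g"
  shows "frame_map A h (frame_map A f p) = p"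
proof -
  interpret I: surface_isometry A g f by (rule f)
  interpret J: surface_isometry A g h by (rule h)
  note x = I.frame_bundle_sel[OF p]
  obtain c where c: "c \<in> charts_at A (fst p)" using x(1) by (rule carrier_ofE)
  obtain d where d: "d \<in> charts_at A (f (fst p))" using I.f_in[OF x(1)] by (rule carrier_ofE)
  have "differential A A h (f (fst p)) (differential A A f (fst p) v) = v"
    if v: "v \<in> tangent_space A (fst p)" for v
  proof -
    have "differential A A h (f (fst p)) (differential A A f (fst p) v) = differential A A (h \<circ> f) (fst p) v"
      by (rule differential_comp[OF I.atlas I.atlas I.atlas I.smooth_f x(1) J.smooth_f I.f_in[OF x(1)] c d v])
    also have "\<dots> = differential A A (\<lambda>x. x) (fst p) v"
      by (rule fun_cong[OF differential_cong[OF I.atlas x(1)]]) (simp add: hf)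
    finally show ?thesis using differential_ident[OF I.atlas v] by simp
  qed
  then show ?thesis by (intro frame_eqI) (simp_all add: hf x)
qed

text \<open>In a frame chart over \<open>c\<close> the complement is a product: the image of
  \<open>fst c - Z\<close>, open because \<open>Z\<close> is closed, times the angle
  interval.\<close>

lemma (in oriented_surface) open_complement:
  assumes Z: "closedin (atlas_topology A) Z" and C: "C \<in> FA"
  shows "open (snd C ` (fst C \<inter> (FB - {p \<in> FB. fst p \<in> Z})))"
proof -
  obtain c s a where C': "C = frame_chart c s a" "c \<in> A" and s: "smooth_section A g c s"
    by (rule frame_atlasE[OF C])
  \<comment> \<open>Closedness makes the complement of \<open>Z\<close> in the topological space
    open, so the chart domain must first be located inside that space.\<close>
  have sub: "fst c \<subseteq> topspace (atlas_topology A)"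
  proof -
    have "M \<inter> fst d = fst d" if "d \<in> A" for d using that by (auto simp: carrier_of_def)
    then have "openin (atlas_topology A) M"
      unfolding openin_atlas_topology[OF atlas] using chart_is_chart by (auto simp: is_chart_def)
    then have "M \<subseteq> topspace (atlas_topology A)" by (rule openin_subset)
    then show ?thesis using C'(2) by (auto simp: carrier_of_def)
  qed
  have "open (snd c ` ((topspace (atlas_topology A) - Z) \<inter> fst c))"
    using Z C'(2) unfolding closedin_def openin_atlas_topology[OF atlas] by blast
  moreover have "(topspace (atlas_topology A) - Z) \<inter> fst c = fst c - Z" using sub by blast
  ultimately have op: "open ((snd c ` (fst c - Z)) \<times> {a - pi <..< a + pi})" by (auto intro: open_Times)
  have inD: "y \<in> (snd c ` (fst c - Z)) \<times> {a - pi <..< a + pi} \<longleftrightarrow> fst (frame_par c s y) \<notin> Z"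
    if y: "y \<in> frame_dom c a" for y
    using y chart_inv_left[OF chart_is_chart[OF C'(2)]] frame_par_in(2)[OF s y] by (cases y) (auto simp: frame_dom_def)
  have "snd C ` (fst C \<inter> (FB - {p \<in> FB. fst p \<in> Z})) = (snd c ` (fst c - Z)) \<times> {a - pi <..< a + pi}"
  proof (intro equalityI subsetI)
    fix y assume "y \<in> snd C ` (fst C \<inter> (FB - {p \<in> FB. fst p \<in> Z}))"
    then obtain p where p: "p \<in> fst C" "fst p \<notin> Z" "y = snd C p" by blast
    then obtain z where z: "z \<in> frame_dom c a" "fst (frame_par c s z) \<notin> Z" "y = snd C (frame_par c s z)"
      unfolding C'(1) by (auto simp: frame_chart_eq)
    then show "y \<in> (snd c ` (fst c - Z)) \<times> {a - pi <..< a + pi}"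
      using inD[OF z(1)] frame_chart_coord(1)[OF C'(2) s z(1)] unfolding C'(1) by metis
  next
    fix y assume y: "y \<in> (snd c ` (fst c - Z)) \<times> {a - pi <..< a + pi}"
    then have yd: "y \<in> frame_dom c a" by (auto simp: frame_dom_def)
    show "y \<in> snd C ` (fst C \<inter> (FB - {p \<in> FB. fst p \<in> Z}))"
      by (rule image_eqI[of _ _ "frame_par c s y"])
        (use inD[OF yd] y frame_chart_coord[OF C'(2) s yd] frame_par_in[OF s yd] in \<open>auto simp: C'(1)\<close>)
  qed
  then show ?thesis using op by simp
qed

theorem theorem3p1:
  fixes A :: "('m, real^2) chart set" and g :: "('m, real^2) metric"
    and Z :: "'m set" and Zhat :: "'m frame set" and f :: "'m \<Rightarrow> 'm"
  assumes "smooth_manifold A" and "oriented_atlas A" and "riemannian_metric A g"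
    and "Z = {x \<in> carrier_of A. gauss_curvature A g x = 0}"
    and "closedin (atlas_topology A) Z" and "submanifold A 1 Z"
    and "Zhat = {p \<in> frame_bundle A g. frame_proj p \<in> Z}"
    and "riemannian_isometry A (carrier_of A) g A (carrier_of A) g f"
    and "orientation_preserving A f"
  shows "riemannian_isometry
           (frame_atlas A g) (frame_bundle A g - Zhat) (wagner_lift A g)
           (frame_atlas A g) (frame_bundle A g - Zhat) (wagner_lift A g)
           (frame_map A f)"
proof -
  let ?M = "carrier_of A" and ?FA = "frame_atlas A g" and ?FB = "frame_bundle A g"
  define W where "W = ?FB - Zhat"
  define h where "h = inv_into ?M f"
  have bij: "bij_betw f ?M ?M" and h: "smooth_map A ?M A ?M h"
    using assms(8) by (auto simp: riemannian_isometry_def diffeomorphism_def h_def)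
  have hf: "h (f x) = x" if "x \<in> ?M" for x
    unfolding h_def by (rule bij_betw_inv_into_left[OF bij that])
  have fh: "f (h x) = x" if "x \<in> ?M" for x
    unfolding h_def by (rule bij_betw_inv_into_right[OF bij that])
  interpret I: surface_isometry A g f
    by unfold_locales
      (use assms in \<open>auto simp: smooth_manifold_def riemannian_isometry_def diffeomorphism_def\<close>)
  interpret J: surface_isometry A g h by (rule I.surface_isometry_inverse[OF h fh])
  note I = I.surface_isometry_axioms and J = J.surface_isometry_axioms
  have W_iff: "p \<in> W \<longleftrightarrow> p \<in> ?FB \<and> gauss_curvature A g (fst p) \<noteq> 0" for p
    using I.frame_bundle_sel(1)[of p] by (auto simp: W_def assms(4,7))
  \<comment> \<open>For arbitrary \<open>k\<close>, because it is used for \<open>f\<close> and for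
    its inverse \<open>h\<close>; invariance of the curvature keeps the image off
    \<open>Zhat\<close>.\<close>
  have map_W: "frame_map A k ` W \<subseteq> W" if "surface_isometry A g k" for k
  proof (rule image_subsetI)
    fix p assume "p \<in> W"
    then have p: "p \<in> ?FB" "gauss_curvature A g (fst p) \<noteq> 0" by (auto simp: W_iff)
    then show "frame_map A k p \<in> W"
      using surface_isometry.frame_map_in[OF that p(1)]
        surface_isometry.gauss_curvature_invariant[OF that I.frame_bundle_sel(1)[OF p(1)]]
      by (simp add: W_iff)
  qed
  have inv1: "frame_map A h (frame_map A f p) = p" if "p \<in> W" for p
    using frame_map_inverse[OF I J hf] that by (simp add: W_iff)
  have inv2: "frame_map A f (frame_map A h p) = p" if "p \<in> W" for p
    using frame_map_inverse[OF J I fh] that by (simp add: W_iff)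
  have bijF: "bij_betw (frame_map A f) W W"
    by (rule bij_betw_byWitness[where f' = "frame_map A h"]) (use inv1 inv2 map_W I J in auto)
  \<comment> \<open>The functions agree only on \<open>W\<close>, and \<open>diffeomorphism\<close>
    speaks of \<open>inv_into\<close>; smoothness is therefore transferred by
    \<open>smooth_map_cong\<close>.\<close>
  have inv: "frame_map A h p = inv_into W (frame_map A f) p" if p: "p \<in> W" for p
  proof -
    have "frame_map A h p \<in> W" using map_W[OF J] p by blast
    then show ?thesis
      using inv_into_f_f[OF bij_betw_imp_inj_on[OF bijF], of "frame_map A h p"] inv2[OF p] by simp
  qed
  have open_W: "open (snd C ` (fst C \<inter> W))" if "C \<in> ?FA" for C
    using I.open_complement[OF assms(5) that] by (simp add: W_def assms(7))
  have smooth: "smooth_map ?FA W ?FA W (frame_map A k)" if "surface_isometry A g k" for k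
    by (rule smooth_map_restrict[OF I.smooth_frame_atlas surface_isometry.smooth_frame_map[OF that] _ map_W[OF that] open_W])
      (auto simp: W_def)
  have "smooth_map ?FA W ?FA W (inv_into W (frame_map A f))"
    by (rule smooth_map_cong[OF I.smooth_frame_atlas smooth[OF J] inv])
  then show ?thesis
    unfolding riemannian_isometry_def diffeomorphism_def W_def[symmetric]
    using bijF smooth[OF I] I.wagner_lift_isometric by (auto simp: W_iff)
qed

end
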